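(* The maximum likelihood threshold of a generic linear subspace $L \subseteq \mathcal{S}^n$ is equal to its generic completion rank. That is, for every $n\ge1$ and $1\le m\le\binom{n+1}{2}$ there is a Zariski-closed proper subset $E\subset\mathrm{Gr}(m,\mathcal{S}^n)$ such that for every $L\in\mathrm{Gr}(m,\mathcal{S}^n)\setminus E$ with $L\cap\mathcal{S}^n_{++}\ne\emptyset$, one has $\mathrm{MLT}(L)=\mathrm{GCR}(L)$.
   Context: $\mathcal{S}^n$ is the vector space of real symmetric $n\times n$ matrices with inner product $\mathrm{Tr}(AB)$; $\mathcal{S}^n_{++}$ is the cone of positive definite matrices, and $\mathcal{S}^n_0(d)$ the set of matrices in $\mathcal{S}^n$ of rank exactly $d$. $\mathrm{Gr}(m,\mathcal{S}^n)$ is the Grassmannian of $m$-dimensional linear subspaces of $\mathcal{S}^n$, viewed as a real projective variety via Plücker coordinates. The generic completion rank $\mathrm{GCR}(L)$ is the minimum $d$ such that $\pi_L(\mathcal{S}^n_0(d))$ is full-dimensional in $L$, where $\pi_L:\mathcal{S}^n\to L$ is orthogonal projection. For $L$ with $L\cap\mathcal{S}^n_{++}\neq\emptyset$, the maximum likelihood threshold $\mathrm{MLT}(L)$ is the minimum $d$ such that the problem of minimizing $\mathrm{Tr}(SK)-\log\det K$ over $K\in L\cap\mathcal{S}^n_{++}$ has a solution (the minimum is attained) for all $S$ in some nonempty Zariski-open subset of the set of positive semidefinite matrices of rank exactly $d$. *)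

theory Defs
  imports "HOL-Analysis.Analysis"
begin

text \<open>The size n of the matrices is CARD('n).\<close>

definition sym_mats :: "(real^'n^'n) set" where
  "sym_mats = {A. transpose A = A}"

definition psd_mats :: "(real^'n^'n) set" where
  "psd_mats = {A \<in> sym_mats. \<forall>x. 0 \<le> x \<bullet> (A *v x)}"

definition pd_mats :: "(real^'n^'n) set" where
  "pd_mats = {A \<in> sym_mats. \<forall>x. x \<noteq> 0 \<longrightarrow> 0 < x \<bullet> (A *v x)}"

text \<open>The library inner product on matrices restricts to the trace form.\<close>

lemma inner_sym_mats_eq_trace:
  fixes A B :: "real^'n^'n"
  assumes "A \<in> sym_mats"
  shows "A \<bullet> B = trace (A ** B)"
proof -
  have "A \<bullet> B = trace (transpose A ** B)"
    unfolding trace_def matrix_matrix_mult_def transpose_def inner_vec_def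
    by (simp add: sum.swap[of "\<lambda>i j. A $ i $ j * B $ i $ j"])
  then show ?thesis
    using assms by (simp add: sym_mats_def)
qed

definition orth_proj :: "'a::euclidean_space set \<Rightarrow> 'a \<Rightarrow> 'a" where
  "orth_proj L x = (THE y. y \<in> L \<and> (\<forall>z\<in>L. orthogonal (x - y) z))"

lemma orth_proj_unique_existence:
  fixes L :: "'a::euclidean_space set"
  assumes "subspace L"
  shows "\<exists>!y. y \<in> L \<and> (\<forall>z\<in>L. orthogonal (x - y) z)"
proof -
  have span: "span L = L"
    using assms by (simp add: span_eq_iff)
  obtain y z where yz: "y \<in> span L" "\<And>w. w \<in> span L \<Longrightarrow> orthogonal z w" "x = y + z"
    using orthogonal_subspace_decomp_exists[of L x] by blast
  show ?thesis
  proof (rule ex1I)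
    show "y \<in> L \<and> (\<forall>w\<in>L. orthogonal (x - y) w)"
      using yz span by simp
  next
    fix y' assume y': "y' \<in> L \<and> (\<forall>w\<in>L. orthogonal (x - y') w)"
    have "y' - y \<in> L"
      using y' yz(1) span assms by (simp add: subspace_diff)
    then have "orthogonal (x - y) (y' - y)" "orthogonal (x - y') (y' - y)"
      using y' yz span by auto
    then have "(y' - y) \<bullet> (y' - y) = 0"
      by (simp add: orthogonal_def inner_diff_left)
    then show "y' = y" by simp
  qed
qed

text \<open>
  The image of the rank d locus under the projection is semialgebraic, so being
  full-dimensional in L means having an interior point relative to L.
\<close>

definition full_dimensional_in :: "'a::euclidean_space set \<Rightarrow> 'a set \<Rightarrow> bool" where
  "full_dimensional_in L X \<longleftrightarrow> (top_of_set L) interior_of X \<noteq> {}"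

definition GCR :: "(real^'n^'n) set \<Rightarrow> nat" where
  "GCR L = (LEAST d. full_dimensional_in L (orth_proj L ` {A \<in> sym_mats. rank A = d}))"

definition zariski_open_in :: "'a::euclidean_space set \<Rightarrow> 'a set \<Rightarrow> bool" where
  "zariski_open_in X U \<longleftrightarrow>
     (\<exists>P. (\<forall>p\<in>P. real_polynomial_function p) \<and> U = {x \<in> X. \<exists>p\<in>P. p x \<noteq> 0})"

definition neg_log_lik :: "real^'n^'n \<Rightarrow> real^'n^'n \<Rightarrow> real" where
  "neg_log_lik S K = trace (S ** K) - ln (det K)"

definition MLE_exists :: "(real^'n^'n) set \<Rightarrow> real^'n^'n \<Rightarrow> bool" where
  "MLE_exists L S \<longleftrightarrow>
     (\<exists>K \<in> L \<inter> pd_mats. \<forall>K' \<in> L \<inter> pd_mats. neg_log_lik S K \<le> neg_log_lik S K')"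

definition MLT :: "(real^'n^'n) set \<Rightarrow> nat" where
  "MLT L = (LEAST d. \<exists>U. zariski_open_in {S \<in> psd_mats. rank S = d} U \<and> U \<noteq> {} \<and>
                         (\<forall>S\<in>U. MLE_exists L S))"

definition grassmannian :: "nat \<Rightarrow> (real^'n^'n) set set" where
  "grassmannian m = {L. subspace L \<and> L \<subseteq> sym_mats \<and> dim L = m}"

definition is_basis_of :: "('m \<Rightarrow> 'a::euclidean_space) \<Rightarrow> 'a set \<Rightarrow> bool" where
  "is_basis_of v L \<longleftrightarrow> inj v \<and> independent (range v) \<and> span (range v) = L"

text \<open>
  Pluecker coordinates of the span of m = CARD('m) matrices.  They are indexed by all m-tuples f
  of matrix positions: the coordinate at f is the m by m minor, at the positions f, of the matrix
  whose rows are the m given matrices written as vectors of entries.  This is redundant: permuting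
  f or transposing one of its positions changes the coordinate at most by a sign, and a repeated
  position gives 0.  Up to these repetitions they are the usual coordinates, indexed by the
  m-element sets of positions on or above the diagonal.
\<close>

definition pluecker :: "('m::finite \<Rightarrow> real^'n^'n) \<Rightarrow> real^('m \<Rightarrow> 'n \<times> 'n)" where
  "pluecker v = (\<chi> f. det (\<chi> a b. v a $ fst (f b) $ snd (f b)))"

definition homogeneous_polynomial :: "('a::euclidean_space \<Rightarrow> real) \<Rightarrow> bool" where
  "homogeneous_polynomial p \<longleftrightarrow>
     real_polynomial_function p \<and> (\<exists>d::nat. \<forall>c x. p (c *\<^sub>R x) = c ^ d * p x)"

text \<open>
  A change of basis multiplies the Pluecker vector by a nonzero scalar, so by homogeneity the
  vanishing condition does not depend on the choice of the basis v.
\<close>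

definition zariski_closed_grassmannian :: "'m::finite itself \<Rightarrow> (real^'n^'n) set set \<Rightarrow> bool" where
  "zariski_closed_grassmannian _ E \<longleftrightarrow>
     (\<exists>P :: (real^('m \<Rightarrow> 'n \<times> 'n) \<Rightarrow> real) set.
        (\<forall>p\<in>P. homogeneous_polynomial p) \<and>
        E = {L \<in> grassmannian CARD('m).
               \<forall>v :: 'm \<Rightarrow> real^'n^'n. is_basis_of v L \<longrightarrow> (\<forall>p\<in>P. p (pluecker v) = 0)})"

end

theory Submission
  imports Defs
begin

text \<open>
  Write N = n(n+1)/2, let L be a subspace of dimension m, and let \<rho> be the least rank r with
  m + (n-r)(n-r+1)/2 \<le> N.  Both thresholds of a generic L equal \<rho>.  The dimension count compares L
  with the symmetric matrices that vanish on the range of a given matrix S of rank r.  These form a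
  space of dimension (n-r)(n-r+1)/2; it is the orthogonal complement of the tangent space at S of the
  matrices of rank r, and S has a maximum likelihood estimate as soon as it meets L in 0
  (\<open>MLE_exists_if_no_kernel\<close>), and has none if it meets L in a nonzero positive
  semidefinite matrix (\<open>not_MLE_exists\<close>).

  For r = \<rho> the intersection is 0 for generic L and S.  So the estimate exists generically, and the
  projection to L of the matrices of rank \<rho> is a submersion at S, hence has full-dimensional image
  (\<open>full_dimensional_if_no_kernel\<close>).  For r < \<rho> the matrices of rank r have dimension less
  than m, so GCR(L) > r (\<open>not_full_dimensional\<close>).

  The remaining inequality MLT(L) \<ge> \<rho> needs a positive semidefinite matrix in the intersection, for a
  Zariski dense set of S of rank r < \<rho>.  Say that a set of j indices is a positive definite face of L
  if for an open set of coordinate systems some matrix in L is positive definite on the span of the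
  corresponding j coordinate vectors and vanishes on the others (\<open>pd_face\<close>).  Since L contains a
  positive definite matrix, all n indices form one.  From a face of size j one descends as follows.
  On a generic span in the open set take a pencil X1 - t X0 in L with X0 positive definite there.  At
  its largest root t the matrix t X0 - X1 is positive semidefinite of rank less than j.  If it is
  regular, that is, if L meets the space of symmetric matrices with the same column space
  transversally, then it deforms along with its column space and gives a smaller face
  (\<open>pd_face_of_regular\<close>).  Regularity at all roots of the pencil is the nonvanishing of one
  polynomial in a basis of L, the coordinate system and the two members of the pencil
  (\<open>pencil_polynomial\<close>).  An explicit diagonal pencil shows that this polynomial is nonzero as
  long as m < N and j(j-1)/2 > N - m (\<open>regular_diagonal_pencil\<close>).  The descent therefore only
  stops at a face with j(j-1)/2 \<le> N - m, which means j \<le> n - r for every r < \<rho>; for m = N a single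
  index is a face.  Consequently a Zariski dense set of S of rank r is annihilated by a nonzero positive
  semidefinite matrix in L (\<open>generic_MLE_fails\<close>).

  All genericity conditions are finitely many polynomial conditions on a basis of L.  Such a condition
  that holds for one basis of one subspace holds for some basis of every L outside a proper Zariski
  closed subset of the Grassmannian, because a basis of L depends linearly on the Pluecker coordinates
  (\<open>generic_basis\<close>).
\<close>

section \<open>Polynomial functions\<close>

text \<open>The coefficients of a product are convolutions of the coefficients of the factors, so their
  polynomial dependence on base point and direction survives the inductive construction.\<close>

lemma real_polynomial_function_along_line:
  fixes p :: "'a::euclidean_space \<Rightarrow> real"
  assumes "real_polynomial_function p"
  obtains D :: nat and c :: "nat \<Rightarrow> 'a \<times> 'a \<Rightarrow> real"
  where "\<And>i. real_polynomial_function (c i)" "\<And>x y t. p (x + t *\<^sub>R y) = (\<Sum>i\<le>D. c i (x, y) * t ^ i)"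
proof -
  have "\<exists>D c. (\<forall>i. real_polynomial_function (c i)) \<and> (\<forall>i>D. c i = (\<lambda>_. 0)) \<and>
     (\<forall>x y t. p (x + t *\<^sub>R y) = (\<Sum>i\<le>D. c i (x, y) * t ^ i))"
    using assms
  proof induction
    case (linear h)
    define c where "c = (\<lambda>i::nat. if i = 0 then (\<lambda>z. h (fst z)) else if i = 1 then (\<lambda>z. h (snd z)) else (\<lambda>_. 0))"
    have "real_polynomial_function (c i)" for i
      using linear bounded_linear_compose[OF linear bounded_linear_fst]
        bounded_linear_compose[OF linear bounded_linear_snd]
      by (auto simp: c_def)
    moreover have "h (x + t *\<^sub>R y) = (\<Sum>i\<le>1. c i (x, y) * t ^ i)" for x y t
      by (simp add: c_def linear_simps[OF linear])
    moreover have "\<forall>i>1. c i = (\<lambda>_. 0)" by (simp add: c_def)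
    ultimately show ?case by blast
  next
    case (const a)
    show ?case
      by (rule exI[of _ 0], rule exI[of _ "\<lambda>i. if i = 0 then (\<lambda>_. a) else (\<lambda>_. 0)"]) auto
  next
    case (add f g)
    then obtain D c D' c' where
      c: "\<forall>i. real_polynomial_function (c i)" "\<forall>i>D. c i = (\<lambda>_. 0)"
        "\<forall>x y t. f (x + t *\<^sub>R y) = (\<Sum>i\<le>D. c i (x, y) * t ^ i)" and
      c': "\<forall>i. real_polynomial_function (c' i)" "\<forall>i>D'. c' i = (\<lambda>_. 0)"
        "\<forall>x y t. g (x + t *\<^sub>R y) = (\<Sum>i\<le>D'. c' i (x, y) * t ^ i)" by blast
    let ?M = "max D D'"
    have pad: "(\<Sum>i\<le>D. c i z * t ^ i) = (\<Sum>i\<le>?M. c i z * t ^ i)" for z t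
      by (rule sum.mono_neutral_left) (use c(2) in auto)
    have pad': "(\<Sum>i\<le>D'. c' i z * t ^ i) = (\<Sum>i\<le>?M. c' i z * t ^ i)" for z t
      by (rule sum.mono_neutral_left) (use c'(2) in auto)
    show ?case
    proof (rule exI[of _ ?M], rule exI[of _ "\<lambda>i z. c i z + c' i z"], intro conjI allI impI)
      show "f (x + t *\<^sub>R y) + g (x + t *\<^sub>R y) = (\<Sum>i\<le>?M. (c i (x, y) + c' i (x, y)) * t ^ i)" for x y t
        by (simp only: c(3)[rule_format] c'(3)[rule_format] pad pad' distrib_right sum.distrib)
    qed (use c c' in auto)
  next
    case (mult f g)
    then obtain D c D' c' where
      c: "\<forall>i. real_polynomial_function (c i)" "\<forall>i>D. c i = (\<lambda>_. 0)"
        "\<forall>x y t. f (x + t *\<^sub>R y) = (\<Sum>i\<le>D. c i (x, y) * t ^ i)" and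
      c': "\<forall>i. real_polynomial_function (c' i)" "\<forall>i>D'. c' i = (\<lambda>_. 0)"
        "\<forall>x y t. g (x + t *\<^sub>R y) = (\<Sum>i\<le>D'. c' i (x, y) * t ^ i)" by blast
    show ?case
    proof (rule exI[of _ "D + D'"], rule exI[of _ "\<lambda>r z. \<Sum>k\<le>r. c k z * c' (r - k) z"], intro conjI allI impI)
      show "f (x + t *\<^sub>R y) * g (x + t *\<^sub>R y)
          = (\<Sum>r\<le>D + D'. (\<Sum>k\<le>r. c k (x, y) * c' (r - k) (x, y)) * t ^ r)" for x y t
        unfolding c(3)[rule_format] c'(3)[rule_format]
        by (rule polynomial_product) (use c(2) c'(2) in auto)
      show "real_polynomial_function (\<lambda>z. \<Sum>k\<le>r. c k z * c' (r - k) z)" for r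
        using c(1) c'(1) by (intro real_polynomial_function_sum real_polynomial_function.intros(4)) auto
      show "(\<lambda>z. \<Sum>k\<le>r. c k z * c' (r - k) z) = (\<lambda>_. 0)" if "r > D + D'" for r
      proof (rule ext, rule sum.neutral, safe)
        fix z k assume "k \<le> r"
        then have "k > D \<or> r - k > D'" using that by linarith
        then show "c k z * c' (r - k) z = 0" using c(2) c'(2) by auto
      qed
    qed
  qed
  then obtain D c where "\<forall>i. real_polynomial_function (c i)"
    "\<forall>x y t. p (x + t *\<^sub>R y) = (\<Sum>i\<le>D. c i (x, y) * t ^ i)" by auto
  then show ?thesis using that[of c D] by simp
qed

text \<open>The components are the coefficients along lines through 0; their homogeneity follows by comparing
  the expansions of p (t a x) in t.\<close>

lemma real_polynomial_function_homogeneous_components: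
  fixes p :: "'a::euclidean_space \<Rightarrow> real"
  assumes "real_polynomial_function p"
  obtains D :: nat and h :: "nat \<Rightarrow> 'a \<Rightarrow> real"
  where "\<And>i. i \<le> D \<Longrightarrow> real_polynomial_function (h i)" "\<And>i c x. i \<le> D \<Longrightarrow> h i (c *\<^sub>R x) = c ^ i * h i x"
    "\<And>x t. p (t *\<^sub>R x) = (\<Sum>i\<le>D. h i x * t ^ i)"
proof -
  obtain D c where c: "\<And>i. real_polynomial_function (c i)"
    and p: "\<And>x y t. p (x + t *\<^sub>R y) = (\<Sum>i\<le>D. c i (x, y) * t ^ i)"
    by (rule real_polynomial_function_along_line[OF assms]) (rule that)
  define h where "h = (\<lambda>i x. c i (0, x))"
  have "bounded_linear (\<lambda>x::'a. (0::'a, x))"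
    by (intro bounded_linear_Pair bounded_linear_zero bounded_linear_ident)
  then have h: "real_polynomial_function (h i)" for i
    using real_polynomial_function_compose[OF polynomial_function_bounded_linear c[of i]]
    by (simp add: h_def o_def)
  have ph: "p (t *\<^sub>R x) = (\<Sum>i\<le>D. h i x * t ^ i)" for t x
    using p[of 0 t x] by (simp add: h_def)
  have "h i (a *\<^sub>R x) = a ^ i * h i x" if "i \<le> D" for i a x
  proof -
    have "(\<Sum>i\<le>D. h i (a *\<^sub>R x) * t ^ i) = (\<Sum>i\<le>D. (a ^ i * h i x) * t ^ i)" for t
      using ph[of t "a *\<^sub>R x"] ph[of "t * a" x]
      by (simp add: power_mult_distrib mult_ac)
    then show ?thesis
      using polyfun_eq_coeffs[of "\<lambda>i. h i (a *\<^sub>R x)" D "\<lambda>i. a ^ i * h i x"] that by simp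
  qed
  then show ?thesis using that[of D h] h ph by simp
qed

text \<open>A polynomial function that vanishes near x vanishes along every line through x, hence
  everywhere.\<close>

lemma real_polynomial_function_nonzero_in_open:
  fixes p :: "'a::euclidean_space \<Rightarrow> real"
  assumes "real_polynomial_function p" "p y \<noteq> 0" "open U" "U \<noteq> {}"
  obtains x where "x \<in> U" "p x \<noteq> 0"
proof (rule ccontr)
  assume "\<not> thesis"
  then have zero: "\<And>x. x \<in> U \<Longrightarrow> p x = 0" using that by blast
  obtain D c where "\<And>i. real_polynomial_function (c i)"
    and p: "\<And>x y t. p (x + t *\<^sub>R y) = (\<Sum>i\<le>D. c i (x, y) * t ^ i)"
    by (rule real_polynomial_function_along_line[OF assms(1)]) (rule that)
  obtain x where x: "x \<in> U" using assms(4) by blast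
  define a where "a = (\<lambda>i. c i (x, y - x))"
  have pt: "p (x + t *\<^sub>R (y - x)) = (\<Sum>i\<le>D. a i * t ^ i)" for t
    by (simp add: p a_def)
  have "open ((\<lambda>t::real. x + t *\<^sub>R (y - x)) -` U)"
    by (intro open_vimage continuous_intros assms)
  moreover have "0 \<in> (\<lambda>t::real. x + t *\<^sub>R (y - x)) -` U" using x by simp
  ultimately have "infinite ((\<lambda>t::real. x + t *\<^sub>R (y - x)) -` U)"
    using not_open_singleton finite_imp_not_open by blast
  moreover have "(\<lambda>t::real. x + t *\<^sub>R (y - x)) -` U \<subseteq> {t. (\<Sum>i\<le>D. a i * t ^ i) = 0}"
    unfolding pt[symmetric] using zero by auto
  ultimately have "infinite {t. (\<Sum>i\<le>D. a i * t ^ i) = 0}" using finite_subset by blast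
  then have "\<forall>i\<le>D. a i = 0" using polyfun_finite_roots by blast
  then have "p y = 0" using pt[of 1] by simp
  then show False using assms by simp
qed

lemma real_polynomial_function_prod_nonzero:
  fixes p :: "'i \<Rightarrow> 'a::euclidean_space \<Rightarrow> real"
  assumes "finite I" "\<And>i. i \<in> I \<Longrightarrow> real_polynomial_function (p i)" "\<And>i. i \<in> I \<Longrightarrow> \<exists>x. p i x \<noteq> 0"
  obtains x where "\<And>i. i \<in> I \<Longrightarrow> p i x \<noteq> 0"
proof -
  have "\<exists>U. open U \<and> U \<noteq> {} \<and> (\<forall>x\<in>U. \<forall>i\<in>I. p i x \<noteq> 0)"
    using assms
  proof (induction I)
    case empty
    then show ?case by (intro exI[of _ UNIV]) auto
  next
    case (insert i I)
    then obtain U where U: "open U" "U \<noteq> {}" "\<forall>x\<in>U. \<forall>i\<in>I. p i x \<noteq> 0" by blast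
    obtain y where "p i y \<noteq> 0" using insert.prems by blast
    then obtain x where x: "x \<in> U" "p i x \<noteq> 0"
      using real_polynomial_function_nonzero_in_open U(1,2) insert.prems(1) by blast
    have "continuous_on UNIV (p i)"
      using insert.prems(1) continuous_on_polymonial_function real_polynomial_function_eq by blast
    then have "open (p i -` (- {0}))" by (intro open_vimage) auto
    then show ?case using U x by (intro exI[of _ "U \<inter> p i -` (- {0})"]) auto
  qed
  then show ?thesis using that by blast
qed

text \<open>In names, rpf and pf stand for real-valued and vector-valued polynomial functions.\<close>

lemma continuous_on_rpf:
  fixes p :: "'a::euclidean_space \<Rightarrow> real"
  shows "real_polynomial_function p \<Longrightarrow> continuous_on S p"
  using continuous_on_polymonial_function real_polynomial_function_eq by blast

lemma polynomial_function_vecI: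
  fixes f :: "'a::euclidean_space \<Rightarrow> 'b::euclidean_space ^ 'k"
  assumes "\<And>i. polynomial_function (\<lambda>x. f x $ i)"
  shows "polynomial_function f"
  unfolding polynomial_function_iff_Basis_inner
proof
  fix b :: "'b ^ 'k" assume "b \<in> Basis"
  then obtain i u where b: "b = axis i u" "u \<in> Basis" by (auto simp: Basis_vec_def)
  have "real_polynomial_function (\<lambda>x. f x $ i \<bullet> u)"
    using assms[of i] b(2) unfolding polynomial_function_iff_Basis_inner by blast
  then show "real_polynomial_function (\<lambda>x. f x \<bullet> b)" by (simp add: b(1) inner_axis)
qed

lemma polynomial_function_vecD:
  fixes f :: "'a::euclidean_space \<Rightarrow> 'b::euclidean_space ^ 'k"
  assumes "polynomial_function f"
  shows "polynomial_function (\<lambda>x. f x $ i)"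
  using polynomial_function_compose[OF assms polynomial_function_bounded_linear[OF bounded_linear_vec_nth]]
  by (simp add: o_def)

lemma rpf_vec_nth: "polynomial_function f \<Longrightarrow> real_polynomial_function (\<lambda>x. f x $ i)"
  for f :: "'a::euclidean_space \<Rightarrow> real ^ 'k"
  using polynomial_function_vecD real_polynomial_function_eq by metis

lemma rpf_mat_nth: "polynomial_function f \<Longrightarrow> real_polynomial_function (\<lambda>x. f x $ i $ j)"
  for f :: "'a::euclidean_space \<Rightarrow> real ^ 'k ^ 'l"
  using polynomial_function_vecD real_polynomial_function_eq by metis

lemma polynomial_function_vec_lambda:
  fixes f :: "'a::euclidean_space \<Rightarrow> 'k::finite \<Rightarrow> 'b::euclidean_space"
  assumes "\<And>i. polynomial_function (\<lambda>x. f x i)"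
  shows "polynomial_function (\<lambda>x. \<chi> i. f x i)"
  using assms by (intro polynomial_function_vecI) simp

lemma rpf_imp_pf: "real_polynomial_function p \<Longrightarrow> polynomial_function p"
  by (simp add: real_polynomial_function_eq)

lemma rpf_det:
  fixes A :: "'a::euclidean_space \<Rightarrow> real ^ 'k ^ 'k"
  assumes "polynomial_function A"
  shows "real_polynomial_function (\<lambda>x. det (A x))"
  unfolding det_def using rpf_mat_nth[OF assms]
  by (intro real_polynomial_function_sum real_polynomial_function.intros(4) real_polynomial_function_prod)
     (auto simp: finite_permutations)

lemma polynomial_function_scaleR [intro]:
  fixes f :: "'a::euclidean_space \<Rightarrow> real" and g :: "'a \<Rightarrow> 'b::euclidean_space"
  assumes "real_polynomial_function f" "polynomial_function g"
  shows "polynomial_function (\<lambda>x. f x *\<^sub>R g x)"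
  by (rule polynomial_function_mult) (use assms real_polynomial_function_eq in auto)

lemma polynomial_function_matrix_mult:
  fixes A :: "'a::euclidean_space \<Rightarrow> real ^ 'k ^ 'l" and B :: "'a \<Rightarrow> real ^ 'j ^ 'k"
  assumes "polynomial_function A" "polynomial_function B"
  shows "polynomial_function (\<lambda>x. A x ** B x)"
  unfolding matrix_matrix_mult_def
  by (intro polynomial_function_vec_lambda rpf_imp_pf real_polynomial_function_sum
      real_polynomial_function.intros(4) rpf_mat_nth assms) auto

lemma polynomial_function_transpose:
  fixes A :: "'a::euclidean_space \<Rightarrow> real ^ 'k ^ 'l"
  assumes "polynomial_function A"
  shows "polynomial_function (\<lambda>x. transpose (A x))"
  unfolding transpose_def
  by (intro polynomial_function_vec_lambda rpf_imp_pf rpf_mat_nth assms)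

lemma polynomial_function_bounded_linear_compose:
  fixes f :: "'a::euclidean_space \<Rightarrow> 'b::euclidean_space" and h :: "'b \<Rightarrow> 'c::euclidean_space"
  assumes "linear h" "polynomial_function f"
  shows "polynomial_function (\<lambda>x. h (f x))"
  using polynomial_function_compose[OF assms(2) polynomial_function_bounded_linear[OF linear_conv_bounded_linear[THEN iffD1, OF assms(1)]]]
  by (simp add: o_def)

lemma polynomial_function_Pair:
  fixes f :: "'a::euclidean_space \<Rightarrow> 'b::euclidean_space" and g :: "'a \<Rightarrow> 'c::euclidean_space"
  assumes "polynomial_function f" "polynomial_function g"
  shows "polynomial_function (\<lambda>x. (f x, g x))"
  using assms unfolding polynomial_function_iff_Basis_inner
  by (auto simp: Basis_prod_def)

lemma rpf_compose:
  fixes f :: "'a::euclidean_space \<Rightarrow> 'b::euclidean_space"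
  assumes "real_polynomial_function p" "polynomial_function f"
  shows "real_polynomial_function (\<lambda>x. p (f x))"
  using real_polynomial_function_compose[OF assms(2,1)] by (simp add: o_def)

lemma polynomial_function_fst: "polynomial_function f \<Longrightarrow> polynomial_function (\<lambda>x. fst (f x))"
  and polynomial_function_snd: "polynomial_function f \<Longrightarrow> polynomial_function (\<lambda>x. snd (f x))"
  for f :: "'a::euclidean_space \<Rightarrow> 'b::euclidean_space \<times> 'c::euclidean_space"
  by (rule polynomial_function_bounded_linear_compose[OF bounded_linear.linear[OF bounded_linear_fst]],
      assumption,
      rule polynomial_function_bounded_linear_compose[OF bounded_linear.linear[OF bounded_linear_snd]])

lemmas pf_intros = polynomial_function_const polynomial_function_id polynomial_function_add
  polynomial_function_diff polynomial_function_sum polynomial_function_vec_lambda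
  polynomial_function_vecD polynomial_function_scaleR polynomial_function_matrix_mult
  polynomial_function_transpose polynomial_function_fst polynomial_function_snd
  polynomial_function_Pair rpf_imp_pf rpf_det rpf_mat_nth rpf_vec_nth

section \<open>Symmetric and positive semidefinite matrices\<close>

lemma inner_mv_transpose:
  fixes A :: "real^'k^'l"
  shows "(A *v x) \<bullet> y = x \<bullet> (transpose A *v y)"
  by (metis dot_lmul_matrix inner_commute transpose_matrix_vector)

lemma inner_matrix_trace:
  fixes A B :: "real^'k^'l"
  shows "A \<bullet> B = trace (transpose A ** B)"
  unfolding trace_def matrix_matrix_mult_def transpose_def inner_vec_def
  by (simp add: sum.swap[of "\<lambda>i j. A $ i $ j * B $ i $ j"])

lemma inner_matrix_mult_left:
  fixes A :: "real^'k^'l" and B :: "real^'j^'k"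
  shows "(A ** B) \<bullet> C = B \<bullet> (transpose A ** C)"
  by (simp add: inner_matrix_trace matrix_transpose_mul matrix_mul_assoc)

lemma inner_matrix_mult_right:
  fixes A :: "real^'k^'l" and B :: "real^'j^'k"
  shows "(A ** B) \<bullet> C = A \<bullet> (C ** transpose B)"
  by (simp add: inner_matrix_trace matrix_transpose_mul matrix_mul_assoc)
     (metis matrix_mul_assoc trace_mul_sym)

lemma inner_transpose:
  fixes A :: "real^'k^'l"
  shows "transpose A \<bullet> transpose B = A \<bullet> B"
  by (simp add: inner_vec_def transpose_def) (rule sum.swap)

lemma matrix_mult_add_right: "(A + B) ** (C::real^'j^'k) = A ** C + B ** C"
  by (simp add: vec_eq_iff matrix_matrix_mult_def sum.distrib distrib_right)

lemma linear_matrix_mult_left: "linear (\<lambda>X. (A::real^'k^'l) ** (X::real^'j^'k))"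
  and linear_matrix_mult_right: "linear (\<lambda>X. (X::real^'k^'l) ** (B::real^'j^'k))"
  by (auto intro!: linearI simp: vec_eq_iff matrix_matrix_mult_def sum_distrib_left algebra_simps
      sum.distrib)

lemma linear_transpose_real: "linear (transpose :: real^'k^'l \<Rightarrow> _)"
  by (auto intro!: linearI simp: vec_eq_iff transpose_def)

lemma subspace_sym_mats: "subspace sym_mats"
  unfolding sym_mats_def subspace_def
  by (auto simp: linear_0[OF linear_transpose_real] linear_add[OF linear_transpose_real]
      linear_scale[OF linear_transpose_real])

lemma sym_mats_congruence:
  assumes "A \<in> sym_mats" shows "transpose G ** A ** G \<in> sym_mats" "G ** A ** transpose G \<in> sym_mats"
  using assms by (simp_all add: sym_mats_def matrix_transpose_mul matrix_mul_assoc)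

lemma psd_mats_congruence:
  fixes A G :: "real^'n^'n"
  assumes "A \<in> psd_mats" shows "transpose G ** A ** G \<in> psd_mats"
proof -
  have "x \<bullet> ((transpose G ** A ** G) *v x) = (G *v x) \<bullet> (A *v (G *v x))" for x
    by (simp add: inner_mv_transpose matrix_vector_mul_assoc[symmetric])
  then show ?thesis using assms sym_mats_congruence(1)[of A G] unfolding psd_mats_def by simp
qed

lemma orthogonal_in_larger_subspace:
  fixes L M :: "'a::euclidean_space set"
  assumes L: "subspace L" and M: "subspace M" and sub: "L \<subseteq> M" "L \<noteq> M"
  obtains y where "y \<noteq> 0" "y \<in> M" "\<And>z. z \<in> L \<Longrightarrow> y \<bullet> z = 0"
proof -
  have span: "span L = L" "span M = M" using L M by (simp_all only: span_eq_iff)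
  moreover have "L \<subset> M" using sub by (rule psubsetI)
  ultimately have "span L \<subset> span M" by (simp only:)
  then obtain y where "y \<noteq> 0" "y \<in> span M" "\<And>z. z \<in> span L \<Longrightarrow> orthogonal y z"
    by (rule orthogonal_to_subspace_exists_gen) (rule that)
  then show ?thesis using that[of y] unfolding span by (simp add: orthogonal_def)
qed

text \<open>To first order in t the form at x + t y is 2 t times the value of the bilinear form at x and y.  If
  this were nonzero, the form would be negative for small t of one sign.\<close>

lemma nonneg_form_kernel:
  fixes M :: "real^'n^'n"
  assumes sym: "M \<in> sym_mats" and V: "subspace V"
    and nonneg: "\<And>y. y \<in> V \<Longrightarrow> 0 \<le> y \<bullet> (M *v y)"
    and x: "x \<in> V" "x \<bullet> (M *v x) = 0" and y: "y \<in> V"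
  shows "y \<bullet> (M *v x) = 0"
proof (rule ccontr)
  assume ne: "y \<bullet> (M *v x) \<noteq> 0"
  define a where "a = y \<bullet> (M *v x)"
  define b where "b = y \<bullet> (M *v y)"
  have xy: "x \<bullet> (M *v y) = a"
    unfolding a_def using sym inner_mv_transpose[of M x y] by (simp add: sym_mats_def inner_commute)
  have b: "b \<ge> 0" using nonneg[OF y] by (simp add: b_def)
  \<comment> \<open>The quadratic 2 t a + t^2 b is minimal at t = - a / b; b + 1 instead of b covers b = 0.\<close>
  define c where "c = b + 1"
  have c: "c > 0" using b by (simp add: c_def)
  define t where "t = - a / c"
  have "x + t *\<^sub>R y \<in> V" using V x y by (simp add: subspace_add subspace_scale)
  then have "0 \<le> (x + t *\<^sub>R y) \<bullet> (M *v (x + t *\<^sub>R y))" by (rule nonneg)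
  also have "\<dots> = 2 * t * a + t\<^sup>2 * b"
    using x(2) xy by (simp add: matrix_vector_right_distrib matrix_vector_mult_scaleR inner_add_left
        inner_add_right a_def b_def power2_eq_square algebra_simps)
  also have "\<dots> = a\<^sup>2 * (b - 2 * c) / c\<^sup>2"
    using c unfolding t_def by (simp add: field_simps power2_eq_square)
  also have "\<dots> < 0"
    using b c ne by (simp add: divide_less_0_iff mult_less_0_iff a_def c_def)
  finally show False by simp
qed

lemma psd_kernel:
  assumes "M \<in> psd_mats" "x \<bullet> (M *v x) = 0" shows "M *v x = 0"
proof -
  have "(M *v x) \<bullet> (M *v x) = 0"
    by (rule nonneg_form_kernel[of M UNIV]) (use assms in \<open>auto simp: psd_mats_def\<close>)
  then show ?thesis by simp
qed

text \<open>A unit vector that maximises the form on an invariant subspace is an eigenvector; its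
  orthogonal complement in that subspace is again invariant.\<close>

lemma orthonormal_eigenbasis:
  fixes A :: "real^'n^'n"
  assumes A: "A \<in> sym_mats" and V: "subspace V" and inv: "\<And>x. x \<in> V \<Longrightarrow> A *v x \<in> V"
  shows "\<exists>B. finite B \<and> B \<subseteq> V \<and> pairwise orthogonal B \<and> span B = V \<and>
    (\<forall>b\<in>B. norm b = 1 \<and> (\<exists>c. A *v b = c *\<^sub>R b))"
  using V inv
proof (induction "dim V" arbitrary: V rule: less_induct)
  case less
  show ?case
  proof (cases "V = {0}")
    case True
    then show ?thesis by (intro exI[of _ "{}"]) auto
  next
    case False
    then obtain v where v: "v \<in> V" "v \<noteq> 0" using subspace_0[OF less.prems(1)] by auto
    let ?S = "sphere 0 1 \<inter> V"
    have comp: "compact ?S" by (intro compact_Int_closed closed_subspace less.prems) auto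
    have "v /\<^sub>R norm v \<in> ?S"
      using v less.prems(1) by (auto intro: subspace_scale)
    then have ne: "?S \<noteq> {}" by blast
    have "continuous_on ?S (\<lambda>y. y \<bullet> (A *v y))"
      by (intro continuous_intros linear_continuous_on linear_linear[THEN iffD2]) auto
    then obtain x where x: "x \<in> ?S" and max: "\<And>y. y \<in> ?S \<Longrightarrow> y \<bullet> (A *v y) \<le> x \<bullet> (A *v x)"
      using continuous_attains_sup[OF comp ne] by blast
    define c where "c = x \<bullet> (A *v x)"
    define M where "M = c *\<^sub>R mat 1 - A"
    have Mv: "M *v y = c *\<^sub>R y - A *v y" for y
      by (simp add: M_def matrix_vector_mult_diff_rdistrib flip: scaleR_matrix_vector_assoc)
    have symM: "M \<in> sym_mats"
      using A unfolding M_def sym_mats_def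
      by (simp add: linear_diff[OF linear_transpose_real] linear_scale[OF linear_transpose_real])
    have "0 \<le> y \<bullet> (M *v y)" if "y \<in> V" for y
    proof (cases "y = 0")
      case False
      have "y /\<^sub>R norm y \<in> ?S"
        using False that less.prems(1) by (auto intro: subspace_scale)
      then have "(y /\<^sub>R norm y) \<bullet> (A *v (y /\<^sub>R norm y)) \<le> c" using max c_def by blast
      then have "(y \<bullet> (A *v y)) / (norm y)\<^sup>2 \<le> c"
        by (simp add: matrix_vector_mult_scaleR power2_eq_square divide_inverse mult_ac)
      then have "y \<bullet> (A *v y) \<le> c * (norm y)\<^sup>2" using False by (simp add: field_simps)
      then show ?thesis by (simp add: Mv inner_diff_right power2_norm_eq_inner)
    qed auto
    moreover have "x \<bullet> (M *v x) = 0"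
      using x by (simp add: Mv inner_diff_right c_def flip: power2_norm_eq_inner)
    ultimately have "y \<bullet> (M *v x) = 0" if "y \<in> V" for y
      using nonneg_form_kernel[OF symM less.prems(1)] x that by blast
    moreover have "M *v x \<in> V"
      using x less.prems by (simp add: Mv subspace_diff subspace_scale)
    ultimately have "M *v x = 0" by (metis inner_eq_zero_iff)
    then have eig: "A *v x = c *\<^sub>R x" by (simp add: Mv)
    define V' where "V' = {y \<in> V. orthogonal x y}"
    have V': "subspace V'"
      using less.prems(1) unfolding V'_def subspace_def by (auto simp: orthogonal_def inner_add_right)
    have "x \<notin> V'" using x by (auto simp: V'_def orthogonal_def)
    then have "V' \<subset> V" using x unfolding V'_def by blast
    then have "dim V' < dim V" using dim_psubset V' less.prems(1) by (metis span_eq_iff)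
    moreover have "A *v y \<in> V'" if "y \<in> V'" for y
    proof -
      have "x \<bullet> (A *v y) = (A *v x) \<bullet> y"
        using A inner_mv_transpose[of A x y] by (simp add: sym_mats_def)
      then show ?thesis using that less.prems(2) by (simp add: V'_def orthogonal_def eig)
    qed
    ultimately obtain B where B: "finite B" "B \<subseteq> V'" "pairwise orthogonal B" "span B = V'"
      "\<forall>b\<in>B. norm b = 1 \<and> (\<exists>c. A *v b = c *\<^sub>R b)"
      using less.hyps V' by blast
    have "pairwise orthogonal (insert x B)"
      using B(2,3) by (auto simp: pairwise_insert V'_def orthogonal_commute)
    moreover have "span (insert x B) = V"
    proof
      show "span (insert x B) \<subseteq> V"
        using B(2) x less.prems(1) by (intro span_minimal) (auto simp: V'_def)
      show "V \<subseteq> span (insert x B)"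
      proof
        fix y assume y: "y \<in> V"
        have "y - (x \<bullet> y) *\<^sub>R x \<in> V'"
          using x y less.prems(1)
          by (auto simp: V'_def orthogonal_def inner_diff_right subspace_diff subspace_scale dot_square_norm)
        then have "y - (x \<bullet> y) *\<^sub>R x \<in> span (insert x B)"
          using B(4) span_mono[of B "insert x B"] by auto
        moreover have "(x \<bullet> y) *\<^sub>R x \<in> span (insert x B)" by (simp add: span_base span_scale)
        ultimately show "y \<in> span (insert x B)" using span_add by fastforce
      qed
    qed
    ultimately show ?thesis
      using B x eig by (intro exI[of _ "insert x B"]) (auto simp: V'_def)
  qed
qed

definition diag_mat :: "('n \<Rightarrow> real) \<Rightarrow> real^'n^'n" where
  "diag_mat d = (\<chi> i j. if i = j then d i else 0)"

text \<open>The orthogonal projection onto the coordinate subspace indexed by J.\<close>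

definition cproj :: "'n set \<Rightarrow> real^'n^'n" where
  "cproj J = diag_mat (\<lambda>i. if i \<in> J then 1 else 0)"

lemma diag_mat_mult: "diag_mat c ** diag_mat d = diag_mat (\<lambda>i. c i * d i)"
proof -
  have "(diag_mat c ** diag_mat d) $ i $ j = diag_mat (\<lambda>i. c i * d i) $ i $ j" for i j
  proof -
    have "(diag_mat c ** diag_mat d) $ i $ j = (\<Sum>k\<in>UNIV. if k = i then (if i = j then c i * d i else 0) else 0)"
      unfolding matrix_matrix_mult_def diag_mat_def vec_lambda_beta by (rule sum.cong) auto
    then show ?thesis by (simp add: diag_mat_def)
  qed
  then show ?thesis by (simp add: vec_eq_iff)
qed

lemma transpose_diag_mat [simp]: "transpose (diag_mat d) = diag_mat d"
  by (auto simp: diag_mat_def transpose_def vec_eq_iff)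

lemma diag_mat_in_sym [simp]: "diag_mat d \<in> sym_mats"
  by (simp add: sym_mats_def)

lemma diag_mat_mult_vec: "diag_mat d *v x = (\<chi> i. d i * x $ i)"
proof -
  have "(\<Sum>j\<in>UNIV. (if i = j then d i else 0) * x $ j) = d i * x $ i" for i
    by (rule trans[OF sum.cong[OF refl, of _ _ "\<lambda>j. if i = j then d i * x $ i else 0"]]) auto
  then show ?thesis by (simp add: diag_mat_def matrix_vector_mult_def vec_eq_iff cong: if_cong)
qed

lemma det_diag_mat: "det (diag_mat d) = (\<Prod>i\<in>UNIV. d i)"
  by (subst det_diagonal) (auto simp: diag_mat_def)

lemma diag_mat_1: "diag_mat (\<lambda>i. 1) = mat 1"
  by (simp add: diag_mat_def mat_def)

lemma transpose_cproj [simp]: "transpose (cproj J) = cproj J"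
  by (simp add: cproj_def)

lemma cproj_in_sym [simp]: "cproj J \<in> sym_mats"
  by (simp add: cproj_def)

lemma cproj_UNIV [simp]: "cproj UNIV = mat 1"
  by (simp add: cproj_def diag_mat_1)

lemma cproj_empty [simp]: "cproj {} = 0"
  by (simp add: cproj_def diag_mat_def vec_eq_iff)

lemma cproj_add_compl [simp]: "cproj J + cproj (- J) = mat 1"
  by (auto simp: cproj_def diag_mat_def mat_def vec_eq_iff)

lemma cproj_mult_cproj: "cproj I ** cproj J = cproj (I \<inter> J)"
  unfolding cproj_def diag_mat_mult by (rule arg_cong[of _ _ diag_mat]) auto

lemma cproj_mult_vec: "cproj J *v x = (\<chi> i. if i \<in> J then x $ i else 0)"
  by (simp add: cproj_def diag_mat_mult_vec vec_eq_iff)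

lemma congruence_diag_nth:
  "(G ** diag_mat d ** transpose H) $ a $ b = (\<Sum>j\<in>UNIV. d j * (G $ a $ j * H $ b $ j))"
proof -
  have "(G ** diag_mat d) $ a $ j = G $ a $ j * d j" for j
    by (simp add: matrix_matrix_mult_def diag_mat_def if_distrib cong: if_cong)
  then show ?thesis
    by (subst matrix_matrix_mult_def) (simp add: transpose_def mult_ac)
qed

lemma congruence_cproj_nth:
  "(G ** cproj J ** transpose H) $ a $ b = (\<Sum>j\<in>J. G $ a $ j * H $ b $ j)"
  unfolding cproj_def congruence_diag_nth by (rule sum.mono_neutral_cong_right) auto

theorem spectral_decomposition:
  fixes A :: "real^'n^'n"
  assumes A: "A \<in> sym_mats"
  obtains Q :: "real^'n^'n" and d where "orthogonal_matrix Q" "A = Q ** diag_mat d ** transpose Q"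
proof -
  obtain B where B: "finite B" "pairwise orthogonal B" "span B = (UNIV :: (real^'n) set)"
    "\<forall>b\<in>B. norm b = 1 \<and> (\<exists>c. A *v b = c *\<^sub>R b)"
    using orthonormal_eigenbasis[OF A subspace_UNIV] by auto
  have "0 \<notin> B" using B(4) by force
  then have "independent B" using B(2) pairwise_orthogonal_independent by blast
  then have "card B = CARD('n)" using dim_span_eq_card_independent[of B] B(3) by simp
  then obtain f where f: "bij_betw f (UNIV :: 'n set) B"
    using finite_same_card_bij[of "UNIV :: 'n set" B] B(1) by auto
  obtain e where e: "\<And>b. b \<in> B \<Longrightarrow> A *v b = e b *\<^sub>R b" using B(4) by metis
  define Q :: "real^'n^'n" where "Q = (\<chi> i j. f j $ i)"
  have fB: "f j \<in> B" for j using f bij_betwE by blast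
  have ff: "f i \<bullet> f j = (if i = j then 1 else 0)" for i j
  proof (cases "i = j")
    case False
    then have "f i \<noteq> f j" using f by (metis UNIV_I bij_betw_inv_into_left)
    then show ?thesis using False B(2) fB by (auto simp: pairwise_def orthogonal_def)
  qed (use B(4) fB in \<open>auto simp: dot_square_norm\<close>)
  have QQ: "transpose Q ** Q = mat 1"
    using ff by (auto simp: vec_eq_iff transpose_def matrix_matrix_mult_def Q_def mat_def inner_vec_def)
  then have orth: "orthogonal_matrix Q" by (simp add: orthogonal_matrix)
  have "(A ** Q) $ i $ j = (Q ** diag_mat (\<lambda>j. e (f j))) $ i $ j" for i j
  proof -
    have "(A ** Q) $ i $ j = (A *v f j) $ i"
      by (simp add: matrix_matrix_mult_def matrix_vector_mult_def Q_def)
    also have "\<dots> = e (f j) * f j $ i" using e[OF fB] by simp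
    also have "\<dots> = (Q ** diag_mat (\<lambda>j. e (f j))) $ i $ j"
      by (simp add: matrix_matrix_mult_def diag_mat_def Q_def if_distrib cong: if_cong)
    finally show ?thesis .
  qed
  then have "A ** Q = Q ** diag_mat (\<lambda>j. e (f j))" by (simp add: vec_eq_iff)
  then have "A ** (Q ** transpose Q) = Q ** diag_mat (\<lambda>j. e (f j)) ** transpose Q"
    by (simp add: matrix_mul_assoc)
  then show ?thesis using that orth by (simp add: orthogonal_matrix_def)
qed

lemma dim_coord_subspace: "dim {x::real^'n. \<forall>i. i \<notin> J \<longrightarrow> x $ i = 0} = card J"
  unfolding dim_vec_eq[symmetric] by (rule dim_substandard_cart)

lemma rank_cproj: "rank (cproj J :: real^'n^'n) = card J"
proof -
  have "range (\<lambda>x. cproj J *v x) = {x::real^'n. \<forall>i. i \<notin> J \<longrightarrow> x $ i = 0}"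
  proof (intro equalityI subsetI)
    fix x :: "real^'n" assume "x \<in> {x. \<forall>i. i \<notin> J \<longrightarrow> x $ i = 0}"
    then have "x = cproj J *v x" by (auto simp: cproj_mult_vec vec_eq_iff)
    then show "x \<in> range (\<lambda>x. cproj J *v x)" by blast
  qed (auto simp: cproj_mult_vec)
  then show ?thesis by (simp add: rank_dim_range dim_coord_subspace)
qed

lemma invertible_matrix_vector_bij:
  fixes G :: "real^'n^'n"
  assumes "invertible G" shows "inj ((*v) G)" "surj ((*v) G)"
proof -
  obtain H where H: "G ** H = mat 1" "H ** G = mat 1" using assms invertible_def by blast
  then have *: "G *v (H *v x) = x" "H *v (G *v x) = x" for x
    by (simp_all add: matrix_vector_mul_assoc)
  show "inj ((*v) G)" by (rule injI) (metis *(2))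
  show "surj ((*v) G)" by (rule surjI[of _ "(*v) H"]) (rule *(1))
qed

lemma rank_congruence:
  fixes G :: "real^'n^'n"
  assumes "invertible G" shows "rank (G ** A ** transpose G) = rank A"
proof -
  have surj: "surj ((*v) (transpose G))" and inj: "inj ((*v) G)"
    using assms invertible_matrix_vector_bij[of G] invertible_matrix_vector_bij[of "transpose G"]
    by (simp_all add: invertible_det_nz)
  have "range ((*v) (G ** A ** transpose G)) = (\<lambda>y. G *v (A *v y)) ` range ((*v) (transpose G))"
    by (simp add: image_image matrix_vector_mul_assoc matrix_mul_assoc del: transpose_matrix_vector)
  also have "\<dots> = (*v) G ` range ((*v) A)" unfolding surj by (simp add: image_image)
  finally have "rank (G ** A ** transpose G) = dim ((*v) G ` range ((*v) A))"
    by (simp add: rank_dim_range)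
  also have "\<dots> = dim (range ((*v) A))"
    by (rule dim_image_eq) (use inj in \<open>auto intro: inj_on_subset\<close>)
  finally show ?thesis by (simp add: rank_dim_range)
qed

lemma psd_spectral_decomposition:
  fixes A :: "real^'n^'n"
  assumes A: "A \<in> psd_mats"
  obtains Q :: "real^'n^'n" and d where "orthogonal_matrix Q" "A = Q ** diag_mat d ** transpose Q" "\<And>i. 0 \<le> d i"
proof -
  obtain Q :: "real^'n^'n" and d where Q: "orthogonal_matrix Q" and AQ: "A = Q ** diag_mat d ** transpose Q"
    using spectral_decomposition[of A] A unfolding psd_mats_def by blast
  have QQ: "transpose Q ** Q = mat 1" using Q by (simp add: orthogonal_matrix_def)
  have "diag_mat d = transpose Q ** A ** Q"
    unfolding AQ matrix_mul_assoc QQ using QQ by (simp add: matrix_mul_assoc[symmetric])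
  then have "diag_mat d \<in> psd_mats" using psd_mats_congruence[OF A] by simp
  then have "0 \<le> axis i 1 \<bullet> (diag_mat d *v axis i 1)" for i by (auto simp: psd_mats_def)
  then have "0 \<le> d i" for i by (simp add: diag_mat_mult_vec inner_axis')
  then show ?thesis using that[of Q d] Q AQ by simp
qed

lemma psd_mats_congruence_cancel:
  fixes G X :: "real^'n^'n"
  assumes G: "invertible G" and psd: "transpose G ** X ** G \<in> psd_mats"
  shows "X \<in> psd_mats"
proof -
  obtain H :: "real^'n^'n" where H: "G ** H = mat 1" "H ** G = mat 1" using G invertible_def by blast
  have tH: "transpose H ** transpose G = mat 1" using H(1) by (metis matrix_transpose_mul transpose_mat)
  have "transpose H ** (transpose G ** X ** G) ** H = (transpose H ** transpose G) ** X ** (G ** H)"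
    by (simp only: matrix_mul_assoc)
  then have "transpose H ** (transpose G ** X ** G) ** H = X" by (simp add: tH H)
  then show ?thesis using psd_mats_congruence[OF psd, of H] by simp
qed

text \<open>Scaling the eigenvectors by the square roots of the positive eigenvalues, and listing them so
  that these come first, turns the spectral decomposition into a congruence with a coordinate
  projection.\<close>

lemma psd_congruent_cproj:
  fixes S :: "real^'n^'n"
  assumes S: "S \<in> psd_mats" and J: "card J = rank S"
  obtains G :: "real^'n^'n" where "invertible G" "S = G ** cproj J ** transpose G"
proof -
  obtain Q :: "real^'n^'n" and d where Q: "orthogonal_matrix Q" and SQ: "S = Q ** diag_mat d ** transpose Q"
    and d: "\<And>i. 0 \<le> d i"
    by (rule psd_spectral_decomposition[OF S]) (rule that)
  define I where "I = {i. d i \<noteq> 0}"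
  define s where "s = (\<lambda>i. if d i = 0 then 1 else sqrt (d i))"
  define G where "G = Q ** diag_mat s"
  have s: "s i \<noteq> 0" "i \<in> I \<Longrightarrow> s i * s i = d i" for i using d by (auto simp: s_def I_def)
  have Gn: "G $ a $ i = Q $ a $ i * s i" for a i
    by (simp add: G_def matrix_matrix_mult_def diag_mat_def if_distrib cong: if_cong)
  have "det Q \<noteq> 0" using det_orthogonal_matrix[OF Q] by auto
  then have detG: "det G \<noteq> 0" using s by (simp add: G_def det_mul det_diag_mat)
  have SG: "S $ a $ b = (\<Sum>i\<in>I. G $ a $ i * G $ b $ i)" for a b
  proof -
    have "S $ a $ b = (\<Sum>i\<in>UNIV. d i * (Q $ a $ i * Q $ b $ i))" by (simp add: SQ congruence_diag_nth)
    also have "\<dots> = (\<Sum>i\<in>I. d i * (Q $ a $ i * Q $ b $ i))"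
      by (rule sum.mono_neutral_right) (auto simp: I_def)
    also have "\<dots> = (\<Sum>i\<in>I. G $ a $ i * G $ b $ i)"
      by (rule sum.cong) (simp_all add: Gn s(2)[symmetric] mult_ac)
    finally show ?thesis .
  qed
  have "S = G ** cproj I ** transpose G" by (simp add: vec_eq_iff SG congruence_cproj_nth)
  then have "card I = card J" using J detG by (simp add: rank_congruence rank_cproj invertible_det_nz)
  then have "\<exists>p::'n \<Rightarrow> 'n. bij_betw p J I" "\<exists>p::'n \<Rightarrow> 'n. bij_betw p (-J) (-I)"
    by (auto intro!: finite_same_card_bij simp: card_Diff_subset Compl_eq_Diff_UNIV)
  then obtain p q where pq: "bij_betw p J I" "bij_betw q (- J) (- I)" by blast
  define r where "r = (\<lambda>i. if i \<in> J then p i else q i)"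
  have rJ: "bij_betw r J I" using pq(1) by (rule bij_betw_cong[THEN iffD1, rotated]) (simp add: r_def)
  moreover have "bij_betw r (- J) (- I)" using pq(2) by (rule bij_betw_cong[THEN iffD1, rotated]) (simp add: r_def)
  ultimately have "bij_betw r (J \<union> - J) (I \<union> - I)" by (rule bij_betw_combine) auto
  then have r: "r permutes UNIV" by (intro bij_imp_permutes) (simp_all add: bij_betw_def)
  define H where "H = (\<chi> i j. G $ i $ r j)"
  have "det H = of_int (sign r) * det G" unfolding H_def by (rule det_permute_columns[OF r])
  then have "invertible H" using detG by (simp add: invertible_det_nz)
  moreover have "S = H ** cproj J ** transpose H"
    by (simp add: vec_eq_iff SG congruence_cproj_nth H_def sum.reindex_bij_betw[OF rJ, of "\<lambda>i. G $ _ $ i * G $ _ $ i"])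
  ultimately show ?thesis using that by blast
qed

lemma pd_imp_psd: "pd_mats \<subseteq> psd_mats"
proof
  fix A :: "real^'n^'n" assume A: "A \<in> pd_mats"
  have "0 \<le> x \<bullet> (A *v x)" for x using A by (cases "x = 0") (auto simp: pd_mats_def less_imp_le)
  then show "A \<in> psd_mats" using A by (auto simp: pd_mats_def psd_mats_def)
qed

lemma pd_det_nonzero:
  assumes "A \<in> pd_mats" shows "det A \<noteq> 0"
proof
  assume "det A = 0"
  then have "\<not> invertible A" by (simp add: invertible_det_nz)
  then obtain x where "x \<noteq> 0" "A *v x = 0"
    using matrix_left_invertible_ker[of A] invertible_left_inverse by blast
  then have "0 < x \<bullet> 0" using assms unfolding pd_mats_def by force
  then show False by simp
qed

lemma psd_det_nonzero_imp_pd: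
  assumes "A \<in> psd_mats" "det A \<noteq> 0" shows "A \<in> pd_mats"
proof -
  have "0 < x \<bullet> (A *v x)" if "x \<noteq> 0" for x
  proof -
    have "A *v x \<noteq> 0" using assms(2) that
      by (metis invertible_det_nz invertible_left_inverse matrix_left_invertible_ker)
    then have "x \<bullet> (A *v x) \<noteq> 0" using psd_kernel[OF assms(1)] by blast
    moreover have "0 \<le> x \<bullet> (A *v x)" using assms(1) by (simp add: psd_mats_def)
    ultimately show ?thesis by simp
  qed
  then show ?thesis using assms by (simp add: pd_mats_def psd_mats_def)
qed

lemma pd_congruent_identity:
  fixes A :: "real^'n^'n"
  assumes "A \<in> pd_mats"
  obtains G :: "real^'n^'n" where "invertible G" "A = G ** transpose G"
proof -
  have "invertible A" using pd_det_nonzero[OF assms] invertible_det_nz by blast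
  then have rank: "card (UNIV :: 'n set) = rank A"
    using invertible_matrix_vector_bij(1)[of A] full_rank_injective[of A] by simp
  have "A \<in> psd_mats" using assms pd_imp_psd by blast
  then obtain G :: "real^'n^'n" where "invertible G" "A = G ** cproj UNIV ** transpose G"
    by (rule psd_congruent_cproj[OF _ rank])
  then show ?thesis using that by simp
qed

lemma pd_det_pos: "A \<in> pd_mats \<Longrightarrow> det (A :: real^'n^'n) > 0"
proof -
  assume "A \<in> pd_mats"
  then obtain G :: "real^'n^'n" where "invertible G" "A = G ** transpose G" by (rule pd_congruent_identity)
  then show ?thesis by (simp add: det_mul invertible_det_nz zero_less_mult_iff) linarith
qed

lemma pd_add_psd: "K \<in> pd_mats \<Longrightarrow> X \<in> psd_mats \<Longrightarrow> K + X \<in> pd_mats"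
  using subspace_add[OF subspace_sym_mats, of K X] unfolding pd_mats_def psd_mats_def
  by (auto simp: matrix_vector_mult_add_rdistrib inner_add_right intro: add_pos_nonneg)

text \<open>After a congruence that turns K into the identity, X becomes diagonal with nonnegative entries d i
  that are not all zero, and adding X multiplies the determinant by the product of the 1 + d i.\<close>

lemma det_add_psd_greater:
  fixes K X :: "real^'n^'n"
  assumes K: "K \<in> pd_mats" and X: "X \<in> psd_mats" "X \<noteq> 0"
  shows "det K < det (K + X)"
proof -
  obtain G :: "real^'n^'n" where G: "invertible G" "K = G ** transpose G"
    using pd_congruent_identity[OF K] .
  obtain H :: "real^'n^'n" where H: "G ** H = mat 1" "H ** G = mat 1" using G(1) invertible_def by blast
  define Y where "Y = H ** X ** transpose H"
  have tH: "transpose H ** transpose G = mat 1" using H(1) by (metis matrix_transpose_mul transpose_mat)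
  have X_eq: "X = G ** Y ** transpose G"
  proof -
    have "G ** Y ** transpose G = (G ** H) ** X ** (transpose H ** transpose G)"
      by (simp only: Y_def matrix_mul_assoc)
    then show ?thesis by (simp add: H tH)
  qed
  have Y: "Y \<in> psd_mats" using psd_mats_congruence[OF X(1), of "transpose H"] by (simp add: Y_def)
  have "Y \<noteq> 0" using X(2) X_eq by auto
  obtain Q :: "real^'n^'n" and d where Q: "orthogonal_matrix Q"
    and YQ: "Y = Q ** diag_mat d ** transpose Q" and d: "\<And>i. 0 \<le> d i"
    by (rule psd_spectral_decomposition[OF Y]) (rule that)
  have QQ: "transpose Q ** Q = mat 1" "Q ** transpose Q = mat 1" using Q by (simp_all add: orthogonal_matrix_def)
  have "diag_mat d \<noteq> 0" using \<open>Y \<noteq> 0\<close> YQ by auto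
  then obtain i where i: "d i \<noteq> 0" by (auto simp: diag_mat_def vec_eq_iff split: if_splits)
  have "K + X = G ** (mat 1 + Y) ** transpose G"
    unfolding X_eq G(2) by (simp add: matrix_add_ldistrib matrix_mult_add_right)
  also have "mat 1 + Y = Q ** (mat 1 + diag_mat d) ** transpose Q"
    by (simp add: YQ matrix_add_ldistrib matrix_mult_add_right QQ)
  also have "mat 1 + diag_mat d = diag_mat (\<lambda>i. 1 + d i)"
    by (simp add: diag_mat_def mat_def vec_eq_iff)
  finally have "det (K + X) = (det G)\<^sup>2 * (det Q)\<^sup>2 * (\<Prod>i\<in>UNIV. 1 + d i)"
    by (simp add: det_mul det_diag_mat power2_eq_square)
  moreover have "(det Q)\<^sup>2 = 1" using QQ(1) by (metis det_I det_mul det_transpose power2_eq_square)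
  moreover have "(\<Prod>i\<in>UNIV. 1 + d i) > 1"
  proof -
    have "(\<Prod>i\<in>UNIV. 1 + d i) = (1 + d i) * (\<Prod>i\<in>UNIV - {i}. 1 + d i)"
      by (rule prod.remove) auto
    moreover have "(\<Prod>i\<in>UNIV - {i}. 1 + d i) \<ge> 1" using d by (intro prod_ge_1) auto
    moreover have "1 + d i > 1" using d i by (simp add: less_le)
    ultimately show ?thesis by (metis less_le_trans mult.right_neutral mult_left_mono order_less_imp_le zero_less_one less_trans)
  qed
  moreover have "det K = (det G)\<^sup>2" "det G \<noteq> 0"
    using G by (simp_all add: det_mul power2_eq_square invertible_det_nz)
  ultimately show ?thesis by simp
qed

section \<open>Existence of the maximum likelihood estimate\<close>

lemma diag_entry_eq_form: "(Y :: real^'n^'n) $ i $ i = axis i 1 \<bullet> (Y *v axis i 1)"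
  by (simp add: inner_axis' matrix_vector_mult_basis column_def)

text \<open>After a congruence S is a coordinate projection, and the trace product with X becomes a sum of
  diagonal entries of a positive semidefinite matrix.\<close>

lemma psd_inner_psd:
  fixes S X :: "real^'n^'n"
  assumes S: "S \<in> psd_mats" and X: "X \<in> psd_mats"
  shows "0 \<le> S \<bullet> X" and "S \<bullet> X = 0 \<Longrightarrow> X ** S = 0"
proof -
  have "rank S \<le> CARD('n)" using rank_bound[of S] by simp
  then obtain J :: "'n set" where J: "card J = rank S"
    using obtain_subset_with_card_n by blast
  obtain G :: "real^'n^'n" where G: "invertible G" "S = G ** cproj J ** transpose G"
    by (rule psd_congruent_cproj[OF S J])
  define Y where "Y = transpose G ** X ** G"
  have Y: "Y \<in> psd_mats" unfolding Y_def by (rule psd_mats_congruence[OF X])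
  have Yii: "0 \<le> Y $ i $ i" for i
    using Y unfolding diag_entry_eq_form psd_mats_def by blast
  have "S \<bullet> X = cproj J \<bullet> Y"
    by (simp only: G(2) inner_matrix_mult_right[of "G ** cproj J"] inner_matrix_mult_left[of G "cproj J"]
        transpose_transpose Y_def matrix_mul_assoc)
  also have "\<dots> = (\<Sum>i\<in>UNIV. \<Sum>j\<in>UNIV. if j = i then (if i \<in> J then Y $ i $ i else 0) else 0)"
    unfolding inner_vec_def by (intro sum.cong) (auto simp: cproj_def diag_mat_def)
  also have "\<dots> = (\<Sum>i\<in>J. Y $ i $ i)"
    by (simp add: sum.If_cases)
  finally have SX: "S \<bullet> X = (\<Sum>i\<in>J. Y $ i $ i)" .
  then show "0 \<le> S \<bullet> X" using Yii by (simp add: sum_nonneg)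
  assume "S \<bullet> X = 0"
  then have "Y $ i $ i = 0" if "i \<in> J" for i
    using SX sum_nonneg_eq_0_iff[of J "\<lambda>i. Y $ i $ i"] Yii that by simp
  then have "Y *v axis i 1 = 0" if "i \<in> J" for i
    using psd_kernel[OF Y] that by (simp add: diag_entry_eq_form)
  then have col: "Y $ a $ i = 0" if "i \<in> J" for a i
    using that by (auto simp: matrix_vector_mult_basis column_def vec_eq_iff)
  have "Y ** cproj J = 0"
    using col by (auto simp: vec_eq_iff matrix_matrix_mult_def cproj_def diag_mat_def intro!: sum.neutral)
  then have "transpose G ** (X ** G ** cproj J) = 0" by (simp add: Y_def matrix_mul_assoc)
  moreover obtain H :: "real^'n^'n" where "H ** transpose G = mat 1"
    using G(1) by (metis invertible_def invertible_det_nz det_transpose)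
  ultimately have "(H ** transpose G) ** (X ** G ** cproj J) = 0"
    by (metis matrix_mul_assoc times0_right)
  then have "X ** G ** cproj J = 0" using \<open>H ** transpose G = mat 1\<close> by simp
  then show "X ** S = 0" by (simp add: G(2) matrix_mul_assoc)
qed

lemma neg_log_lik_inner: "S \<in> sym_mats \<Longrightarrow> neg_log_lik S K = S \<bullet> K - ln (det K)"
  by (simp add: neg_log_lik_def inner_sym_mats_eq_trace)

text \<open>Moving in the direction X leaves the linear term unchanged and increases the determinant.\<close>

lemma not_MLE_exists:
  assumes L: "subspace L" and X: "X \<in> L" "X \<in> psd_mats" "X \<noteq> 0" and XS: "X ** S = 0"
  shows "\<not> MLE_exists L S"
proof
  assume "MLE_exists L S"
  then obtain K where K: "K \<in> L" "K \<in> pd_mats"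
    and min: "\<And>K'. K' \<in> L \<inter> pd_mats \<Longrightarrow> neg_log_lik S K \<le> neg_log_lik S K'"
    unfolding MLE_exists_def by blast
  have "K + X \<in> L \<inter> pd_mats" using K X L by (simp add: subspace_add pd_add_psd)
  then have "neg_log_lik S K \<le> neg_log_lik S (K + X)" by (rule min)
  moreover have "trace (S ** X) = 0" using XS trace_mul_sym[of S X] by (simp add: trace_def)
  moreover have "ln (det K) < ln (det (K + X))"
    using det_add_psd_greater[OF K(2) X(2,3)] pd_det_pos[OF K(2)] by simp
  ultimately show False by (simp add: neg_log_lik_def matrix_add_ldistrib trace_add)
qed

lemma linear_mv_left: "linear (\<lambda>A :: real^'k^'l. A *v x)"
  by (auto intro!: linearI simp: matrix_vector_mult_add_rdistrib scaleR_matrix_vector_assoc)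

lemma closed_psd_mats: "closed (psd_mats :: (real^'n^'n) set)"
proof -
  have eq: "psd_mats = sym_mats \<inter> (\<Inter>x. {A :: real^'n^'n. 0 \<le> x \<bullet> (A *v x)})"
    by (auto simp: psd_mats_def)
  have "closed {A :: real^'n^'n. 0 \<le> x \<bullet> (A *v x)}" for x
    by (intro closed_Collect_le continuous_intros linear_continuous_on linear_linear[THEN iffD2] linear_mv_left)
  then show ?thesis
    unfolding eq by (intro closed_Int closed_subspace[OF subspace_sym_mats] closed_INT) blast
qed

lemma psd_mats_scale: "A \<in> psd_mats \<Longrightarrow> 0 \<le> c \<Longrightarrow> c *\<^sub>R A \<in> psd_mats"
  using subspace_scale[OF subspace_sym_mats, of A c]
  by (auto simp: psd_mats_def scaleR_matrix_vector_assoc[symmetric])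

lemma continuous_on_det: "continuous_on U (det :: real^'n^'n \<Rightarrow> real)"
  by (intro continuous_on_rpf rpf_det pf_intros)

lemma det_scaleR: "det (r *\<^sub>R (A :: real^'n^'n)) = r ^ CARD('n) * det A"
proof -
  have "r *\<^sub>R A = diag_mat (\<lambda>_. r) ** A"
  proof -
    have "diag_mat (\<lambda>_. r) = r *\<^sub>R (mat 1 :: real^'n^'n)"
      by (simp add: diag_mat_def mat_def vec_eq_iff)
    then show ?thesis by (simp add: scalar_matrix_assoc[symmetric])
  qed
  then show ?thesis by (simp add: det_mul det_diag_mat)
qed

lemma det_zero: "det (0 :: real^'n^'n) = 0"
  using det_scaleR[of 0 "mat 1 :: real^'n^'n"] by simp

text \<open>On the cone of positive semidefinite matrices in L the linear term dominates a positive multiple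
  of the norm, while log det grows only logarithmically.  So the sublevel sets are compact.\<close>

lemma MLE_exists_if_no_kernel:
  fixes L :: "(real^'n^'n) set"
  assumes L: "subspace L" and pd: "L \<inter> pd_mats \<noteq> {}" and S: "S \<in> psd_mats"
    and ker: "\<And>X. X \<in> L \<Longrightarrow> X ** S = 0 \<Longrightarrow> X = 0"
  shows "MLE_exists L S"
proof -
  obtain K0 where K0: "K0 \<in> L" "K0 \<in> pd_mats" using pd by blast
  have symS: "S \<in> sym_mats" using S by (simp add: psd_mats_def)
  have "K0 \<noteq> 0" using pd_det_pos[OF K0(2)] by (metis det_zero less_irrefl)
  let ?C = "sphere 0 1 \<inter> (L \<inter> psd_mats)"
  have comp: "compact ?C"
    by (intro compact_Int_closed closed_Int closed_subspace L closed_psd_mats) auto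
  have norm_in: "K /\<^sub>R norm K \<in> ?C" if "K \<in> L" "K \<in> psd_mats" "K \<noteq> 0" for K
    using that L by (auto intro: psd_mats_scale subspace_scale)
  have "K0 /\<^sub>R norm K0 \<in> ?C" using norm_in K0 \<open>K0 \<noteq> 0\<close> pd_imp_psd by blast
  then have ne: "?C \<noteq> {}" by blast
  have "continuous_on ?C (\<lambda>X. S \<bullet> X)" by (intro continuous_intros)
  then obtain X0 where X0: "X0 \<in> ?C" and X0min: "\<And>X. X \<in> ?C \<Longrightarrow> S \<bullet> X0 \<le> S \<bullet> X"
    using continuous_attains_inf[OF comp ne] by blast
  define c where "c = S \<bullet> X0"
  have "c \<noteq> 0" using psd_inner_psd(2)[OF S, of X0] X0 ker[of X0] by (auto simp: c_def)
  then have c: "c > 0" using psd_inner_psd(1)[OF S, of X0] X0 by (simp add: c_def)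
  have lin: "c * norm K \<le> S \<bullet> K" if "K \<in> L" "K \<in> psd_mats" for K
  proof (cases "K = 0")
    case False
    then have "c \<le> S \<bullet> (K /\<^sub>R norm K)" unfolding c_def by (intro X0min norm_in that)
    then show ?thesis using False by (simp add: field_simps)
  qed auto
  have "compact (det ` sphere (0 :: real^'n^'n) 1)"
    by (intro compact_continuous_image continuous_on_det) auto
  then have "bounded (det ` sphere (0 :: real^'n^'n) 1)" by (rule compact_imp_bounded)
  then obtain M' where "\<forall>y \<in> det ` sphere (0 :: real^'n^'n) 1. norm y \<le> M'"
    unfolding bounded_iff by blast
  then have M': "\<bar>det A\<bar> \<le> M'" if "A \<in> sphere 0 1" for A :: "real^'n^'n"
    using that by fastforce
  define M where "M = max 1 M'"
  have M: "M \<ge> 1" "\<And>A :: real^'n^'n. A \<in> sphere 0 1 \<Longrightarrow> det A \<le> M"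
    using M' by (force simp: M_def)+
  have det_le: "det K \<le> M * norm K ^ CARD('n)" if "K \<noteq> 0" for K :: "real^'n^'n"
  proof -
    have "det K = norm K ^ CARD('n) * det (K /\<^sub>R norm K)"
      using that by (simp add: det_scaleR[symmetric])
    also have "\<dots> \<le> norm K ^ CARD('n) * M"
      using that by (intro mult_left_mono M(2)) auto
    finally show ?thesis by (simp add: mult.commute)
  qed
  define \<beta> where "\<beta> = neg_log_lik S K0"
  define T where "T = {K \<in> L \<inter> psd_mats. exp (S \<bullet> K - \<beta>) \<le> det K}"
  have T_pd: "K \<in> pd_mats" if "K \<in> T" for K
  proof -
    have "exp (S \<bullet> K - \<beta>) \<le> det K" using that by (simp add: T_def)
    with exp_gt_zero have "0 < det K" by (rule less_le_trans)
    then show ?thesis using that psd_det_nonzero_imp_pd[of K] by (simp add: T_def)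
  qed
  have T_iff: "K \<in> T \<longleftrightarrow> neg_log_lik S K \<le> \<beta>" if "K \<in> L" "K \<in> pd_mats" for K
  proof -
    have "exp (S \<bullet> K - \<beta>) \<le> det K \<longleftrightarrow> S \<bullet> K - \<beta> \<le> ln (det K)"
      using pd_det_pos[OF that(2)] by (simp add: ln_ge_iff)
    then show ?thesis using that pd_imp_psd by (auto simp: T_def neg_log_lik_inner[OF symS])
  qed
  define n where "n = real CARD('n)"
  have n: "n > 0" by (simp add: n_def)
  define R where "R = 2 / c * (\<beta> + ln M + n * ln (2 * n / c))"
  have bound: "norm K \<le> R" if K: "K \<in> T" for K
  proof -
    have pdK: "K \<in> pd_mats" and KL: "K \<in> L" "K \<in> psd_mats" using K T_pd by (auto simp: T_def)
    have detK: "det K > 0" by (rule pd_det_pos[OF pdK])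
    then have K_ne: "K \<noteq> 0" by (metis det_zero less_irrefl)
    have "c * norm K - \<beta> \<le> S \<bullet> K - \<beta>" using lin KL by simp
    also have "\<dots> \<le> ln (det K)" using K detK by (simp add: T_def ln_ge_iff)
    also have "\<dots> \<le> ln (M * norm K ^ CARD('n))" using det_le[OF K_ne] detK by simp
    also have "\<dots> = ln M + n * ln (norm K)"
      using M K_ne by (simp add: ln_mult ln_realpow n_def)
    \<comment> \<open>The inequality ln y \<le> y - 1 is applied with a factor in y that makes the coefficient of norm K
      on the right half of that on the left.\<close>
    also have "ln (norm K) = ln (c / (2 * n) * norm K) + ln (2 * n / c)"
      using c n K_ne by (simp add: ln_mult ln_div)
    also have "ln (c / (2 * n) * norm K) \<le> c / (2 * n) * norm K - 1"
      using c n K_ne by (intro ln_le_minus_one) simp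
    finally have "c * norm K - \<beta> \<le> ln M + n * (c / (2 * n) * norm K - 1 + ln (2 * n / c))"
      using n by simp
    also have "\<dots> = ln M + c / 2 * norm K - n + n * ln (2 * n / c)"
      using n by (simp add: field_simps)
    finally have "c / 2 * norm K \<le> \<beta> + ln M + n * ln (2 * n / c)"
      using n by simp
    then show ?thesis using c by (simp add: R_def field_simps)
  qed
  have "T = (L \<inter> psd_mats) \<inter> {K. exp (S \<bullet> K - \<beta>) \<le> det K}" by (auto simp: T_def)
  moreover have "closed {K :: real^'n^'n. exp (S \<bullet> K - \<beta>) \<le> det K}"
    by (intro closed_Collect_le continuous_intros continuous_on_det)
  ultimately have "closed T" using closed_subspace[OF L] closed_psd_mats by auto
  moreover have "bounded T" using bound unfolding bounded_iff by blast
  ultimately have "compact T" by (simp add: compact_eq_bounded_closed)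
  moreover have K0T: "K0 \<in> T" using T_iff[OF K0] by (simp add: \<beta>_def)
  moreover have "continuous_on T (neg_log_lik S)"
    unfolding neg_log_lik_inner[OF symS, abs_def]
    using T_pd pd_det_nonzero by (intro continuous_intros continuous_on_det) auto
  ultimately obtain K where K: "K \<in> T" and min: "\<And>K'. K' \<in> T \<Longrightarrow> neg_log_lik S K \<le> neg_log_lik S K'"
    using continuous_attains_inf[of T "neg_log_lik S"] by blast
  have "neg_log_lik S K \<le> neg_log_lik S K'" if "K' \<in> L" "K' \<in> pd_mats" for K'
  proof (cases "K' \<in> T")
    case False
    then have "\<beta> < neg_log_lik S K'" using T_iff[OF that] by simp
    moreover have "neg_log_lik S K \<le> \<beta>" using min[OF K0T] by (simp add: \<beta>_def)
    ultimately show ?thesis by simp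
  qed (rule min)
  then show ?thesis using K T_pd unfolding MLE_exists_def T_def by blast
qed

section \<open>Matrices with a prescribed kernel\<close>

definition sym_supp :: "'n set \<Rightarrow> (real^'n^'n) set" where
  "sym_supp J = {A \<in> sym_mats. \<forall>i j. i \<notin> J \<or> j \<notin> J \<longrightarrow> A $ i $ j = 0}"

lemma sym_matsI: "(\<And>i j. A $ i $ j = A $ j $ i) \<Longrightarrow> A \<in> sym_mats"
  by (simp add: sym_mats_def transpose_def vec_eq_iff)

lemma sym_matsD: "A \<in> sym_mats \<Longrightarrow> A $ i $ j = A $ j $ i"
  by (simp add: sym_mats_def transpose_def vec_eq_iff)

lemma subspace_sym_supp: "subspace (sym_supp J)"
  using subspace_sym_mats unfolding sym_supp_def subspace_def by auto

lemma mult_cproj_nth: "(A ** cproj J) $ i $ j = (if j \<in> J then A $ i $ j else 0)"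
proof -
  have "(A ** cproj J) $ i $ j = (\<Sum>k\<in>UNIV. if k = j then (if j \<in> J then A $ i $ j else 0) else 0)"
    unfolding matrix_matrix_mult_def cproj_def diag_mat_def vec_lambda_beta by (rule sum.cong) auto
  then show ?thesis by simp
qed

lemma sym_supp_iff: "A \<in> sym_supp J \<longleftrightarrow> A \<in> sym_mats \<and> A ** cproj (- J) = 0"
proof -
  have "A ** cproj (- J) = 0 \<longleftrightarrow> (\<forall>i j. j \<notin> J \<longrightarrow> A $ i $ j = 0)"
    by (auto simp: vec_eq_iff mult_cproj_nth)
  then show ?thesis unfolding sym_supp_def using sym_matsD[of A] by (simp, metis)
qed

text \<open>Adding an index a to the support adds a row, which can be prescribed freely.\<close>

lemma dim_sym_supp: "dim (sym_supp J :: (real^'n^'n) set) = (card J + 1) choose 2"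
proof (induction J rule: finite_induct[OF finite])
  case 1
  have "sym_supp {} = {0 :: real^'n^'n}"
    using subspace_0[OF subspace_sym_mats] by (auto simp: sym_supp_def vec_eq_iff)
  then show ?case by simp
next
  case (2 a J)
  define \<phi> :: "real^'n \<Rightarrow> real^'n^'n" where
    "\<phi> = (\<lambda>u. \<chi> i j. (if i = a then u $ j else 0) + (if j = a then u $ i else 0))"
  define R where "R = {u :: real^'n. \<forall>i. i \<notin> insert a J \<longrightarrow> u $ i = 0}"
  have lin: "linear \<phi>"
    by (auto intro!: linearI simp: \<phi>_def vec_eq_iff algebra_simps)
  have inj: "u = 0" if "\<And>j. \<phi> u $ a $ j = 0" for u
  proof -
    have "u $ j = 0" for j using that[of j] by (simp add: \<phi>_def split: if_splits)
    then show ?thesis by (simp add: vec_eq_iff)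
  qed
  have subR: "subspace R" by (auto simp: R_def subspace_def)
  have "inj \<phi>" using inj by (subst linear_inj_iff_eq_0[OF lin]) auto
  then have dim\<phi>: "dim (\<phi> ` R) = card J + 1"
    using dim_image_eq[OF lin, of R] dim_coord_subspace[of "insert a J"] 2
    by (simp add: R_def inj_on_subset)
  have "sym_supp J \<inter> \<phi> ` R = {0}"
  proof
    show "sym_supp J \<inter> \<phi> ` R \<subseteq> {0}"
      using inj linear_0[OF lin] 2(2) by (auto simp: sym_supp_def)
    show "{0} \<subseteq> sym_supp J \<inter> \<phi> ` R"
      using linear_subspace_image[OF lin subR] subspace_sym_supp subspace_0 by blast
  qed
  then have int: "dim (sym_supp J \<inter> \<phi> ` R) = 0" by simp
  have "{x + y |x y. x \<in> sym_supp J \<and> y \<in> \<phi> ` R} = sym_supp (insert a J)"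
  proof (intro equalityI subsetI)
    fix X assume "X \<in> {x + y |x y. x \<in> sym_supp J \<and> y \<in> \<phi> ` R}"
    then obtain Y u where X: "X = Y + \<phi> u" "Y \<in> sym_supp J" "u \<in> R" by blast
    have "Y \<in> sym_supp (insert a J)" using X(2) by (auto simp: sym_supp_def)
    moreover have "\<phi> u \<in> sym_supp (insert a J)"
      using X(3) by (auto simp: sym_supp_def R_def \<phi>_def intro!: sym_matsI)
    ultimately show "X \<in> sym_supp (insert a J)"
      unfolding X(1) using subspace_add subspace_sym_supp by blast
  next
    fix X :: "real^'n^'n" assume X: "X \<in> sym_supp (insert a J)"
    define u where "u = (\<chi> j. if j = a then X $ a $ a / 2 else X $ a $ j)"
    have u: "u \<in> R" using X by (auto simp: u_def R_def sym_supp_def)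
    have sym: "X $ i $ j = X $ j $ i" for i j using X by (auto simp: sym_supp_def intro: sym_matsD)
    have "X - \<phi> u \<in> sym_supp J"
      using X sym by (auto simp: sym_supp_def \<phi>_def u_def intro!: sym_matsI)
    then have "X = (X - \<phi> u) + \<phi> u \<and> X - \<phi> u \<in> sym_supp J \<and> \<phi> u \<in> \<phi> ` R" using u by simp
    then show "X \<in> {x + y |x y. x \<in> sym_supp J \<and> y \<in> \<phi> ` R}" by blast
  qed
  then have "dim (sym_supp (insert a J) :: (real^'n^'n) set) = dim (sym_supp J :: (real^'n^'n) set) + (card J + 1)"
    using dim_sums_Int[OF subspace_sym_supp[of J] linear_subspace_image[OF lin subR]] int dim\<phi> by simp
  also have "\<dots> = (card (insert a J) + 1) choose 2"
    using 2 by (simp add: numeral_2_eq_2)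
  finally show ?case .
qed

lemma dim_sym_mats: "dim (sym_mats :: (real^'n^'n) set) = (CARD('n) + 1) choose 2"
proof -
  have "sym_supp UNIV = (sym_mats :: (real^'n^'n) set)" by (auto simp: sym_supp_def)
  then show ?thesis using dim_sym_supp[of "UNIV :: 'n set"] by simp
qed

text \<open>For invertible G, the symmetric matrices whose kernel contains the columns of G outside J.\<close>

definition kernel_mats :: "real^'n^'n \<Rightarrow> 'n set \<Rightarrow> (real^'n^'n) set" where
  "kernel_mats G J = {X \<in> sym_mats. X ** G ** cproj (- J) = 0}"

lemma subspace_kernel_mats: "subspace (kernel_mats G J)"
proof -
  have "linear (\<lambda>X. X ** (G ** cproj (- J)))" by (rule linear_matrix_mult_right)
  then have "subspace {X. X ** (G ** cproj (- J)) = 0}"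
    by (rule linear_subspace_kernel)
  then have "subspace (sym_mats \<inter> {X. X ** (G ** cproj (- J)) = 0})"
    by (rule subspace_inter[OF subspace_sym_mats])
  moreover have "kernel_mats G J = sym_mats \<inter> {X. X ** (G ** cproj (- J)) = 0}"
    by (auto simp: kernel_mats_def matrix_mul_assoc)
  ultimately show ?thesis by simp
qed

lemma kernel_mats_congruence:
  assumes "X \<in> kernel_mats G J" shows "transpose G ** X ** G \<in> sym_supp J"
proof -
  have "transpose G ** X ** G ** cproj (- J) = transpose G ** (X ** G ** cproj (- J))"
    by (simp add: matrix_mul_assoc)
  then show ?thesis using assms by (simp add: sym_supp_iff kernel_mats_def sym_mats_congruence)
qed

lemma psd_if_nonneg_on_support:
  fixes A :: "real^'n^'n"
  assumes A: "A \<in> sym_supp J" and nonneg: "\<And>u. cproj (- J) *v u = 0 \<Longrightarrow> 0 \<le> u \<bullet> (A *v u)"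
  shows "A \<in> psd_mats"
proof -
  have sym: "A \<in> sym_mats" and AP: "A ** cproj (- J) = 0" using A by (auto simp: sym_supp_iff)
  have "0 \<le> y \<bullet> (A *v y)" for y
  proof -
    define u where "u = cproj J *v y"
    have Pu: "cproj (- J) *v u = 0"
      unfolding u_def matrix_vector_mul_assoc cproj_mult_cproj by simp
    have "y = (cproj J + cproj (- J)) *v y" by simp
    then have y: "y = u + cproj (- J) *v y" by (simp only: matrix_vector_mult_add_rdistrib u_def)
    have Ay: "A *v y = A *v u"
    proof -
      have "A *v y = A *v u + (A ** cproj (- J)) *v y"
        by (subst y) (simp only: matrix_vector_right_distrib matrix_vector_mul_assoc)
      then show ?thesis by (simp add: AP)
    qed
    have "y \<bullet> (A *v y) = (A *v y) \<bullet> u"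
      using inner_mv_transpose[of A y u] sym
      by (simp add: Ay sym_mats_def inner_commute del: transpose_matrix_vector)
    also have "\<dots> = u \<bullet> (A *v u)" by (simp add: Ay inner_commute)
    finally show ?thesis using nonneg[OF Pu] by simp
  qed
  then show ?thesis using sym by (simp add: psd_mats_def)
qed

lemma dim_kernel_mats:
  fixes G :: "real^'n^'n"
  assumes "invertible G"
  shows "dim (kernel_mats G J) = (card J + 1) choose 2"
proof -
  obtain H where H: "G ** H = mat 1" "H ** G = mat 1" using assms invertible_def by blast
  have tH: "transpose H ** transpose G = mat 1" "transpose G ** transpose H = mat 1"
    using H by (metis matrix_transpose_mul transpose_mat)+
  define \<phi> where "\<phi> = (\<lambda>A. transpose H ** A ** H)"
  have lin: "linear \<phi>"
    using linear_compose[OF linear_matrix_mult_left linear_matrix_mult_right]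
    by (simp add: \<phi>_def o_def)
  have inv: "transpose G ** \<phi> A ** G = A" for A
  proof -
    have "transpose G ** \<phi> A ** G = (transpose G ** transpose H) ** A ** (H ** G)"
      by (simp only: \<phi>_def matrix_mul_assoc)
    then show ?thesis by (simp add: H tH)
  qed
  have inv': "\<phi> (transpose G ** X ** G) = X" for X
  proof -
    have "\<phi> (transpose G ** X ** G) = (transpose H ** transpose G) ** X ** (G ** H)"
      by (simp only: \<phi>_def matrix_mul_assoc)
    then show ?thesis by (simp add: H tH)
  qed
  have "inj \<phi>" by (metis inv injI)
  moreover have "kernel_mats G J = \<phi> ` sym_supp J"
  proof (intro equalityI subsetI)
    fix X assume X: "X \<in> kernel_mats G J"
    then have "transpose G ** X ** G \<in> sym_supp J" by (rule kernel_mats_congruence)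
    then show "X \<in> \<phi> ` sym_supp J" using inv'[of X] by force
  next
    fix X assume "X \<in> \<phi> ` sym_supp J"
    then obtain A where A: "A \<in> sym_mats" "A ** cproj (- J) = 0" "X = \<phi> A" by (auto simp: sym_supp_iff)
    have "\<phi> A ** G ** cproj (- J) = transpose H ** A ** (H ** G) ** cproj (- J)"
      by (simp only: \<phi>_def matrix_mul_assoc)
    also have "\<dots> = transpose H ** (A ** cproj (- J))" by (simp add: H matrix_mul_assoc)
    finally show "X \<in> kernel_mats G J"
      using A sym_mats_congruence(1)[of A H] by (simp add: kernel_mats_def \<phi>_def)
  qed
  ultimately show ?thesis
    using dim_image_eq[OF lin, of "sym_supp J"] by (simp add: dim_sym_supp inj_on_subset)
qed

lemma dim_Int_sym_ge:
  fixes L Q :: "(real^'n^'n) set"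
  assumes "subspace L" "subspace Q" "L \<subseteq> sym_mats" "Q \<subseteq> sym_mats"
  shows "dim L + dim Q \<le> dim (L \<inter> Q) + ((CARD('n) + 1) choose 2)"
proof -
  have "{x + y |x y. x \<in> L \<and> y \<in> Q} \<subseteq> sym_mats"
    using assms subspace_add[OF subspace_sym_mats] by blast
  then have "dim {x + y |x y. x \<in> L \<and> y \<in> Q} \<le> (CARD('n) + 1) choose 2"
    unfolding dim_sym_mats[symmetric] by (rule dim_subset)
  then show ?thesis using dim_sums_Int[OF assms(1,2)] by simp
qed

section \<open>Polynomial parametrization of the kernel of a family of linear maps\<close>

text \<open>Cramer's rule applied to the square system E (M c) + F c = F z, cleared of its denominator.\<close>

definition kernel_param ::
  "('b::euclidean_space \<Rightarrow> real^'m) \<Rightarrow> (real^'m \<Rightarrow> real^'m) \<Rightarrow> (real^'m \<Rightarrow> 'b) \<Rightarrow> real^'m \<Rightarrow> real^'m" where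
  "kernel_param E F M z =
     (\<chi> k. det (\<chi> i j. if j = k then F z $ i else matrix (\<lambda>c. E (M c) + F c) $ i $ j))"

lemma kernel_param_system:
  assumes "linear E" "linear F" "linear M" and N: "det (matrix (\<lambda>c. E (M c) + F c)) \<noteq> 0"
  shows "E (M (kernel_param E F M z)) + F (kernel_param E F M z)
    = det (matrix (\<lambda>c. E (M c) + F c)) *\<^sub>R F z"
proof -
  let ?N = "\<lambda>c. E (M c) + F c"
  let ?d = "det (matrix ?N)"
  have lin: "linear ?N"
    using linear_compose_add[OF linear_compose[OF assms(3,1)] assms(2)] by (simp add: o_def)
  have "matrix ?N *v (kernel_param E F M z /\<^sub>R ?d) = F z"
    unfolding cramer[OF N] by (simp add: kernel_param_def vec_eq_iff divide_inverse mult.commute)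
  then have "?N (kernel_param E F M z) /\<^sub>R ?d = F z"
    using matrix_vector_mul(2)[OF lin, THEN fun_cong] by (simp add: linear_scale[OF lin])
  then show ?thesis using N by (metis inverse_zero_imp_zero scaleR_left_imp_eq scaleR_scaleR right_inverse scaleR_one)
qed

text \<open>At the base point M0 the map E inverts M0 on a complement of its kernel and F projects onto the
  kernel.  Wherever the system stays regular, its solutions with right-hand side in the range of F form
  a space that contains the kernel of M and has the dimension of the kernel of M0.  So it is the kernel
  of M as long as the dimension does not drop.\<close>

lemma kernel_chart:
  fixes M0 :: "real^'m \<Rightarrow> 'b::euclidean_space"
  assumes M0: "linear M0"
  obtains E F where "linear E" "linear F"
    "det (matrix (\<lambda>c. E (M0 c) + F c)) = 1"
    "\<And>c. M0 c = 0 \<Longrightarrow> kernel_param E F M0 c = c"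
    "\<And>M z. linear M \<Longrightarrow> dim {c. M0 c = 0} \<le> dim {c. M c = 0} \<Longrightarrow>
       det (matrix (\<lambda>c. E (M c) + F c)) \<noteq> 0 \<Longrightarrow> M (kernel_param E F M z) = 0"
proof -
  define K where "K = {c. M0 c = 0}"
  have K: "subspace K" unfolding K_def by (rule linear_subspace_kernel[OF M0])
  define K' where "K' = orthogonal_comp K"
  have K': "subspace K'" by (simp add: K'_def subspace_orthogonal_comp)
  have KK': "x = 0" if "x \<in> K" "x \<in> K'" for x
    using that by (auto simp: K'_def orthogonal_comp_def orthogonal_def)
  have "inj_on M0 K'"
    using KK' linear_diff[OF M0] subspace_diff[OF K']
    by (intro inj_onI) (metis (mono_tags, lifting) K_def eq_iff_diff_eq_0 mem_Collect_eq)
  then obtain E where E: "range E \<subseteq> K'" "linear E" "\<forall>v\<in>K'. E (M0 v) = v"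
    using linear_exists_left_inverse_on[OF M0 K'] by blast
  define F where "F = (\<lambda>c. c - E (M0 c))"
  have linF: "linear F"
    using linear_compose_sub[OF linear_ident linear_compose[OF M0 E(2)]] by (simp add: F_def o_def id_def)
  have FK: "F c \<in> K" for c
  proof -
    obtain y z where yz: "y \<in> span K" "\<And>w. w \<in> span K \<Longrightarrow> orthogonal z w" "c = y + z"
      using orthogonal_subspace_decomp_exists[of K c] by blast
    have y: "M0 y = 0" using yz(1) K by (simp add: K_def span_eq_iff[THEN iffD2, OF K[unfolded K_def]])
    have "z \<in> K'" using yz(2) span_base by (auto simp: K'_def orthogonal_comp_def orthogonal_commute)
    then have "F c = y" using E(3) y yz(3) linear_add[OF M0] by (simp add: F_def)
    then show ?thesis using y by (simp add: K_def)
  qed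
  have id0: "(\<lambda>c. E (M0 c) + F c) = (\<lambda>c. c)" by (simp add: F_def)
  have mat0: "matrix (\<lambda>c. E (M0 c) + F c) = mat 1"
    unfolding id0 using matrix_id_mat_1 by (simp add: id_def)
  show thesis
  proof (rule that[OF E(2) linF])
    show det1: "det (matrix (\<lambda>c. E (M0 c) + F c)) = 1" by (simp add: mat0)
    fix c assume c: "M0 c = 0"
    have "kernel_param E F M0 c = F c"
      using kernel_param_system[OF E(2) linF M0, of c] det1 id0 by (metis scaleR_one zero_neq_one)
    then show "kernel_param E F M0 c = c" using c linear_0[OF E(2)] by (simp add: F_def)
  next
    fix M :: "real^'m \<Rightarrow> 'b" and z
    assume M: "linear M" and dim: "dim {c. M0 c = 0} \<le> dim {c. M c = 0}"
      and N: "det (matrix (\<lambda>c. E (M c) + F c)) \<noteq> 0"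
    let ?N = "\<lambda>c. E (M c) + F c"
    have lin: "linear ?N"
      using linear_compose_add[OF linear_compose[OF M E(2)] linF] by (simp add: o_def)
    have bij: "inj ?N" "surj ?N"
      using invertible_matrix_vector_bij[of "matrix ?N"] N matrix_vector_mul(2)[OF lin]
      by (simp_all add: invertible_det_nz)
    define W where "W = {c. ?N c \<in> K}"
    have W: "subspace W"
      using linear_subspace_vimage[OF lin K] by (simp add: W_def vimage_def)
    have "?N ` W = K"
      using surj_image_vimage_eq[OF bij(2), of K] by (simp add: W_def vimage_def)
    then have dimW: "dim W = dim K" using dim_image_eq[OF lin, of W] bij(1) by (metis inj_on_subset subset_UNIV)
    have "{c. M c = 0} \<subseteq> W" using FK linear_0[OF E(2)] by (auto simp: W_def)
    then have W_eq: "{c. M c = 0} = W"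
      using subspace_dim_equal[OF linear_subspace_kernel[OF M] W] dim dimW by (simp add: K_def)
    have "kernel_param E F M z \<in> W"
      using kernel_param_system[OF E(2) linF M N, of z] FK K by (simp add: W_def subspace_scale)
    then show "M (kernel_param E F M z) = 0" using W_eq by auto
  qed
qed

lemma kernel_param_surj:
  assumes "linear E" "linear F" "linear M" and N: "det (matrix (\<lambda>c. E (M c) + F c)) \<noteq> 0"
    and c: "M c = 0"
  shows "\<exists>z. kernel_param E F M z = c"
proof -
  let ?N = "\<lambda>c. E (M c) + F c"
  let ?d = "det (matrix ?N)"
  have lin: "linear ?N"
    using linear_compose_add[OF linear_compose[OF assms(3,1)] assms(2)] by (simp add: o_def)
  have "inj ?N"
    using invertible_matrix_vector_bij[of "matrix ?N"] N matrix_vector_mul(2)[OF lin]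
    by (simp add: invertible_det_nz)
  moreover have "?N (kernel_param E F M (c /\<^sub>R ?d)) = ?N c"
    using kernel_param_system[OF assms(1-4), of "c /\<^sub>R ?d"] N c linear_0[OF assms(1)]
    by (simp add: linear_scale[OF assms(2)])
  ultimately show ?thesis by (meson injD)
qed

lemma polynomial_function_matrix:
  fixes N :: "'a::euclidean_space \<Rightarrow> real^'m \<Rightarrow> real^'k"
  assumes "\<And>c. polynomial_function (\<lambda>\<theta>. N \<theta> c)"
  shows "polynomial_function (\<lambda>\<theta>. matrix (N \<theta>))"
  unfolding matrix_def by (intro pf_intros assms)

lemma polynomial_function_kernel_param:
  fixes M :: "'a::euclidean_space \<Rightarrow> real^'m \<Rightarrow> 'b::euclidean_space"
  assumes "linear E" "linear F" "\<And>c. polynomial_function (\<lambda>\<theta>. M \<theta> c)" "polynomial_function z"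
  shows "polynomial_function (\<lambda>\<theta>. kernel_param E F (M \<theta>) (z \<theta>))"
    and "polynomial_function (\<lambda>\<theta>. matrix (\<lambda>c. E (M \<theta> c) + F c))"
proof -
  show mat: "polynomial_function (\<lambda>\<theta>. matrix (\<lambda>c. E (M \<theta> c) + F c))"
    by (intro polynomial_function_matrix polynomial_function_add polynomial_function_const
        polynomial_function_bounded_linear_compose[OF assms(1)] assms)
  have "real_polynomial_function (\<lambda>\<theta>. if j = k then F (z \<theta>) $ i else matrix (\<lambda>c. E (M \<theta> c) + F c) $ i $ j)" for i j k
    using rpf_mat_nth[OF mat] rpf_vec_nth[OF polynomial_function_bounded_linear_compose[OF assms(2,4)]]
    by (cases "j = k") simp_all
  then show "polynomial_function (\<lambda>\<theta>. kernel_param E F (M \<theta>) (z \<theta>))"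
    unfolding kernel_param_def by (intro polynomial_function_vec_lambda rpf_imp_pf rpf_det)
qed

section \<open>Positive definite faces of a linear subspace\<close>

definition comb :: "(real^'n^'n)^'m \<Rightarrow> real^'m \<Rightarrow> real^'n^'n" where
  "comb v c = (\<Sum>a\<in>UNIV. c $ a *\<^sub>R v $ a)"

lemma linear_comb: "linear (comb v)"
  by (auto intro!: linearI simp: comb_def scaleR_add_left sum.distrib scaleR_sum_right)

lemma subspace_range_comb: "subspace (range (comb v))"
  using linear_subspace_image[OF linear_comb subspace_UNIV] .

lemma comb_axis: "comb v (axis a 1) = v $ a"
proof -
  have "comb v (axis a 1) = (\<Sum>b\<in>UNIV. if b = a then v $ b else 0)"
    unfolding comb_def by (rule sum.cong) (auto simp: axis_def)
  then show ?thesis by simp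
qed

lemma comb_in_sym: "(\<And>a. v $ a \<in> sym_mats) \<Longrightarrow> comb v c \<in> sym_mats"
  unfolding comb_def by (intro subspace_sum[OF subspace_sym_mats] subspace_scale[OF subspace_sym_mats]) auto

lemma orthogonal_range_comb: "(\<forall>Z \<in> range (comb v). Y \<bullet> Z = 0) \<longleftrightarrow> (\<forall>a. v $ a \<bullet> Y = 0)"
proof
  assume "\<forall>Z \<in> range (comb v). Y \<bullet> Z = 0"
  then have "Y \<bullet> comb v (axis a 1) = 0" for a by blast
  then show "\<forall>a. v $ a \<bullet> Y = 0" by (simp add: comb_axis inner_commute)
qed (auto simp: comb_def inner_sum_right inner_commute)

lemma dim_range_comb: "inj (comb (v :: (real^'n^'n)^'m)) \<Longrightarrow> dim (range (comb v)) = CARD('m)"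
  using dim_image_eq[OF linear_comb, of v UNIV] by simp

lemma comb_of_basis:
  fixes f :: "'m::finite \<Rightarrow> real^'n^'n"
  assumes inj: "inj f" and ind: "independent (range f)" and span: "span (range f) = L"
  shows "range (comb (\<chi> a. f a)) = L" "inj (comb (\<chi> a. f a))"
proof -
  let ?v = "\<chi> a. f a"
  show "range (comb ?v) = L"
  proof
    have "comb ?v c \<in> span (range f)" for c
      unfolding comb_def by (intro span_sum span_scale span_base) simp
    then show "range (comb ?v) \<subseteq> L" using span by auto
    have "f a \<in> range (comb ?v)" for a
      using comb_axis[of ?v a] by (metis rangeI vec_lambda_beta)
    then have "range f \<subseteq> range (comb ?v)" by blast
    then show "L \<subseteq> range (comb ?v)"
      unfolding span[symmetric] by (intro span_minimal subspace_range_comb)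
  qed
  have "c = 0" if c: "comb ?v c = 0" for c
  proof -
    have "(\<Sum>b\<in>range f. c $ (inv f b) *\<^sub>R b) = 0"
      using c inj by (simp add: comb_def sum.reindex)
    then have "c $ (inv f (f a)) = 0" for a
      using independentD[OF ind _ subset_refl, of "\<lambda>b. c $ (inv f b)" "f a"] by simp
    then show ?thesis using inj by (simp add: vec_eq_iff)
  qed
  then show "inj (comb ?v)" using linear_injective_0[OF linear_comb] by blast
qed

lemma subspace_has_comb:
  fixes L :: "(real^'n^'n) set"
  assumes "subspace L" "dim L = CARD('m)"
  obtains v :: "(real^'n^'n)^'m" where "range (comb v) = L" "inj (comb v)"
proof -
  obtain B where B: "B \<subseteq> L" "independent B" "L \<subseteq> span B" "card B = dim L"
    using basis_exists[of L] by blast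
  have "span B = L" using B assms by (simp add: span_minimal subset_antisym)
  moreover obtain f where f: "bij_betw f (UNIV :: 'm set) B"
    using finite_same_card_bij[of "UNIV :: 'm set" B] B assms(2) independent_imp_finite[of B] by auto
  ultimately show ?thesis
    using that[of "\<chi> a. f a"] comb_of_basis[of f L] B(2) by (simp add: bij_betw_def)
qed

definition kernel_map :: "(real^'n^'n)^'m \<Rightarrow> real^'n^'n \<Rightarrow> 'n set \<Rightarrow> real^'m \<Rightarrow> real^'n^'n" where
  "kernel_map v G J c = comb v c ** G ** cproj (- J)"

lemma linear_kernel_map: "linear (kernel_map v G J)"
proof -
  have "linear (\<lambda>c. comb v c ** (G ** cproj (- J)))"
    using linear_compose[OF linear_comb linear_matrix_mult_right] by (simp add: o_def)
  then show ?thesis by (simp add: kernel_map_def[abs_def] matrix_mul_assoc)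
qed

lemma kernel_map_eq_0:
  assumes "\<And>a. v $ a \<in> sym_mats"
  shows "kernel_map v G J c = 0 \<longleftrightarrow> comb v c \<in> kernel_mats G J"
  using comb_in_sym[OF assms] by (simp add: kernel_map_def kernel_mats_def)

lemma dim_kernel_kernel_map:
  assumes v: "\<And>a. v $ a \<in> sym_mats" and inj: "inj (comb v)"
  shows "dim {c. kernel_map v G J c = 0} = dim (range (comb v) \<inter> kernel_mats G J)"
proof -
  have "comb v ` {c. kernel_map v G J c = 0} = range (comb v) \<inter> kernel_mats G J"
    by (auto simp: kernel_map_eq_0[OF v])
  then show ?thesis
    using dim_image_eq[OF linear_comb, of v "{c. kernel_map v G J c = 0}"] inj
    by (metis inj_on_subset subset_UNIV)
qed

text \<open>For symmetric X: the subspace L and the symmetric matrices whose column space lies in that of X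
  together span the symmetric matrices.  The definition expresses this by the orthogonal complement.\<close>

definition regular_at :: "(real^'n^'n) set \<Rightarrow> real^'n^'n \<Rightarrow> bool" where
  "regular_at L X \<longleftrightarrow> (\<forall>Y\<in>sym_mats. (\<forall>Z\<in>L. Y \<bullet> Z = 0) \<and> X ** Y ** X = 0 \<longrightarrow> Y = 0)"

lemma regular_at_scale:
  fixes X :: "real^'n^'n"
  assumes "regular_at L (c *\<^sub>R X)" shows "regular_at L X"
  unfolding regular_at_def
proof (intro ballI impI)
  fix Y :: "real^'n^'n" assume Y: "Y \<in> sym_mats" "(\<forall>Z\<in>L. Y \<bullet> Z = 0) \<and> X ** Y ** X = 0"
  have "(c *\<^sub>R X) ** Y ** (c *\<^sub>R X) = (c * c) *\<^sub>R (X ** Y ** X)"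
    by (simp add: scalar_matrix_assoc[symmetric] matrix_scalar_ac)
  then show "Y = 0" using assms Y unfolding regular_at_def by simp
qed

lemma sym_sandwich_inner:
  assumes "X \<in> sym_mats" shows "Y \<bullet> (X ** Z ** X) = (X ** Y ** X) \<bullet> Z"
proof -
  have tX: "transpose X = X" using assms by (simp add: sym_mats_def)
  have "(X ** Z ** X) \<bullet> Y = (X ** Z) \<bullet> (Y ** X)" by (simp add: inner_matrix_mult_right tX)
  also have "\<dots> = Z \<bullet> (X ** (Y ** X))" by (simp add: inner_matrix_mult_left tX)
  finally show ?thesis by (simp add: inner_commute matrix_mul_assoc)
qed

text \<open>A symmetric Y that is orthogonal to L and to the kernel matrices is orthogonal to X Z X for every
  symmetric Z, so that X Y X = 0.  By regularity the two subspaces span the symmetric matrices.\<close>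

lemma dim_Int_kernel_mats_regular:
  fixes G :: "real^'n^'n"
  assumes L: "subspace L" "L \<subseteq> sym_mats" and G: "invertible G"
    and X: "X \<in> kernel_mats G J" "regular_at L X"
  shows "dim (L \<inter> kernel_mats G J) + ((CARD('n) + 1) choose 2) = dim L + ((card J + 1) choose 2)"
proof -
  let ?T = "{x + y |x y. x \<in> L \<and> y \<in> kernel_mats G J}"
  have T: "subspace ?T" by (rule subspace_sums[OF L(1) subspace_kernel_mats])
  have K: "kernel_mats G J \<subseteq> sym_mats" by (auto simp: kernel_mats_def)
  have symX: "X \<in> sym_mats" using X K by blast
  have "?T \<subseteq> sym_mats" using L(2) K subspace_add[OF subspace_sym_mats] by blast
  have "?T = sym_mats"
  proof (rule ccontr)
    assume "?T \<noteq> sym_mats"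
    obtain Y where Y: "Y \<noteq> 0" "Y \<in> sym_mats" "\<And>y. y \<in> ?T \<Longrightarrow> Y \<bullet> y = 0"
      by (rule orthogonal_in_larger_subspace[OF T subspace_sym_mats \<open>?T \<subseteq> sym_mats\<close> \<open>?T \<noteq> sym_mats\<close>])
        (rule that)
    have L_T: "Z \<in> ?T" if "Z \<in> L" for Z
    proof -
      have "Z = Z + 0 \<and> Z \<in> L \<and> 0 \<in> kernel_mats G J"
        using that subspace_0[OF subspace_kernel_mats] by simp
      then show ?thesis by blast
    qed
    have K_T: "Z \<in> ?T" if "Z \<in> kernel_mats G J" for Z
    proof -
      have "Z = 0 + Z \<and> 0 \<in> L \<and> Z \<in> kernel_mats G J"
        using that subspace_0[OF L(1)] by simp
      then show ?thesis by blast
    qed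
    let ?Z = "X ** Y ** X"
    have tX: "transpose X = X" using symX by (simp add: sym_mats_def)
    have symZ: "?Z \<in> sym_mats" using sym_mats_congruence(1)[OF Y(2), of X] by (simp add: tX)
    have "X ** ?Z ** X \<in> sym_mats" using sym_mats_congruence(1)[OF symZ, of X] by (simp add: tX)
    moreover have "X ** ?Z ** X ** G ** cproj (- J) = X ** ?Z ** (X ** G ** cproj (- J))"
      by (simp add: matrix_mul_assoc)
    ultimately have "X ** ?Z ** X \<in> kernel_mats G J" using X(1) by (simp add: kernel_mats_def)
    then have "Y \<bullet> (X ** ?Z ** X) = 0" by (intro Y(3) K_T)
    then have "?Z \<bullet> ?Z = 0" unfolding sym_sandwich_inner[OF symX] .
    then have "?Z = 0" by simp
    moreover have "\<forall>Z\<in>L. Y \<bullet> Z = 0" by (intro ballI Y(3) L_T)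
    ultimately show False using X(2) Y(1,2) unfolding regular_at_def by blast
  qed
  then show ?thesis
    using dim_sums_Int[OF L(1) subspace_kernel_mats[of G J]] dim_kernel_mats[OF G, of J] dim_sym_mats[where 'n='n]
    by simp
qed

text \<open>Symmetry is not required, so that this is an open set of matrices.\<close>

definition posdefs :: "(real^'n^'n) set" where
  "posdefs = {A. \<forall>x. x \<noteq> 0 \<longrightarrow> 0 < x \<bullet> (A *v x)}"

lemma mat_1_posdefs: "mat 1 \<in> posdefs"
  by (simp add: posdefs_def)

lemma open_posdefs: "open (posdefs :: (real^'n^'n) set)"
proof -
  define R :: "real^'n \<Rightarrow> real^'n^'n" where "R = (\<lambda>x. \<chi> i j. x $ i * x $ j)"
  have form: "x \<bullet> (A *v x) = A \<bullet> R x" for A x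
    by (simp add: R_def inner_vec_def matrix_vector_mult_def sum_distrib_left mult_ac)
  have "continuous_on (sphere 0 1) R"
    unfolding R_def by (intro continuous_intros)
  then have comp: "compact (R ` sphere 0 1)" by (intro compact_continuous_image) auto
  then obtain B where B: "\<forall>r \<in> R ` sphere 0 1. norm r \<le> B" "B > 0"
    using compact_imp_bounded bounded_pos by metis
  show ?thesis
    unfolding open_contains_ball
  proof
    fix A :: "real^'n^'n" assume A: "A \<in> posdefs"
    have "R ` sphere 0 1 \<noteq> {}" by simp
    moreover have "continuous_on (R ` sphere 0 1) (\<lambda>r. A \<bullet> r)" by (intro continuous_intros)
    ultimately obtain r where r: "r \<in> R ` sphere 0 1" and rmin: "\<And>r'. r' \<in> R ` sphere 0 1 \<Longrightarrow> A \<bullet> r \<le> A \<bullet> r'"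
      using continuous_attains_inf[OF comp] by blast
    define m where "m = A \<bullet> r"
    obtain x where "r = R x" "norm x = 1" using r by auto
    then have "m = x \<bullet> (A *v x)" "x \<noteq> 0" by (auto simp: m_def form)
    then have m: "m > 0" using A by (simp add: posdefs_def)
    have "A' \<in> posdefs" if A': "A' \<in> ball A (m / B)" for A'
    proof -
      have "0 < y \<bullet> (A' *v y)" if "y \<noteq> 0" for y
      proof -
        define u where "u = y /\<^sub>R norm y"
        have u: "R u \<in> R ` sphere 0 1" using that by (simp add: u_def)
        have "\<bar>(A - A') \<bullet> R u\<bar> \<le> norm (A - A') * norm (R u)" by (rule Cauchy_Schwarz_ineq2)
        also have "\<dots> \<le> norm (A - A') * B" using B u by (intro mult_left_mono) auto
        also have "\<dots> < m" using A' B by (simp add: dist_norm field_simps)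
        finally have "A \<bullet> R u - A' \<bullet> R u < m" by (simp add: inner_diff_left)
        moreover have "m \<le> A \<bullet> R u" unfolding m_def by (rule rmin[OF u])
        ultimately have "0 < u \<bullet> (A' *v u)" by (simp add: form)
        also have "\<dots> = (y \<bullet> (A' *v y)) / (norm y)\<^sup>2"
          by (simp add: u_def matrix_vector_mult_scaleR power2_eq_square divide_inverse mult_ac)
        finally show ?thesis using that by (simp add: zero_less_divide_iff)
      qed
      then show ?thesis by (simp add: posdefs_def)
    qed
    moreover have "m / B > 0" using m B by simp
    ultimately show "\<exists>e>0. ball A e \<subseteq> posdefs" by blast
  qed
qed

text \<open>For an open set of coordinate systems G, the subspace L contains a matrix of rank |J| that is
  positive definite on the span of the columns of G indexed by J and vanishes on the other columns.
  Adding the projection onto the coordinates outside J makes positivity an open condition.\<close>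

definition pd_face :: "(real^'n^'n) set \<Rightarrow> 'n set \<Rightarrow> bool" where
  "pd_face L J \<longleftrightarrow> J \<noteq> {} \<and> (\<exists>U. open U \<and> U \<noteq> {} \<and>
     (\<forall>G\<in>U. invertible G \<and> (\<exists>X \<in> L \<inter> kernel_mats G J. transpose G ** X ** G + cproj (- J) \<in> posdefs)))"

lemma polynomial_function_comb:
  fixes v :: "'a::euclidean_space \<Rightarrow> (real^'n^'n)^'m"
  assumes "polynomial_function v" "polynomial_function c"
  shows "polynomial_function (\<lambda>\<theta>. comb (v \<theta>) (c \<theta>))"
  unfolding comb_def by (intro pf_intros assms) auto

lemma polynomial_function_kernel_map:
  fixes v :: "'a::euclidean_space \<Rightarrow> (real^'n^'n)^'m"
  assumes "polynomial_function v" "polynomial_function G"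
  shows "polynomial_function (\<lambda>\<theta>. kernel_map (v \<theta>) (G \<theta>) J c)"
  unfolding kernel_map_def by (intro pf_intros polynomial_function_comb assms)

lemma open_det_nonzero: "open {G :: real^'n^'n. det G \<noteq> 0}"
proof -
  have "open (det -` (- {0}) :: (real^'n^'n) set)"
    by (intro open_vimage continuous_on_det) auto
  then show ?thesis by (simp add: vimage_def)
qed

lemma pd_face_if_all:
  fixes L :: "(real^'n^'n) set"
  assumes "J \<noteq> {}"
    "\<And>G :: real^'n^'n. invertible G \<Longrightarrow> \<exists>X \<in> L \<inter> kernel_mats G J. transpose G ** X ** G + cproj (- J) \<in> posdefs"
  shows "pd_face L J"
proof -
  have "mat 1 \<in> {G :: real^'n^'n. det G \<noteq> 0}" by simp
  then have "{G :: real^'n^'n. det G \<noteq> 0} \<noteq> {}" by blast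
  then show ?thesis
    unfolding pd_face_def using assms open_det_nonzero
    by (intro conjI exI[of _ "{G :: real^'n^'n. det G \<noteq> 0}"]) (auto simp: invertible_det_nz)
qed

lemma pd_face_UNIV:
  fixes L :: "(real^'n^'n) set"
  assumes "L \<inter> pd_mats \<noteq> {}" shows "pd_face L UNIV"
proof -
  obtain K where K: "K \<in> L" "K \<in> pd_mats" using assms by blast
  have "transpose G ** K ** G \<in> posdefs" if "invertible G" for G :: "real^'n^'n"
  proof -
    have "x \<bullet> ((transpose G ** K ** G) *v x) = (G *v x) \<bullet> (K *v (G *v x))" for x
      by (simp add: inner_mv_transpose matrix_vector_mul_assoc[symmetric])
    moreover have "G *v x \<noteq> 0" if "x \<noteq> 0" for x
      using invertible_matrix_vector_bij(1)[OF \<open>invertible G\<close>] that by (metis injD matrix_vector_mult_0_right)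
    ultimately show ?thesis using K(2) by (auto simp: posdefs_def pd_mats_def)
  qed
  moreover have "K \<in> L \<inter> kernel_mats G UNIV" for G
    using K by (simp add: kernel_mats_def pd_mats_def)
  ultimately show ?thesis by (intro pd_face_if_all) auto
qed

text \<open>At a regular point the kernel equations keep a solution when the coordinate system moves, and
  the solution stays positive definite on the moving column space.\<close>

lemma pd_face_of_regular:
  fixes v :: "(real^'n^'n)^'m"
  assumes v: "\<And>a. v $ a \<in> sym_mats" and inj: "inj (comb v)"
    and X: "X \<in> range (comb v)" "X \<in> psd_mats" "X \<noteq> 0" "regular_at (range (comb v)) X"
  obtains J where "card J = rank X" "pd_face (range (comb v)) J"
proof -
  let ?L = "range (comb v)"
  have L: "subspace ?L" "?L \<subseteq> sym_mats" using subspace_range_comb comb_in_sym[OF v] by auto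
  have "rank X \<le> CARD('n)" using rank_bound[of X] by simp
  then obtain J :: "'n set" where J: "card J = rank X"
    using obtain_subset_with_card_n by blast
  obtain B :: "real^'n^'n" where B: "invertible B" "X = B ** cproj J ** transpose B"
    by (rule psd_congruent_cproj[OF X(2) J])
  obtain H :: "real^'n^'n" where H: "B ** H = mat 1" "H ** B = mat 1" using B(1) invertible_def by blast
  define G where "G = transpose H"
  have BG: "transpose B ** G = mat 1" using H by (metis G_def matrix_transpose_mul transpose_mat)
  have "G ** transpose B = mat 1" using H by (metis G_def matrix_transpose_mul transpose_mat)
  then have G: "invertible G" using BG invertible_def by blast
  have XG: "X ** G = B ** cproj J"
    using BG by (simp add: B(2) matrix_mul_assoc[symmetric])
  have "X ** G ** cproj (- J) = B ** (cproj J ** cproj (- J))"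
    by (simp add: XG matrix_mul_assoc)
  then have XK: "X \<in> kernel_mats G J"
    using X(2) by (simp add: kernel_mats_def psd_mats_def cproj_mult_cproj)
  have GXG: "transpose G ** X ** G = cproj J"
    using H by (simp add: matrix_mul_assoc[symmetric] XG) (simp add: G_def matrix_mul_assoc)
  obtain c where c: "X = comb v c" using X(1) by blast
  obtain E F where EF: "linear E" "linear F"
    and det1: "det (matrix (\<lambda>c. E (kernel_map v G J c) + F c)) = 1"
    and base: "\<And>c. kernel_map v G J c = 0 \<Longrightarrow> kernel_param E F (kernel_map v G J) c = c"
    and sol: "\<And>M z. linear M \<Longrightarrow> dim {c. kernel_map v G J c = 0} \<le> dim {c. M c = 0} \<Longrightarrow>
       det (matrix (\<lambda>c. E (M c) + F c)) \<noteq> 0 \<Longrightarrow> M (kernel_param E F M z) = 0"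
    by (rule kernel_chart[OF linear_kernel_map[of v G J]]) (rule that)
  define N where "N = (\<lambda>G'. det (matrix (\<lambda>c. E (kernel_map v G' J c) + F c)))"
  define Z where "Z = (\<lambda>G'. comb v (kernel_param E F (kernel_map v G' J) c))"
  have pfM: "polynomial_function (\<lambda>G'. kernel_map v G' J c')" for c'
    by (intro polynomial_function_kernel_map pf_intros)
  have rpfN: "real_polynomial_function N"
    unfolding N_def
    by (rule rpf_det[OF polynomial_function_kernel_param(2)[OF EF pfM polynomial_function_const]])
  have pfZ: "polynomial_function Z"
    unfolding Z_def
    by (rule polynomial_function_comb[OF polynomial_function_const
          polynomial_function_kernel_param(1)[OF EF pfM polynomial_function_const]])
  have ZK: "Z G' \<in> kernel_mats G' J" if G': "invertible G'" "N G' \<noteq> 0" for G'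
  proof -
    have "dim (?L \<inter> kernel_mats G J) + ((CARD('n) + 1) choose 2) = dim ?L + ((card J + 1) choose 2)"
      by (rule dim_Int_kernel_mats_regular[OF L G XK X(4)])
    moreover have "dim ?L + dim (kernel_mats G' J) \<le> dim (?L \<inter> kernel_mats G' J) + ((CARD('n) + 1) choose 2)"
      by (rule dim_Int_sym_ge[OF L(1) subspace_kernel_mats L(2)]) (auto simp: kernel_mats_def)
    ultimately have "dim {c. kernel_map v G J c = 0} \<le> dim {c. kernel_map v G' J c = 0}"
      unfolding dim_kernel_kernel_map[OF v inj] dim_kernel_mats[OF G'(1)] by simp
    then have "kernel_map v G' J (kernel_param E F (kernel_map v G' J) c) = 0"
      using G'(2) by (intro sol linear_kernel_map) (simp_all add: N_def)
    then show ?thesis by (simp add: Z_def kernel_map_eq_0[OF v])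
  qed
  define f where "f = (\<lambda>G'. transpose G' ** Z G' ** G' + cproj (- J))"
  define U where "U = {G'. det G' \<noteq> 0} \<inter> N -` (- {0}) \<inter> f -` posdefs"
  have "polynomial_function f" unfolding f_def by (intro pf_intros pfZ)
  then have "open U"
    unfolding U_def using rpfN
    by (intro open_Int open_det_nonzero open_vimage continuous_on_rpf continuous_on_polymonial_function
        open_posdefs) auto
  moreover have "G \<in> U"
  proof -
    have "kernel_map v G J c = 0" using XK c by (simp add: kernel_map_eq_0[OF v])
    then have "Z G = X" using base c by (simp add: Z_def)
    then have "f G = mat 1" by (simp add: f_def GXG)
    then show ?thesis using G det1 by (simp add: U_def N_def invertible_det_nz mat_1_posdefs)
  qed
  moreover have "J \<noteq> {}"
  proof
    assume "J = {}"
    then have "X = 0" using B(2) by simp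
    then show False using X(3) by simp
  qed
  moreover have "invertible G' \<and> (\<exists>X \<in> ?L \<inter> kernel_mats G' J. transpose G' ** X ** G' + cproj (- J) \<in> posdefs)"
    if "G' \<in> U" for G'
  proof -
    have G': "invertible G'" "N G' \<noteq> 0" "f G' \<in> posdefs"
      using that by (auto simp: U_def invertible_det_nz)
    have "Z G' \<in> ?L \<inter> kernel_mats G' J" using ZK[OF G'(1,2)] by (simp add: Z_def)
    then show ?thesis using G' unfolding f_def by blast
  qed
  ultimately have "pd_face ?L J" unfolding pd_face_def by blast
  then show ?thesis using that J by blast
qed

section \<open>Lowering the rank along a pencil\<close>

text \<open>Matrices as vectors, so that linear operators on matrices have determinants.\<close>

definition mat_of_vec :: "real^('n \<times> 'n) \<Rightarrow> real^'n^'n" where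
  "mat_of_vec y = (\<chi> i j. y $ (i, j))"

definition vec_of_mat :: "real^'n^'n \<Rightarrow> real^('n \<times> 'n)" where
  "vec_of_mat Y = (\<chi> p. Y $ fst p $ snd p)"

lemma mat_of_vec_inverse [simp]: "mat_of_vec (vec_of_mat Y) = Y" "vec_of_mat (mat_of_vec y) = y"
  by (simp_all add: mat_of_vec_def vec_of_mat_def vec_eq_iff)

lemma linear_mat_of_vec: "linear mat_of_vec" and linear_vec_of_mat: "linear vec_of_mat"
  by (auto intro!: linearI simp: mat_of_vec_def vec_of_mat_def vec_eq_iff)

text \<open>For symmetric X the quadratic form of this operator is a sum of squares.  It vanishes exactly at the
  symmetric Y that are orthogonal to all v a and satisfy X Y X = 0.\<close>

definition regularity_op :: "(real^'n^'n)^'m \<Rightarrow> real^'n^'n \<Rightarrow> real^'n^'n \<Rightarrow> real^'n^'n" where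
  "regularity_op v X Y =
     (\<Sum>a\<in>UNIV. (v $ a \<bullet> Y) *\<^sub>R v $ a) + X ** (X ** Y ** X) ** X + (Y - transpose Y)"

definition regularity_det :: "(real^'n^'n)^'m \<Rightarrow> real^'n^'n \<Rightarrow> real" where
  "regularity_det v X = det (matrix (\<lambda>y. vec_of_mat (regularity_op v X (mat_of_vec y))))"

lemma linear_regularity_op: "linear (regularity_op v X)"
proof -
  have "linear (\<lambda>Y. \<Sum>a\<in>UNIV. (v $ a \<bullet> Y) *\<^sub>R v $ a)"
    by (auto intro!: linearI simp: inner_add_right scaleR_add_left sum.distrib scaleR_sum_right)
  moreover have "linear (\<lambda>Y. X ** (X ** Y ** X) ** X)"
    using linear_compose[OF linear_compose[OF linear_matrix_mult_left[of "X ** X"] linear_matrix_mult_right[of X]]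
        linear_matrix_mult_right[of X]]
    by (simp add: o_def matrix_mul_assoc)
  moreover have "linear (\<lambda>Y :: real^'n^'n. Y - transpose Y)"
    by (rule linear_compose_sub[OF linear_ident linear_transpose_real])
  ultimately show ?thesis
    unfolding regularity_op_def[abs_def] by (intro linear_compose_add)
qed

lemma regularity_det_nonzero_iff:
  "regularity_det v X \<noteq> 0 \<longleftrightarrow> (\<forall>Y. regularity_op v X Y = 0 \<longrightarrow> Y = 0)"
proof -
  let ?f = "\<lambda>y. vec_of_mat (regularity_op v X (mat_of_vec y))"
  have lin: "linear ?f"
    using linear_compose[OF linear_compose[OF linear_mat_of_vec linear_regularity_op[of v X]] linear_vec_of_mat]
    by (simp add: o_def)
  have "regularity_det v X \<noteq> 0 \<longleftrightarrow> (\<forall>y. matrix ?f *v y = 0 \<longrightarrow> y = 0)"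
    unfolding regularity_det_def invertible_det_nz[symmetric] invertible_left_inverse
    by (rule matrix_left_invertible_ker)
  also have "\<dots> \<longleftrightarrow> (\<forall>y. ?f y = 0 \<longrightarrow> y = 0)"
    by (simp only: matrix_vector_mul(2)[OF lin, THEN fun_cong])
  also have "\<dots> \<longleftrightarrow> (\<forall>Y. regularity_op v X Y = 0 \<longrightarrow> Y = 0)"
    by (metis mat_of_vec_inverse linear_0[OF linear_vec_of_mat] linear_0[OF linear_mat_of_vec])
  finally show ?thesis .
qed

lemma regularity_det_nonzero_imp:
  fixes X :: "real^'n^'n" and v :: "(real^'n^'n)^'m"
  assumes "regularity_det v X \<noteq> 0" shows "regular_at (range (comb v)) X"
  unfolding regular_at_def
proof (intro ballI impI)
  fix Y :: "real^'n^'n"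
  assume Y: "Y \<in> sym_mats" "(\<forall>Z \<in> range (comb v). Y \<bullet> Z = 0) \<and> X ** Y ** X = 0"
  then have "v $ a \<bullet> Y = 0" for a using orthogonal_range_comb[of v Y] by simp
  then have "regularity_op v X Y = 0" using Y by (simp add: regularity_op_def sym_mats_def)
  then show "Y = 0" using assms regularity_det_nonzero_iff by blast
qed

lemma regular_imp_regularity_det_nonzero:
  assumes reg: "regular_at (range (comb v)) X" and X: "X \<in> sym_mats"
  shows "regularity_det v X \<noteq> 0"
  unfolding regularity_det_nonzero_iff
proof (intro allI impI)
  fix Y assume Y: "regularity_op v X Y = 0"
  have tX: "transpose X = X" using X by (simp add: sym_mats_def)
  have skew: "Y \<bullet> (Y - transpose Y) = ((Y - transpose Y) \<bullet> (Y - transpose Y)) / 2"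
    using inner_transpose[of Y Y] by (simp add: inner_diff_left inner_diff_right inner_commute)
  have squares: "(\<Sum>a\<in>UNIV. (v $ a \<bullet> Y) * (Y \<bullet> v $ a)) = (\<Sum>a\<in>UNIV. (v $ a \<bullet> Y)\<^sup>2)"
    by (simp add: power2_eq_square inner_commute)
  have "0 = Y \<bullet> regularity_op v X Y" using Y by simp
  also have "\<dots> = (\<Sum>a\<in>UNIV. (v $ a \<bullet> Y)\<^sup>2) + (X ** Y ** X) \<bullet> (X ** Y ** X)
      + ((Y - transpose Y) \<bullet> (Y - transpose Y)) / 2"
    by (simp only: regularity_op_def inner_add_right sym_sandwich_inner[OF X] skew inner_sum_right
        inner_scaleR_right squares)
  finally have sum0: "(\<Sum>a\<in>UNIV. (v $ a \<bullet> Y)\<^sup>2) + (X ** Y ** X) \<bullet> (X ** Y ** X)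
      + ((Y - transpose Y) \<bullet> (Y - transpose Y)) / 2 = 0" by simp
  have "(\<Sum>a\<in>UNIV. (v $ a \<bullet> Y)\<^sup>2) \<ge> 0" by (simp add: sum_nonneg)
  moreover have "(X ** Y ** X) \<bullet> (X ** Y ** X) \<ge> 0" "(Y - transpose Y) \<bullet> (Y - transpose Y) \<ge> 0"
    by (rule inner_ge_zero)+
  ultimately have zero: "(\<Sum>a\<in>UNIV. (v $ a \<bullet> Y)\<^sup>2) = 0" "(X ** Y ** X) \<bullet> (X ** Y ** X) = 0"
    "(Y - transpose Y) \<bullet> (Y - transpose Y) = 0"
    using sum0 by linarith+
  have "v $ a \<bullet> Y = 0" for a
    using zero(1) sum_nonneg_eq_0_iff[of UNIV "\<lambda>a. (v $ a \<bullet> Y)\<^sup>2"] by simp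
  then have "\<forall>Z \<in> range (comb v). Y \<bullet> Z = 0" using orthogonal_range_comb[of v Y] by simp
  moreover have "X ** Y ** X = 0" "Y \<in> sym_mats" using zero(2,3) by (simp_all add: sym_mats_def)
  ultimately show "Y = 0" using reg unfolding regular_at_def by blast
qed

lemma rpf_inner_const: "polynomial_function f \<Longrightarrow> real_polynomial_function (\<lambda>x. f x \<bullet> b)"
  for f :: "'a::euclidean_space \<Rightarrow> 'b::euclidean_space"
  unfolding real_polynomial_function_eq by (rule polynomial_function_inner)

lemma rpf_regularity_det:
  fixes v :: "'a::euclidean_space \<Rightarrow> (real^'n^'n)^'m"
  assumes "polynomial_function v" "polynomial_function X"
  shows "real_polynomial_function (\<lambda>\<theta>. regularity_det (v \<theta>) (X \<theta>))"
  unfolding regularity_det_def regularity_op_def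
  by (intro rpf_det polynomial_function_matrix polynomial_function_bounded_linear_compose[OF linear_vec_of_mat]
      polynomial_function_add polynomial_function_sum polynomial_function_scaleR rpf_inner_const
      polynomial_function_vecD polynomial_function_matrix_mult polynomial_function_const assms) simp

text \<open>The adjugate of A times B, by Cramer's rule.\<close>

definition adj_mult :: "real^'n^'n \<Rightarrow> real^'n^'n \<Rightarrow> real^'n^'n" where
  "adj_mult A B = (\<chi> k l. det (\<chi> i j. if j = k then B $ i $ l else A $ i $ j))"

lemma mult_adj_mult:
  assumes "det A \<noteq> 0" shows "A ** adj_mult A B = det A *\<^sub>R B"
proof -
  have "A *v ((1 / det A) *\<^sub>R column l (adj_mult A B)) = column l B" for l
    unfolding cramer[OF assms] by (simp add: adj_mult_def column_def vec_eq_iff cong: if_cong)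
  then have col: "(1 / det A) *\<^sub>R (A *v column l (adj_mult A B)) = column l B" for l
    by (simp add: matrix_vector_mult_scaleR)
  have "A *v column l (adj_mult A B) = det A *\<^sub>R column l B" for l
    unfolding col[of l, symmetric] using assms by simp
  then have "(A *v column l (adj_mult A B)) $ i = det A * B $ i $ l" for i l
    by (simp add: column_def)
  then show ?thesis
    by (simp add: vec_eq_iff matrix_matrix_mult_def matrix_vector_mult_def column_def)
qed

lemma polynomial_function_adj_mult:
  fixes A B :: "'a::euclidean_space \<Rightarrow> real^'n^'n"
  assumes "polynomial_function A" "polynomial_function B"
  shows "polynomial_function (\<lambda>\<theta>. adj_mult (A \<theta>) (B \<theta>))"
proof -
  have "real_polynomial_function (\<lambda>\<theta>. if j = k then B \<theta> $ i $ l else A \<theta> $ i $ j)" for i j k l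
    using rpf_mat_nth[OF assms(1)] rpf_mat_nth[OF assms(2)] by (cases "j = k") simp_all
  then show ?thesis
    unfolding adj_mult_def by (intro polynomial_function_vec_lambda rpf_imp_pf rpf_det)
qed

fun mpow :: "real^'n^'n \<Rightarrow> nat \<Rightarrow> real^'n^'n" where
  "mpow C 0 = mat 1"
| "mpow C (Suc i) = C ** mpow C i"

lemma mpow_eigen: "C *v x = \<kappa> *\<^sub>R x \<Longrightarrow> mpow C i *v x = \<kappa> ^ i *\<^sub>R x"
  by (induction i) (simp_all add: matrix_vector_mul_assoc[symmetric] matrix_vector_mult_scaleR)

lemma polynomial_function_mpow:
  fixes C :: "'a::euclidean_space \<Rightarrow> real^'n^'n"
  shows "polynomial_function C \<Longrightarrow> polynomial_function (\<lambda>\<theta>. mpow (C \<theta>) i)"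
  by (induction i) (auto intro: polynomial_function_matrix_mult)

text \<open>Regularity at X1 - t X0 for every root t of det (B - t A) follows from the nonvanishing of one
  polynomial.  Write the regularity determinant of \<delta> X1 - \<kappa> X0, where \<delta> = det A, as a
  polynomial in \<kappa> and substitute for \<kappa> the matrix C = adj(A) B: every eigenvector of C with eigenvalue
  \<kappa> = \<delta> t becomes an eigenvector of the resulting matrix, whose eigenvalue is the regularity
  determinant at \<delta> (X1 - t X0).\<close>

lemma pencil_polynomial:
  obtains R :: "((real^'n^'n)^'m) \<times> (real^'n^'n) \<times> (real^'n^'n) \<times> (real^'n^'n) \<times> (real^'n^'n) \<Rightarrow> real"
  where "real_polynomial_function R"
    "\<And>v X0 X1 A B t x. R (v, X0, X1, A, B) \<noteq> 0 \<Longrightarrow> det A \<noteq> 0 \<Longrightarrow> x \<noteq> 0 \<Longrightarrow> B *v x = t *\<^sub>R (A *v x) \<Longrightarrow>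
       regular_at (range (comb v)) (X1 - t *\<^sub>R X0)"
    "\<And>v X0 X1 d. (\<forall>i. X1 - d i *\<^sub>R X0 \<in> sym_mats \<and> regular_at (range (comb v)) (X1 - d i *\<^sub>R X0)) \<Longrightarrow>
       R (v, X0, X1, mat 1, diag_mat d) \<noteq> 0"
proof -
  let ?p = "\<lambda>z :: ((real^'n^'n)^'m) \<times> (real^'n^'n). regularity_det (fst z) (snd z)"
  have rpf: "real_polynomial_function ?p" by (intro rpf_regularity_det pf_intros)
  obtain D c where c: "\<And>i. real_polynomial_function (c i)"
    and p: "\<And>x y t. ?p (x + t *\<^sub>R y) = (\<Sum>i\<le>D. c i (x, y) * t ^ i)"
    by (rule real_polynomial_function_along_line[OF rpf]) (rule that)
  define e where "e = (\<lambda>i v X0 X1 \<delta>. c i ((v :: (real^'n^'n)^'m, \<delta> *\<^sub>R X1 :: real^'n^'n), (0, - X0)))"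
  have e: "regularity_det v (\<delta> *\<^sub>R X1 - \<kappa> *\<^sub>R X0) = (\<Sum>i\<le>D. e i v X0 X1 \<delta> * \<kappa> ^ i)" for v X0 X1 \<delta> \<kappa>
    using p[of "(v, \<delta> *\<^sub>R X1)" \<kappa> "(0, - X0)"] by (simp add: e_def)
  define \<Gamma> where "\<Gamma> = (\<lambda>v X0 X1 (A :: real^'n^'n) B. \<Sum>i\<le>D. e i v X0 X1 (det A) *\<^sub>R mpow (adj_mult A B) i)"
  define R where "R = (\<lambda>(v, X0, X1, A, B). det (\<Gamma> v X0 X1 A B))"
  have R_eq: "R = (\<lambda>\<theta>. det (\<Gamma> (fst \<theta>) (fst (snd \<theta>)) (fst (snd (snd \<theta>)))
      (fst (snd (snd (snd \<theta>)))) (snd (snd (snd (snd \<theta>))))))"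
    by (auto simp: R_def)
  show thesis
  proof (rule that)
    have 1: "polynomial_function (\<lambda>\<theta> :: ((real^'n^'n)^'m) \<times> (real^'n^'n) \<times> (real^'n^'n) \<times> (real^'n^'n) \<times> (real^'n^'n).
        ((fst \<theta>, det (fst (snd (snd (snd \<theta>)))) *\<^sub>R fst (snd (snd \<theta>))), (0 :: (real^'n^'n)^'m, - fst (snd \<theta>))))"
      by (intro pf_intros polynomial_function_minus)
    have 2: "real_polynomial_function (\<lambda>\<theta> :: ((real^'n^'n)^'m) \<times> (real^'n^'n) \<times> (real^'n^'n) \<times> (real^'n^'n) \<times> (real^'n^'n).
        e i (fst \<theta>) (fst (snd \<theta>)) (fst (snd (snd \<theta>))) (det (fst (snd (snd (snd \<theta>))))))" for i
      unfolding e_def by (rule rpf_compose[OF c 1])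
    show "real_polynomial_function R"
      unfolding R_eq \<Gamma>_def
      by (intro rpf_det polynomial_function_sum polynomial_function_scaleR 2 polynomial_function_mpow
          polynomial_function_adj_mult polynomial_function_fst polynomial_function_snd
          polynomial_function_id) auto
  next
    fix v X0 X1 A B t and x :: "real^'n"
    assume R: "R (v, X0, X1, A, B) \<noteq> 0" and A: "det A \<noteq> 0" and x: "x \<noteq> 0" "B *v x = t *\<^sub>R (A *v x)"
    let ?\<kappa> = "det A * t"
    have "A *v (adj_mult A B *v x) = det A *\<^sub>R (B *v x)"
      by (simp add: matrix_vector_mul_assoc mult_adj_mult[OF A] scaleR_matrix_vector_assoc)
    also have "\<dots> = A *v (?\<kappa> *\<^sub>R x)" by (simp add: x(2) matrix_vector_mult_scaleR)
    finally have eig: "adj_mult A B *v x = ?\<kappa> *\<^sub>R x"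
      using invertible_matrix_vector_bij(1)[of A] A by (simp add: invertible_det_nz inj_eq)
    have "\<Gamma> v X0 X1 A B *v x = (\<Sum>i\<le>D. e i v X0 X1 (det A) *\<^sub>R (mpow (adj_mult A B) i *v x))"
      unfolding \<Gamma>_def using linear_sum[OF linear_mv_left[of x]]
      by (simp add: scaleR_matrix_vector_assoc)
    also have "\<dots> = regularity_det v (det A *\<^sub>R X1 - ?\<kappa> *\<^sub>R X0) *\<^sub>R x"
      by (simp add: mpow_eigen[OF eig] e scaleR_sum_left)
    finally have \<Gamma>x: "\<Gamma> v X0 X1 A B *v x = regularity_det v (det A *\<^sub>R X1 - ?\<kappa> *\<^sub>R X0) *\<^sub>R x" .
    have "invertible (\<Gamma> v X0 X1 A B)" using R by (simp add: R_def invertible_det_nz)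
    then have "\<Gamma> v X0 X1 A B *v x \<noteq> 0"
      using x(1) by (metis invertible_left_inverse matrix_left_invertible_ker)
    then have "regularity_det v (det A *\<^sub>R X1 - ?\<kappa> *\<^sub>R X0) \<noteq> 0" using \<Gamma>x by auto
    then have "regular_at (range (comb v)) (det A *\<^sub>R (X1 - t *\<^sub>R X0))"
      using regularity_det_nonzero_imp by (simp add: scaleR_diff_right)
    then show "regular_at (range (comb v)) (X1 - t *\<^sub>R X0)" by (rule regular_at_scale)
  next
    fix v :: "(real^'n^'n)^'m" and X0 X1 :: "real^'n^'n" and d :: "'n \<Rightarrow> real"
    assume "\<forall>i. X1 - d i *\<^sub>R X0 \<in> sym_mats \<and> regular_at (range (comb v)) (X1 - d i *\<^sub>R X0)"
    then have sym: "X1 - d i *\<^sub>R X0 \<in> sym_mats" and reg: "regular_at (range (comb v)) (X1 - d i *\<^sub>R X0)" for i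
      by auto
    have adj: "adj_mult (mat 1) (diag_mat d) = diag_mat d"
      using mult_adj_mult[of "mat 1" "diag_mat d"] by simp
    have pow: "mpow (diag_mat d) i = diag_mat (\<lambda>l. d l ^ i)" for i
      by (induction i) (simp_all add: diag_mat_mult diag_mat_1)
    have "\<Gamma> v X0 X1 (mat 1) (diag_mat d) $ i $ j
        = diag_mat (\<lambda>l. regularity_det v (X1 - d l *\<^sub>R X0)) $ i $ j" for i j
      using e[of v 1 X1 "d i" X0] by (simp add: \<Gamma>_def adj pow) (auto simp: diag_mat_def)
    then have "\<Gamma> v X0 X1 (mat 1) (diag_mat d) = diag_mat (\<lambda>l. regularity_det v (X1 - d l *\<^sub>R X0))"
      by (simp add: vec_eq_iff)
    then show "R (v, X0, X1, mat 1, diag_mat d) \<noteq> 0"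
      using regular_imp_regularity_det_nonzero[OF reg sym] by (simp add: R_def det_diag_mat)
  qed
qed

text \<open>The largest generalized eigenvalue of the pencil, found by maximising a Rayleigh quotient.\<close>

lemma singular_psd_in_pencil:
  fixes A0 A1 :: "real^'n^'n"
  assumes A: "A0 \<in> sym_supp J" "A1 \<in> sym_supp J" and pos: "A0 + cproj (- J) \<in> posdefs" and J: "J \<noteq> {}"
  obtains t x where "x \<noteq> 0" "cproj (- J) *v x = 0" "t *\<^sub>R A0 - A1 \<in> psd_mats" "A1 *v x = t *\<^sub>R (A0 *v x)"
proof -
  let ?B = "A0 + cproj (- J)"
  define V where "V = {x :: real^'n. cproj (- J) *v x = 0}"
  have V: "subspace V" unfolding V_def by (rule linear_subspace_kernel) simp
  have comp: "compact (sphere 0 1 \<inter> V)" by (intro compact_Int_closed closed_subspace V) auto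
  obtain j where "j \<in> J" using J by blast
  then have "axis j 1 \<in> sphere 0 1 \<inter> V"
    by (simp add: V_def cproj_mult_vec axis_def vec_eq_iff[of _ 0] norm_axis_1[unfolded axis_def])
  then have ne: "sphere 0 1 \<inter> V \<noteq> {}" by blast
  have pos': "0 < x \<bullet> (?B *v x)" if "x \<noteq> 0" for x using pos that by (simp add: posdefs_def)
  have "continuous_on (sphere 0 1 \<inter> V) (\<lambda>x. (x \<bullet> (A1 *v x)) / (x \<bullet> (?B *v x)))"
    using pos' by (intro continuous_intros linear_continuous_on linear_linear[THEN iffD2])
      (auto, metis less_irrefl norm_zero zero_neq_one)
  then obtain x where x: "x \<in> sphere 0 1 \<inter> V" and
    max: "\<And>y. y \<in> sphere 0 1 \<inter> V \<Longrightarrow> (y \<bullet> (A1 *v y)) / (y \<bullet> (?B *v y)) \<le> (x \<bullet> (A1 *v x)) / (x \<bullet> (?B *v x))"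
    using continuous_attains_sup[OF comp ne] by blast
  define t where "t = (x \<bullet> (A1 *v x)) / (x \<bullet> (?B *v x))"
  define T where "T = t *\<^sub>R A0 - A1"
  have x0: "x \<noteq> 0" using x by auto
  have TS: "T \<in> sym_supp J"
    unfolding T_def using A subspace_sym_supp by (intro subspace_diff subspace_scale)
  have BV: "?B *v y = A0 *v y" if "y \<in> V" for y
    using that by (simp add: V_def matrix_vector_mult_add_rdistrib)
  have Tv: "T *v y = t *\<^sub>R (A0 *v y) - A1 *v y" for y
    by (simp add: T_def matrix_vector_mult_diff_rdistrib scaleR_matrix_vector_assoc)
  have on_V: "0 \<le> y \<bullet> (T *v y)" if y: "y \<in> V" for y
  proof (cases "y = 0")
    case False
    have "y /\<^sub>R norm y \<in> sphere 0 1 \<inter> V" using y False V by (auto intro: subspace_scale)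
    then have "((y /\<^sub>R norm y) \<bullet> (A1 *v (y /\<^sub>R norm y))) / ((y /\<^sub>R norm y) \<bullet> (?B *v (y /\<^sub>R norm y))) \<le> t"
      unfolding t_def by (rule max)
    then have "(y \<bullet> (A1 *v y)) / (y \<bullet> (?B *v y)) \<le> t"
      using False by (simp add: matrix_vector_mult_scaleR)
    then have "y \<bullet> (A1 *v y) \<le> t * (y \<bullet> (?B *v y))"
      using pos'[OF False] by (simp add: pos_divide_le_eq)
    then show ?thesis by (simp add: Tv BV[OF y] inner_diff_right)
  qed auto
  have psd: "T \<in> psd_mats"
    by (rule psd_if_nonneg_on_support[OF TS]) (rule on_V, simp add: V_def)
  have "x \<bullet> (T *v x) = 0"
    using x pos'[OF x0] BV[of x] by (simp add: Tv inner_diff_right t_def)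
  then have "T *v x = 0" by (rule psd_kernel[OF psd])
  then have "A1 *v x = t *\<^sub>R (A0 *v x)" by (simp add: Tv)
  then show ?thesis using that[of x t] x x0 psd by (simp add: V_def T_def)
qed

text \<open>If the regularity polynomial of the pencil does not vanish identically, then among the matrices
  that are positive definite on a column space of dimension |J| one finds a pencil whose first
  singular member is regular.  That member has smaller rank, and regularity makes it persist.\<close>

lemma pd_face_smaller:
  fixes v :: "(real^'n^'n)^'m"
    and R :: "((real^'n^'n)^'m) \<times> (real^'n^'n) \<times> (real^'n^'n) \<times> (real^'n^'n) \<times> (real^'n^'n) \<Rightarrow> real"
  defines "L \<equiv> range (comb v)"
  assumes v: "\<And>a. v $ a \<in> sym_mats" and inj: "inj (comb v)" and proper: "L \<noteq> sym_mats"
    and face: "pd_face L J"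
    and R: "real_polynomial_function R"
      "\<And>v X0 X1 A B t x. R (v, X0, X1, A, B) \<noteq> 0 \<Longrightarrow> det A \<noteq> 0 \<Longrightarrow> x \<noteq> 0 \<Longrightarrow> B *v x = t *\<^sub>R (A *v x) \<Longrightarrow>
       regular_at (range (comb v)) (X1 - t *\<^sub>R X0)"
    and EF: "linear E" "linear F"
    and sol: "\<And>G z. invertible G \<Longrightarrow> det (matrix (\<lambda>c. E (kernel_map v G J c) + F c)) \<noteq> 0 \<Longrightarrow>
       kernel_map v G J (kernel_param E F (kernel_map v G J) z) = 0"
    and \<Psi>: "\<Psi> = (\<lambda>G z0 z1.
       let X0 = comb v (kernel_param E F (kernel_map v G J) z0);
           X1 = comb v (kernel_param E F (kernel_map v G J) z1)
       in det (matrix (\<lambda>c. E (kernel_map v G J c) + F c)) *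
          R (v, X0, X1, transpose G ** X0 ** G + cproj (- J), transpose G ** X1 ** G))"
    and nonzero: "\<Psi> G' z0' z1' \<noteq> 0"
  obtains J' where "card J' < card J" "pd_face L J'"
proof -
  define N where "N = (\<lambda>G. det (matrix (\<lambda>c. E (kernel_map v G J c) + F c)))"
  define Z where "Z = (\<lambda>G z. comb v (kernel_param E F (kernel_map v G J) z))"
  define A where "A = (\<lambda>G z. transpose G ** Z G z ** G)"
  have \<Psi>_eq: "\<Psi> G z0 z1 = N G * R (v, Z G z0, Z G z1, A G z0 + cproj (- J), A G z1)" for G z0 z1
    by (simp add: \<Psi> N_def Z_def A_def Let_def)
  have pfM: "polynomial_function (\<lambda>\<theta>. kernel_map v (G \<theta>) J c)" if "polynomial_function G"
    for c and G :: "'z::euclidean_space \<Rightarrow> real^'n^'n"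
    by (intro polynomial_function_kernel_map pf_intros that)
  have rpfN: "real_polynomial_function (\<lambda>\<theta>. N (G \<theta>))" if "polynomial_function G"
    for G :: "'z::euclidean_space \<Rightarrow> real^'n^'n"
    unfolding N_def
    by (rule rpf_det[OF polynomial_function_kernel_param(2)[OF EF pfM[OF that] polynomial_function_const]])
  have pfZ: "polynomial_function (\<lambda>\<theta>. Z (G \<theta>) (z \<theta>))" if "polynomial_function G" "polynomial_function z"
    for G :: "'z::euclidean_space \<Rightarrow> real^'n^'n" and z
    unfolding Z_def
    by (rule polynomial_function_comb[OF polynomial_function_const
          polynomial_function_kernel_param(1)[OF EF pfM[OF that(1)] that(2)]])
  have pfA: "polynomial_function (\<lambda>\<theta>. A (G \<theta>) (z \<theta>))" if "polynomial_function G" "polynomial_function z"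
    for G :: "'z::euclidean_space \<Rightarrow> real^'n^'n" and z
    unfolding A_def by (intro pf_intros pfZ that)
  obtain U where U: "open U" "U \<noteq> {}" and J: "J \<noteq> {}"
    and U_face: "\<And>G. G \<in> U \<Longrightarrow> invertible G \<and> (\<exists>X \<in> L \<inter> kernel_mats G J. transpose G ** X ** G + cproj (- J) \<in> posdefs)"
    using face unfolding pd_face_def by blast
  have "N G' \<noteq> 0" using nonzero by (auto simp: \<Psi>_eq)
  then obtain G1 where G1: "G1 \<in> U" "N G1 \<noteq> 0"
    using real_polynomial_function_nonzero_in_open[OF rpfN[OF polynomial_function_id] _ U] by blast
  obtain X where X: "X \<in> L" "X \<in> kernel_mats G1 J" "transpose G1 ** X ** G1 + cproj (- J) \<in> posdefs"
    using U_face[OF G1(1)] by blast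
  obtain c where c: "X = comb v c" using X(1) by (auto simp: L_def)
  have "kernel_map v G1 J c = 0" using X(2) c by (simp add: kernel_map_eq_0[OF v])
  then obtain z where z: "kernel_param E F (kernel_map v G1 J) z = c"
    using kernel_param_surj[OF EF linear_kernel_map, of v G1 J c] G1(2) by (auto simp: N_def)
  define S where "S = (\<lambda>\<theta>. fst \<theta>) -` U \<inter> (\<lambda>\<theta> :: (real^'n^'n) \<times> (real^'m) \<times> (real^'m). N (fst \<theta>)) -` (- {0})
      \<inter> (\<lambda>\<theta>. A (fst \<theta>) (fst (snd \<theta>)) + cproj (- J)) -` posdefs"
  have "open S"
    unfolding S_def
    by (intro open_Int open_vimage U open_posdefs continuous_on_rpf continuous_on_polymonial_function
        rpfN polynomial_function_add pfA polynomial_function_const polynomial_function_fst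
        polynomial_function_snd polynomial_function_id) auto
  moreover have "(G1, z, 0) \<in> S"
    using G1 X(3) z c by (simp add: S_def A_def Z_def)
  then have "S \<noteq> {}" by blast
  moreover have "real_polynomial_function (\<lambda>\<theta>. \<Psi> (fst \<theta>) (fst (snd \<theta>)) (snd (snd \<theta>)))"
    unfolding \<Psi>_eq
    by (intro real_polynomial_function.intros(4) rpfN rpf_compose[OF R(1)] polynomial_function_Pair
        pfZ pfA polynomial_function_add polynomial_function_const polynomial_function_fst
        polynomial_function_snd polynomial_function_id)
  moreover have "\<Psi> (fst (G', z0', z1')) (fst (snd (G', z0', z1'))) (snd (snd (G', z0', z1'))) \<noteq> 0"
    using nonzero by simp
  ultimately obtain \<theta> where \<theta>: "\<theta> \<in> S" "\<Psi> (fst \<theta>) (fst (snd \<theta>)) (snd (snd \<theta>)) \<noteq> 0"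
    using real_polynomial_function_nonzero_in_open[of "\<lambda>\<theta>. \<Psi> (fst \<theta>) (fst (snd \<theta>)) (snd (snd \<theta>))"] by blast
  obtain G z0 z1 where \<theta>_eq: "\<theta> = (G, z0, z1)" by (cases \<theta>) auto
  have G: "invertible G" "N G \<noteq> 0" and pos: "A G z0 + cproj (- J) \<in> posdefs"
    and Rne: "R (v, Z G z0, Z G z1, A G z0 + cproj (- J), A G z1) \<noteq> 0"
    using \<theta> U_face unfolding \<theta>_eq S_def \<Psi>_eq by auto
  have ZK: "Z G y \<in> kernel_mats G J" "Z G y \<in> L" for y
    using sol[OF G(1), of y] G(2) by (simp_all add: kernel_map_eq_0[OF v] N_def Z_def L_def)
  have AS: "A G y \<in> sym_supp J" for y
    unfolding A_def by (rule kernel_mats_congruence[OF ZK(1)])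
  obtain t x where x: "x \<noteq> 0" "cproj (- J) *v x = 0" "t *\<^sub>R A G z0 - A G z1 \<in> psd_mats"
      "A G z1 *v x = t *\<^sub>R (A G z0 *v x)"
    by (rule singular_psd_in_pencil[OF AS[of z0] AS[of z1] pos J])
  define Y where "Y = t *\<^sub>R Z G z0 - Z G z1"
  have "det (A G z0 + cproj (- J)) \<noteq> 0"
  proof
    assume "det (A G z0 + cproj (- J)) = 0"
    then obtain y where "y \<noteq> 0" "(A G z0 + cproj (- J)) *v y = 0"
      using invertible_det_nz matrix_left_invertible_ker invertible_left_inverse by blast
    then have "0 < y \<bullet> 0" using pos unfolding posdefs_def by force
    then show False by simp
  qed
  moreover have "A G z1 *v x = t *\<^sub>R ((A G z0 + cproj (- J)) *v x)"
    using x by (simp add: matrix_vector_mult_add_rdistrib)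
  ultimately have "regular_at L (Z G z1 - t *\<^sub>R Z G z0)"
    unfolding L_def using R(2)[OF Rne _ x(1)] by blast
  then have "regular_at L ((-1) *\<^sub>R Y)" by (simp add: Y_def)
  then have regY: "regular_at L Y" by (rule regular_at_scale)
  have YL: "Y \<in> L"
    using ZK(2) subspace_range_comb[of v] unfolding Y_def L_def
    by (intro subspace_diff subspace_scale) auto
  define T where "T = t *\<^sub>R A G z0 - A G z1"
  have T_eq: "T = transpose G ** Y ** G"
  proof -
    have "linear (\<lambda>W. transpose G ** W ** G)"
      using linear_compose[OF linear_matrix_mult_left linear_matrix_mult_right] by (simp add: o_def)
    then show ?thesis unfolding T_def Y_def A_def
      using linear_diff[of "\<lambda>W. transpose G ** W ** G" "t *\<^sub>R Z G z0" "Z G z1"]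
        linear_scale[of "\<lambda>W. transpose G ** W ** G" t "Z G z0"] by simp
  qed
  have "transpose G ** Y ** G \<in> psd_mats" using x(3) by (simp add: T_eq[symmetric] T_def)
  then have Ypsd: "Y \<in> psd_mats" by (rule psd_mats_congruence_cancel[OF G(1)])
  have "Y \<noteq> 0"
  proof
    assume "Y = 0"
    have "subspace L" "L \<subseteq> sym_mats" unfolding L_def using subspace_range_comb comb_in_sym[OF v] by auto
    then obtain W where W: "W \<noteq> 0" "W \<in> sym_mats" "\<And>Z. Z \<in> L \<Longrightarrow> W \<bullet> Z = 0"
      by (rule orthogonal_in_larger_subspace[OF _ subspace_sym_mats _ proper]) (rule that)
    then show False using regY \<open>Y = 0\<close> unfolding regular_at_def by auto
  qed
  obtain J' where J': "card J' = rank Y" "pd_face L J'"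
    using pd_face_of_regular[OF v inj] YL Ypsd \<open>Y \<noteq> 0\<close> regY unfolding L_def by blast
  have "rank Y < card J"
  proof -
    have rT: "rank Y = rank T"
      using rank_congruence[of "transpose G" Y] G(1) by (simp add: T_eq invertible_det_nz)
    define V where "V = {y :: real^'n. \<forall>i. i \<notin> J \<longrightarrow> y $ i = 0}"
    define V' where "V' = {y \<in> V. x \<bullet> y = 0}"
    have subV: "subspace V" "subspace V'" by (auto simp: V_def V'_def subspace_def inner_add_right)
    have "T \<in> sym_supp J" unfolding T_def using AS subspace_sym_supp by (intro subspace_diff subspace_scale)
    then have symT: "T \<in> sym_mats" and T0: "\<And>i j. i \<notin> J \<Longrightarrow> T $ i $ j = 0" by (auto simp: sym_supp_def)
    have Tx: "T *v x = 0"
      using x(4) by (simp add: T_def matrix_vector_mult_diff_rdistrib scaleR_matrix_vector_assoc[symmetric])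
    have "T *v y \<in> V'" for y
    proof -
      have "T *v y \<in> V" using T0 by (simp add: V_def matrix_vector_mult_def)
      moreover have "x \<bullet> (T *v y) = (T *v x) \<bullet> y"
        using inner_mv_transpose[of T x y] symT
        by (simp add: sym_mats_def del: transpose_matrix_vector)
      ultimately show ?thesis by (simp add: V'_def Tx)
    qed
    then have "rank T \<le> dim V'" unfolding rank_dim_range by (intro dim_subset) auto
    also have "\<dots> < dim V"
    proof -
      have "x \<in> V" using x(2) by (auto simp: V_def cproj_mult_vec vec_eq_iff split: if_splits)
      moreover have "x \<notin> V'" using x(1) by (simp add: V'_def)
      moreover have "V' \<subseteq> V" by (auto simp: V'_def)
      ultimately have "V' \<subset> V" by blast
      moreover have "span V' = V'" "span V = V" using subV by simp_all
      ultimately have "span V' \<subset> span V" by (simp only:)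
      then show ?thesis by (rule dim_psubset)
    qed
    also have "dim V = card J" unfolding V_def by (rule dim_coord_subspace)
    finally show ?thesis by (simp add: rT)
  qed
  then show ?thesis using that[of J'] J' by simp
qed

section \<open>A pencil all of whose singular members are regular\<close>

text \<open>The vectors u l are the columns of the Householder reflection I - (2/j) 1 1^T on the coordinates
  in J: they are orthonormal and, as j is at least 3, have no zero entry.  The complement of L inside
  the symmetric matrices consists of matrices Y supported on J that are orthogonal to the diagonal
  matrix d and to all the squares (u l)(u l)^T, whose sum is the projection onto J.  These are j + 1
  conditions, which is where the bound on m comes from.  If X is diagonal and at most its i-th entry in
  J vanishes, then X Y X = 0 leaves only row and column i of Y.  The condition (u l)^T Y (u l) = 0 then
  says that this row, with its diagonal entry halved, is orthogonal to u l.\<close>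

lemma regular_diagonal_pencil:
  fixes J :: "'n::finite set" and d :: "'n \<Rightarrow> real"
  assumes j: "card J \<ge> 3" and m: "m \<le> (CARD('n) + 1) choose 2"
    and mJ: "(CARD('n) + 1) choose 2 < m + (card J choose 2)"
    and d: "\<And>a. a \<notin> J \<Longrightarrow> d a = 0"
  obtains L :: "(real^'n^'n) set" where "subspace L" "L \<subseteq> sym_mats" "dim L = m" "cproj J \<in> L" "diag_mat d \<in> L"
    "\<forall>x. \<forall>i\<in>J. (\<forall>a. a \<notin> J \<longrightarrow> x a = 0) \<longrightarrow> (\<forall>a\<in>J. a \<noteq> i \<longrightarrow> x a \<noteq> 0) \<longrightarrow> regular_at L (diag_mat x)"
proof -
  let ?N = "(CARD('n) + 1) choose 2"
  define t where "t = 2 / real (card J)"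
  have t: "real (card J) * t = 2" "t \<noteq> 0" "1 - t \<noteq> 0" using j by (auto simp: t_def)
  define u :: "'n \<Rightarrow> 'n \<Rightarrow> real" where
    "u = (\<lambda>l a. if a \<in> J then (if a = l then 1 else 0) - t else 0)"
  have u_ne: "u l i \<noteq> 0" if "i \<in> J" for l i using that t by (simp add: u_def)
  define U :: "'n \<Rightarrow> real^'n^'n" where "U = (\<lambda>l. \<chi> a b. u l a * u l b)"
  have ortho: "(\<Sum>l\<in>J. u l a * u l b) = (if a = b \<and> a \<in> J then 1 else 0)" for a b
  proof (cases "a \<in> J \<and> b \<in> J")
    case True
    have "(\<Sum>l\<in>J. u l a * u l b)
        = (\<Sum>l\<in>J. (if l = a then (if a = b then 1 else 0) else 0) - t * (if l = a then 1 else 0) - t * (if l = b then 1 else 0) + t * t)"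
      using True by (intro sum.cong) (auto simp: u_def algebra_simps)
    also have "\<dots> = (if a = b then 1 else 0) - t - t + real (card J) * (t * t)"
      using True by (simp add: sum.distrib sum_subtractf flip: sum_distrib_left)
    also have "real (card J) * (t * t) = 2 * t" using t(1) by (simp flip: mult.assoc)
    finally show ?thesis using True by simp
  qed (auto simp: u_def)
  have cproj_sum: "cproj J = (\<Sum>l\<in>J. U l)"
    by (simp add: vec_eq_iff sum_component U_def ortho) (auto simp: cproj_def diag_mat_def)
  define S where "S = insert (diag_mat d) (U ` J)"
  have "finite S" by (simp add: S_def)
  have cardS: "card S \<le> card J + 1"
    unfolding S_def using card_insert_le_m1[of "card J + 1" "U ` J" "diag_mat d"] card_image_le[of J U] by simp
  define T where "T = {Y :: real^'n^'n. \<forall>s \<in> span S. orthogonal s Y}"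
  have subT: "subspace T" by (auto simp: T_def subspace_def orthogonal_def inner_add_right)
  have "dim T + dim (span S) = dim (UNIV :: (real^'n^'n) set)"
    using dim_subspace_orthogonal_to_vectors[of "span S" UNIV] by (simp add: T_def)
  moreover have "dim (span S) \<le> card J + 1" using dim_le_card'[OF \<open>finite S\<close>] cardS by simp
  moreover have "dim {x + y |x y. x \<in> sym_supp J \<and> y \<in> T} \<le> dim (UNIV :: (real^'n^'n) set)"
    by (rule dim_subset) simp
  ultimately have "dim (sym_supp J :: (real^'n^'n) set) \<le> dim (sym_supp J \<inter> T) + (card J + 1)"
    using dim_sums_Int[OF subspace_sym_supp[of J] subT] by simp
  moreover have "(card J + 1) choose 2 = (card J choose 2) + card J" by (simp add: numeral_2_eq_2)
  ultimately have "?N - m \<le> dim (sym_supp J \<inter> T)" using mJ by (simp add: dim_sym_supp)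
  moreover have subST: "subspace (sym_supp J \<inter> T)" by (intro subspace_inter subspace_sym_supp subT)
  ultimately obtain W where W: "subspace W" "W \<subseteq> sym_supp J \<inter> T" "dim W = ?N - m"
    using choose_subspace_of_subspace[of "?N - m" "sym_supp J \<inter> T"] by (auto simp: span_eq_iff[THEN iffD2])
  have Wsym: "W \<subseteq> sym_mats" using W(2) by (auto simp: sym_supp_def)
  define L where "L = {Y \<in> sym_mats. \<forall>x\<in>W. orthogonal x Y}"
  have L: "subspace L" "L \<subseteq> sym_mats"
    using subspace_sym_mats by (auto simp: L_def subspace_def orthogonal_def inner_add_right)
  have dimL: "dim L + dim W = ?N"
    using dim_subspace_orthogonal_to_vectors[OF W(1) subspace_sym_mats Wsym] by (simp add: L_def dim_sym_mats)
  have span_L: "Y \<in> L" if "Y \<in> span S" "Y \<in> sym_mats" for Y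
    using that W(2) by (auto simp: L_def T_def orthogonal_commute)
  have "(\<Sum>l\<in>J. U l) \<in> span S" by (intro span_sum span_base) (auto simp: S_def)
  then have "cproj J \<in> L" by (intro span_L) (simp_all add: cproj_sum[symmetric])
  moreover have "diag_mat d \<in> L" by (rule span_L) (auto simp: S_def intro: span_base)
  moreover have regular: "regular_at L (diag_mat x)"
    if i: "i \<in> J" and x0: "\<And>a. a \<notin> J \<Longrightarrow> x a = 0" and x: "\<And>a. a \<in> J \<Longrightarrow> a \<noteq> i \<Longrightarrow> x a \<noteq> 0" for x i
    unfolding regular_at_def
  proof (intro ballI impI)
    fix Y :: "real^'n^'n"
    assume Y: "Y \<in> sym_mats" "(\<forall>Z\<in>L. Y \<bullet> Z = 0) \<and> diag_mat x ** Y ** diag_mat x = 0"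
    define W' where "W' = {Y \<in> sym_mats. \<forall>x\<in>L. orthogonal x Y}"
    have "dim W' + dim L = ?N"
      using dim_subspace_orthogonal_to_vectors[OF L(1) subspace_sym_mats L(2)] by (simp add: W'_def dim_sym_mats)
    moreover have "W \<subseteq> W'" using Wsym by (auto simp: W'_def L_def orthogonal_commute)
    moreover have "subspace W'"
      using subspace_sym_mats by (auto simp: W'_def subspace_def orthogonal_def inner_add_right)
    ultimately have "W = W'" using subspace_dim_equal[OF W(1), of W'] dimL by simp
    moreover have "Y \<in> W'" using Y by (auto simp: W'_def orthogonal_def inner_commute)
    ultimately have "Y \<in> sym_supp J" "Y \<in> T" using W(2) by auto
    then have supp: "\<And>a b. a \<notin> J \<or> b \<notin> J \<Longrightarrow> Y $ a $ b = 0" and UY: "\<And>l. l \<in> J \<Longrightarrow> U l \<bullet> Y = 0"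
      by (auto simp: sym_supp_def T_def orthogonal_def S_def span_base)
    have symY: "Y $ a $ b = Y $ b $ a" for a b using Y(1) by (rule sym_matsD)
    have "(diag_mat x ** Y ** diag_mat x) $ a $ b = x a * Y $ a $ b * x b" for a b
    proof -
      have "(diag_mat x ** Y) $ a $ c = x a * Y $ a $ c" for c
        by (simp add: matrix_matrix_mult_def diag_mat_def if_distribR cong: if_cong)
          (rule trans[OF sum.cong[OF refl, of _ _ "\<lambda>k. if a = k then x a * Y $ a $ c else 0"]], auto)
      then show ?thesis
        by (subst matrix_matrix_mult_def) (simp add: diag_mat_def if_distrib cong: if_cong)
    qed
    then have "x a * Y $ a $ b * x b = 0" for a b using Y(2) by (metis zero_index)
    then have Y0: "Y $ a $ b = 0" if "a \<noteq> i" "b \<noteq> i" for a b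
      using that x supp[of a b] by (metis mult_eq_0_iff)
    define y where "y = (\<lambda>b. if b = i then Y $ i $ i / 2 else Y $ i $ b)"
    have Y_eq: "Y $ a $ b = (if a = i then y b else 0) + (if b = i then y a else 0)" for a b
      using Y0[of a b] symY[of a b] by (auto simp: y_def)
    have y0: "y b = 0" if "b \<notin> J" for b using that i supp by (auto simp: y_def)
    have uy: "(\<Sum>b\<in>J. u l b * y b) = 0" if l: "l \<in> J" for l
    proof -
      have "0 = (\<Sum>a\<in>UNIV. \<Sum>b\<in>UNIV. u l a * u l b * Y $ a $ b)"
        using UY[OF l] by (simp add: U_def inner_vec_def)
      also have "\<dots> = (\<Sum>a\<in>UNIV. \<Sum>b\<in>UNIV. (if a = i then u l i * (u l b * y b) else 0)
          + (if b = i then u l i * (u l a * y a) else 0))"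
        by (intro sum.cong) (auto simp: Y_eq algebra_simps)
      also have "\<dots> = (\<Sum>b\<in>UNIV. \<Sum>a\<in>UNIV. if a = i then u l i * (u l b * y b) else 0)
          + (\<Sum>a\<in>UNIV. \<Sum>b\<in>UNIV. if b = i then u l i * (u l a * y a) else 0)"
        unfolding sum.distrib by (intro arg_cong2[of _ _ _ _ "(+)"] sum.swap refl)
      also have "\<dots> = u l i * (\<Sum>b\<in>UNIV. u l b * y b) + u l i * (\<Sum>a\<in>UNIV. u l a * y a)"
        by (simp add: sum_distrib_left)
      finally have "(\<Sum>b\<in>UNIV. u l b * y b) = 0" using u_ne[OF i, of l] by simp
      moreover have "(\<Sum>b\<in>UNIV. u l b * y b) = (\<Sum>b\<in>J. u l b * y b)"
        by (rule sum.mono_neutral_right) (auto simp: y0)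
      ultimately show ?thesis by simp
    qed
    define \<sigma> where "\<sigma> = (\<Sum>b\<in>J. y b)"
    have y_l: "y l = t * \<sigma>" if l: "l \<in> J" for l
    proof -
      have "(\<Sum>b\<in>J. u l b * y b) = (\<Sum>b\<in>J. (if b = l then y l else 0) - t * y b)"
        by (intro sum.cong) (auto simp: u_def algebra_simps)
      also have "\<dots> = y l - t * \<sigma>" using l by (simp add: sum_subtractf \<sigma>_def sum_distrib_left)
      finally show ?thesis using uy[OF l] by simp
    qed
    have "(\<Sum>b\<in>J. y b) = (\<Sum>b\<in>J. t * \<sigma>)" by (rule sum.cong[OF refl]) (rule y_l)
    also have "\<dots> = 2 * \<sigma>" using t(1) by (simp flip: mult.assoc)
    finally have "\<sigma> = 0" by (simp add: \<sigma>_def[symmetric])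
    then have "y b = 0" for b using y_l[of b] y0[of b] by (cases "b \<in> J") auto
    then show "Y = 0" by (simp add: vec_eq_iff Y_eq)
  qed
  moreover have "dim L = m" using dimL W(3) m by simp
  ultimately show ?thesis using that[OF L] regular by blast
qed

text \<open>In coordinates G = I the pencil spanned by the coordinate projection and a diagonal matrix with
  distinct entries shows that the regularity polynomial is not identically zero.\<close>

lemma generic_pd_face_smaller:
  fixes J :: "'n::finite set"
  assumes m: "CARD('m::finite) < (CARD('n) + 1) choose 2"
    and mJ: "(CARD('n) + 1) choose 2 < CARD('m) + (card J choose 2)"
  shows "\<exists>q :: (real^'n^'n)^'m \<Rightarrow> real. real_polynomial_function q \<and>
      (\<exists>w. (\<forall>a. w $ a \<in> sym_mats) \<and> q w \<noteq> 0) \<and>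
      (\<forall>v. (\<forall>a. v $ a \<in> sym_mats) \<longrightarrow> inj (comb v) \<longrightarrow> q v \<noteq> 0 \<longrightarrow> pd_face (range (comb v)) J \<longrightarrow>
         (\<exists>J'. card J' < card J \<and> pd_face (range (comb v)) J'))"
proof -
  let ?N = "(CARD('n) + 1) choose 2"
  have j: "card J \<ge> 3"
  proof (rule ccontr)
    assume "\<not> card J \<ge> 3"
    then have "card J = 0 \<or> card J = 1 \<or> card J = 2" by linarith
    then have "card J choose 2 \<le> 1" by (elim disjE) (simp_all add: binomial_eq_0)
    then show False using m mJ by simp
  qed
  then obtain i0 where i0: "i0 \<in> J" by fastforce
  obtain h :: "'n \<Rightarrow> nat" where h: "inj h" using finite_imp_inj_to_nat_seg[of "UNIV :: 'n set"] by auto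
  \<comment> \<open>The entries in J are distinct and nonzero, so d a - t vanishes for at most one a in J, also for
    t = 0.\<close>
  define d where "d = (\<lambda>a. if a \<in> J then real (h a) + 1 else 0)"
  have d0: "d a = 0" if "a \<notin> J" for a using that by (simp add: d_def)
  obtain L :: "(real^'n^'n) set" where L: "subspace L" "L \<subseteq> sym_mats" "dim L = CARD('m)"
    "cproj J \<in> L" "diag_mat d \<in> L"
    and reg_all: "\<forall>x. \<forall>i\<in>J. (\<forall>a. a \<notin> J \<longrightarrow> x a = 0) \<longrightarrow> (\<forall>a\<in>J. a \<noteq> i \<longrightarrow> x a \<noteq> 0) \<longrightarrow> regular_at L (diag_mat x)"
    by (rule regular_diagonal_pencil[OF j less_imp_le[OF m] mJ, of d, OF d0], assumption) (rule that)
  have reg: "regular_at L (diag_mat x)"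
    if "i \<in> J" "\<And>a. a \<notin> J \<Longrightarrow> x a = 0" "\<And>a. a \<in> J \<Longrightarrow> a \<noteq> i \<Longrightarrow> x a \<noteq> 0" for x i
  proof -
    have a: "\<forall>a. a \<notin> J \<longrightarrow> x a = 0" using that(2) by simp
    have b: "\<forall>a\<in>J. a \<noteq> i \<longrightarrow> x a \<noteq> 0" using that(3) by simp
    show ?thesis by (rule reg_all[THEN spec, THEN bspec, OF that(1), THEN mp, OF a, THEN mp, OF b])
  qed
  obtain w :: "(real^'n^'n)^'m" where w: "range (comb w) = L" "inj (comb w)"
    by (rule subspace_has_comb[OF L(1,3)])
  have "w $ a \<in> range (comb w)" for a using rangeI[of "comb w" "axis a 1"] by (simp only: comb_axis)
  then have wsym: "w $ a \<in> sym_mats" for a using L(2) unfolding w(1) by (rule subsetD[rotated])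
  obtain R :: "((real^'n^'n)^'m) \<times> (real^'n^'n) \<times> (real^'n^'n) \<times> (real^'n^'n) \<times> (real^'n^'n) \<Rightarrow> real"
    where R: "real_polynomial_function R"
    "\<And>v X0 X1 A B t x. R (v, X0, X1, A, B) \<noteq> 0 \<Longrightarrow> det A \<noteq> 0 \<Longrightarrow> x \<noteq> 0 \<Longrightarrow> B *v x = t *\<^sub>R (A *v x) \<Longrightarrow>
       regular_at (range (comb v)) (X1 - t *\<^sub>R X0)"
    and Rdiag: "\<And>v X0 X1 d. (\<forall>i. X1 - d i *\<^sub>R X0 \<in> sym_mats \<and> regular_at (range (comb v)) (X1 - d i *\<^sub>R X0)) \<Longrightarrow>
       R (v, X0, X1, mat 1, diag_mat d) \<noteq> 0"
    by (rule pencil_polynomial) (rule that)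
  obtain E F where EF: "linear E" "linear F"
    and det1: "det (matrix (\<lambda>c. E (kernel_map w (mat 1) J c) + F c)) = 1"
    and base: "\<And>c. kernel_map w (mat 1) J c = 0 \<Longrightarrow> kernel_param E F (kernel_map w (mat 1) J) c = c"
    and sol: "\<And>M z. linear M \<Longrightarrow> dim {c. kernel_map w (mat 1) J c = 0} \<le> dim {c. M c = 0} \<Longrightarrow>
       det (matrix (\<lambda>c. E (M c) + F c)) \<noteq> 0 \<Longrightarrow> M (kernel_param E F M z) = 0"
    by (rule kernel_chart[OF linear_kernel_map[of w "mat 1" J]]) (rule that)
  have inv1: "invertible (mat 1 :: real^'n^'n)" by (simp add: invertible_det_nz)
  have cJ: "cproj J \<in> kernel_mats (mat 1) J"
    by (simp add: kernel_mats_def cproj_mult_cproj)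
  have "regular_at L (cproj J)" unfolding cproj_def by (rule reg[OF i0]) auto
  then have dimw: "dim (L \<inter> kernel_mats (mat 1) J) + ?N = dim L + ((card J + 1) choose 2)"
    by (rule dim_Int_kernel_mats_regular[OF L(1,2) inv1 cJ])
  have diff: "diag_mat d - t *\<^sub>R cproj J = diag_mat (\<lambda>a. if a \<in> J then d a - t else d a)" for t
    by (simp add: vec_eq_iff cproj_def diag_mat_def)
  have dK: "diag_mat d \<in> kernel_mats (mat 1) J"
    by (simp add: kernel_mats_def) (simp add: vec_eq_iff mult_cproj_nth diag_mat_def d_def)
  obtain z0 z1 where z0: "cproj J = comb w z0" and z1: "diag_mat d = comb w z1"
    using L(4,5) w(1) by blast
  have ker: "kernel_map w (mat 1) J z0 = 0" "kernel_map w (mat 1) J z1 = 0"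
    using cJ dK z0 z1 by (simp_all add: kernel_map_eq_0[OF wsym])
  define \<Psi> where "\<Psi> = (\<lambda>v G z0 z1.
       let X0 = comb v (kernel_param E F (kernel_map v G J) z0);
           X1 = comb v (kernel_param E F (kernel_map v G J) z1)
       in det (matrix (\<lambda>c. E (kernel_map v G J c) + F c)) *
          R (v, X0, X1, transpose G ** X0 ** G + cproj (- J), transpose G ** X1 ** G))"
  define q where "q = (\<lambda>v. \<Psi> v (mat 1) z0 z1)"
  have pfM: "polynomial_function (\<lambda>v. kernel_map v (mat 1) J c)" for c
    by (intro polynomial_function_kernel_map pf_intros)
  have pfX: "polynomial_function (\<lambda>v. comb v (kernel_param E F (kernel_map v (mat 1) J) z))" for z
    by (rule polynomial_function_comb[OF polynomial_function_id
          polynomial_function_kernel_param(1)[OF EF pfM polynomial_function_const]])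
  have "real_polynomial_function q"
    unfolding q_def \<Psi>_def Let_def
    by (intro real_polynomial_function.intros(4) rpf_compose[OF R(1)]
        rpf_det[OF polynomial_function_kernel_param(2)[OF EF pfM polynomial_function_const]]
        polynomial_function_Pair pfX polynomial_function_add polynomial_function_matrix_mult
        polynomial_function_const polynomial_function_id)
  moreover have "q w \<noteq> 0"
  proof -
    have "q w = R (w, cproj J, diag_mat d, mat 1, diag_mat d)"
      unfolding q_def \<Psi>_def Let_def base[OF ker(1)] base[OF ker(2)] z0[symmetric] z1[symmetric] det1 by simp
    moreover have "R (w, cproj J, diag_mat d, mat 1, diag_mat d) \<noteq> 0"
    proof (rule Rdiag, intro allI conjI)
      fix i
      show "diag_mat d - d i *\<^sub>R cproj J \<in> sym_mats" unfolding diff by simp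
      show "regular_at (range (comb w)) (diag_mat d - d i *\<^sub>R cproj J)"
      proof (cases "i \<in> J")
        case True
        show ?thesis
          unfolding diff w(1)
          by (rule reg[OF True]) (use True h in \<open>auto simp: d_def inj_eq\<close>)
      next
        case False
        show ?thesis
          unfolding diff w(1) by (rule reg[OF i0]) (use False in \<open>auto simp: d_def\<close>)
      qed
    qed
    ultimately show ?thesis by simp
  qed
  moreover have "\<exists>J'. card J' < card J \<and> pd_face (range (comb v)) J'"
    if v: "\<And>a. v $ a \<in> sym_mats" and inj: "inj (comb v)" and q: "q v \<noteq> 0"
      and face: "pd_face (range (comb v)) J" for v
  proof -
    have subL: "range (comb v) \<subseteq> sym_mats" using comb_in_sym[OF v] by blast
    have proper: "range (comb v) \<noteq> sym_mats"
      using dim_range_comb[OF inj] m by (metis dim_sym_mats less_irrefl)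
    have sol': "kernel_map v G J (kernel_param E F (kernel_map v G J) z) = 0"
      if G: "invertible G" and det: "det (matrix (\<lambda>c. E (kernel_map v G J c) + F c)) \<noteq> 0" for G z
    proof (rule sol[OF linear_kernel_map _ det])
      have "dim (range (comb v)) + dim (kernel_mats G J) \<le> dim (range (comb v) \<inter> kernel_mats G J) + ?N"
        by (rule dim_Int_sym_ge[OF subspace_range_comb subspace_kernel_mats subL]) (auto simp: kernel_mats_def)
      then show "dim {c. kernel_map w (mat 1) J c = 0} \<le> dim {c. kernel_map v G J c = 0}"
        using dimw unfolding dim_kernel_kernel_map[OF v inj] dim_kernel_kernel_map[OF wsym w(2)] w(1)
          dim_kernel_mats[OF G] dim_range_comb[OF inj] L(3) by simp
    qed
    obtain J' where "card J' < card J" "pd_face (range (comb v)) J'"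
      by (rule pd_face_smaller[OF v inj proper face R EF sol' \<Psi>_def[THEN fun_cong, of v] q[unfolded q_def]])
    then show ?thesis by blast
  qed
  ultimately show ?thesis
    by (intro exI[of _ q] conjI exI[of _ w] allI impI wsym) simp_all
qed

section \<open>The generic completion rank\<close>

text \<open>The inner products with a basis are linear coordinates on L that factor through the orthogonal
  projection.\<close>

definition coords :: "(real^'n^'n)^'m \<Rightarrow> real^'n^'n \<Rightarrow> real^'m" where
  "coords v A = (\<chi> a. v $ a \<bullet> A)"

lemma linear_coords: "linear (coords v)"
  by (auto intro!: linearI simp: coords_def vec_eq_iff inner_add_right)

lemma orth_proj_props:
  assumes "subspace L"
  shows "orth_proj L A \<in> L" and "Z \<in> L \<Longrightarrow> (A - orth_proj L A) \<bullet> Z = 0"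
  using theI'[OF orth_proj_unique_existence[OF assms, of A]]
  by (auto simp: orth_proj_def orthogonal_def)

lemma coords_orth_proj: "coords v (orth_proj (range (comb v)) A) = coords v A"
proof -
  have "(A - orth_proj (range (comb v)) A) \<bullet> v $ a = 0" for a
    using orth_proj_props(2)[OF subspace_range_comb, of "v $ a" v A] comb_axis[of v a] by (metis rangeI)
  then have "v $ a \<bullet> orth_proj (range (comb v)) A = v $ a \<bullet> A" for a
    by (simp add: inner_diff_left inner_commute[of "v $ a"])
  then show ?thesis by (simp add: coords_def vec_eq_iff)
qed

lemma coords_eq_0_iff: "coords v A = 0 \<longleftrightarrow> (\<forall>Z \<in> range (comb v). A \<bullet> Z = 0)"
  unfolding orthogonal_range_comb by (simp add: coords_def vec_eq_iff)

lemma coords_inverse: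
  fixes v :: "(real^'n^'n)^'m"
  assumes inj: "inj (comb v)"
  obtains g where "linear g" "range g \<subseteq> range (comb v)" "\<And>y. coords v (g y) = y"
    "\<And>Z. Z \<in> range (comb v) \<Longrightarrow> g (coords v Z) = Z"
proof -
  let ?L = "range (comb v)"
  have zero: "Z = 0" if "Z \<in> ?L" "coords v Z = 0" for Z
  proof -
    have "Z \<bullet> Z = 0" using that coords_eq_0_iff by blast
    then show ?thesis by simp
  qed
  have "inj_on (coords v) ?L"
  proof (rule inj_onI)
    fix y z assume yz: "y \<in> ?L" "z \<in> ?L" "coords v y = coords v z"
    then have "coords v (y - z) = 0" by (simp add: linear_diff[OF linear_coords])
    then show "y = z" using zero[of "y - z"] subspace_diff[OF subspace_range_comb yz(1,2)] by simp
  qed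
  then obtain g where g: "range g \<subseteq> ?L" "linear g" "\<forall>Z\<in>?L. g (coords v Z) = Z"
    using linear_exists_left_inverse_on[OF linear_coords subspace_range_comb] by blast
  have lin: "linear (\<lambda>c. coords v (comb v c))"
    using linear_compose[OF linear_comb linear_coords] by (simp add: o_def)
  have "c = 0" if "coords v (comb v c) = 0" for c
    using zero[OF rangeI that] linear_injective_0[OF linear_comb, of v] inj by blast
  then have "inj (\<lambda>c. coords v (comb v c))" using linear_injective_0[OF lin] by blast
  then have surj: "surj (\<lambda>c. coords v (comb v c))" using linear_injective_imp_surjective[OF lin] by blast
  have "coords v (g y) = y" for y
  proof -
    obtain c where "y = coords v (comb v c)" using surj by (metis surjD)
    then show ?thesis using g(3) by simp
  qed
  then show ?thesis using that[of g] g by blast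
qed

lemma full_dimensional_in_iff:
  "full_dimensional_in L X \<longleftrightarrow> (\<exists>U. open U \<and> L \<inter> U \<noteq> {} \<and> L \<inter> U \<subseteq> X)"
proof -
  have "full_dimensional_in L X \<longleftrightarrow> (\<exists>x T. openin (top_of_set L) T \<and> x \<in> T \<and> T \<subseteq> X)"
    by (auto simp: full_dimensional_in_def interior_of_def)
  also have "\<dots> \<longleftrightarrow> (\<exists>T. openin (top_of_set L) T \<and> T \<noteq> {} \<and> T \<subseteq> X)" by blast
  also have "\<dots> \<longleftrightarrow> (\<exists>U. open U \<and> L \<inter> U \<noteq> {} \<and> L \<inter> U \<subseteq> X)"
    unfolding openin_open by blast
  finally show ?thesis .
qed

lemma bounded_bilinear_matrix_mult: "bounded_bilinear (\<lambda>(A :: real^'k^'l) (B :: real^'j^'k). A ** B)"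
  unfolding bilinear_conv_bounded_bilinear[symmetric] bilinear_def
  by (auto intro: linear_matrix_mult_left linear_matrix_mult_right)

lemma surj_if_no_orthogonal:
  fixes f :: "'a::euclidean_space \<Rightarrow> 'b::euclidean_space"
  assumes f: "linear f" and "\<And>c. (\<And>x. c \<bullet> f x = 0) \<Longrightarrow> c = 0"
  shows "surj f"
proof (rule ccontr)
  assume "range f \<noteq> UNIV"
  then obtain c where c: "c \<noteq> 0" "\<And>y. y \<in> range f \<Longrightarrow> c \<bullet> y = 0"
    by (rule orthogonal_in_larger_subspace[OF linear_subspace_image[OF f subspace_UNIV] subspace_UNIV subset_UNIV])
      (rule that)
  then show False using assms(2)[of c] by blast
qed

text \<open>The differential at the identity of G \<mapsto> G P G^T, projected to L, is surjective when no nonzero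
  matrix of L is annihilated by the coordinate projection P.\<close>

lemma full_dimensional_if_no_kernel:
  fixes v :: "(real^'n^'n)^'m"
  assumes v: "\<And>a. v $ a \<in> sym_mats" and inj: "inj (comb v)"
    and ker: "\<And>c. comb v c ** cproj I = 0 \<Longrightarrow> c = 0"
  shows "full_dimensional_in (range (comb v))
    (orth_proj (range (comb v)) ` {A \<in> sym_mats. rank A = card I})"
proof -
  let ?L = "range (comb v)"
  let ?P = "cproj I :: real^'n^'n"
  obtain g where g: "linear g" "range g \<subseteq> ?L" "\<And>y. coords v (g y) = y"
    "\<And>Z. Z \<in> ?L \<Longrightarrow> g (coords v Z) = Z"
    by (rule coords_inverse[OF inj]) (rule that)
  define f where "f = (\<lambda>H. coords v ((H ** ?P) ** transpose H))"
  define f' where "f' = (\<lambda>h. coords v (?P ** transpose h + h ** ?P))"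
  have "((\<lambda>H. H ** ?P) has_derivative (\<lambda>h. h ** ?P)) (at (mat 1))"
    by (intro bounded_linear_imp_has_derivative linear_linear[THEN iffD2] linear_matrix_mult_right)
  moreover have "(transpose has_derivative (transpose :: real^'n^'n \<Rightarrow> _)) (at (mat 1))"
    by (intro bounded_linear_imp_has_derivative linear_linear[THEN iffD2] linear_transpose_real)
  ultimately have "((\<lambda>H. (H ** ?P) ** transpose H) has_derivative
      (\<lambda>h. (mat 1 ** ?P) ** transpose h + (h ** ?P) ** transpose (mat 1))) (at (mat 1))"
    by (rule bounded_bilinear.FDERIV[OF bounded_bilinear_matrix_mult])
  then have "((\<lambda>H. (H ** ?P) ** transpose H) has_derivative (\<lambda>h. ?P ** transpose h + h ** ?P)) (at (mat 1))"
    by simp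
  then have deriv: "(f has_derivative f') (at (mat 1))"
    unfolding f_def f'_def
    by (rule bounded_linear.has_derivative[OF linear_linear[THEN iffD2, OF linear_coords]])
  have f'_nth: "f' h $ a = 2 * (v $ a \<bullet> (h ** ?P))" for h a
  proof -
    have "v $ a \<bullet> (?P ** transpose h) = transpose (v $ a) \<bullet> transpose (?P ** transpose h)"
      by (rule inner_transpose[symmetric])
    also have "\<dots> = v $ a \<bullet> (h ** ?P)" using v[of a] by (simp add: sym_mats_def matrix_transpose_mul)
    finally show ?thesis by (simp add: f'_def coords_def inner_add_right)
  qed
  have lin': "linear f'" using has_derivative_bounded_linear[OF deriv] by (rule bounded_linear.linear)
  have "surj f'"
  proof (rule surj_if_no_orthogonal[OF lin'])
    fix c assume c: "\<And>h. c \<bullet> f' h = 0"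
    have "c \<bullet> f' h = 2 * (comb v c \<bullet> (h ** ?P))" for h
      by (simp add: inner_vec_def[of c] f'_nth comb_def inner_sum_left sum_distrib_left mult_ac)
    then have "comb v c \<bullet> (h ** ?P) = 0" for h using c[of h] by simp
    then have "(comb v c ** ?P) \<bullet> h = 0" for h
      using inner_matrix_mult_right[of h ?P "comb v c"] by (simp add: inner_commute)
    then have "comb v c ** ?P = 0" by (metis inner_eq_zero_iff)
    then show "c = 0" by (rule ker)
  qed
  then obtain g' where g': "linear g'" "f' \<circ> g' = id"
    using linear_surjective_right_inverse[OF lin'] by blast
  have "polynomial_function f"
    unfolding f_def
    by (intro polynomial_function_bounded_linear_compose[OF linear_coords] pf_intros)
  then have cont: "continuous_on UNIV f" by (rule continuous_on_polymonial_function)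
  let ?D = "{H :: real^'n^'n. det H \<noteq> 0}"
  have "mat 1 \<in> interior ?D" by (simp add: interior_open open_det_nonzero)
  then have int: "f (mat 1) \<in> interior (f ` ?D)"
    using sussmann_open_mapping[OF open_UNIV cont _ deriv _ g'(2), of ?D] g'(1) linear_linear by blast
  define U where "U = coords v -` interior (f ` ?D)"
  have "open U"
    unfolding U_def by (intro open_vimage) (auto intro: linear_continuous_on linear_linear[THEN iffD2] linear_coords)
  moreover have "g (f (mat 1)) \<in> ?L \<inter> U" using int g(2,3) by (auto simp: U_def)
  moreover have "?L \<inter> U \<subseteq> orth_proj ?L ` {A \<in> sym_mats. rank A = card I}"
  proof
    fix y assume y: "y \<in> ?L \<inter> U"
    then have "coords v y \<in> f ` ?D" using interior_subset by (auto simp: U_def)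
    then obtain H where H: "det H \<noteq> 0" "coords v y = f H" by auto
    let ?A = "H ** ?P ** transpose H"
    have "coords v (orth_proj ?L ?A) = coords v y" using H(2) by (simp add: f_def coords_orth_proj)
    then have "orth_proj ?L ?A = y"
      using g(4) y orth_proj_props(1)[OF subspace_range_comb, of v ?A] by (metis IntD1)
    moreover have "?A \<in> sym_mats" by (intro sym_mats_congruence(2)) simp
    moreover have "rank ?A = card I" using H(1) by (simp add: rank_congruence rank_cproj invertible_det_nz)
    ultimately show "y \<in> orth_proj ?L ` {A \<in> sym_mats. rank A = card I}" by blast
  qed
  ultimately show ?thesis unfolding full_dimensional_in_iff by blast
qed

text \<open>A symmetric matrix Z that vanishes outside the rows and columns in I encodes a matrix of rank at
  most |I|: its I \<times> I block, and the coefficients that express the other rows by those in I.\<close>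

definition chart_dom :: "'n set \<Rightarrow> (real^'n^'n) set" where
  "chart_dom I = {Z \<in> sym_mats. \<forall>x \<in> sym_supp (- I). orthogonal x Z}"

definition rank_chart :: "'n set \<Rightarrow> real^'n^'n \<Rightarrow> real^'n^'n" where
  "rank_chart I Z = (cproj I + cproj (- I) ** Z ** cproj I) ** (cproj I ** Z ** cproj I)
     ** transpose (cproj I + cproj (- I) ** Z ** cproj I)"

lemma dim_chart_dom:
  "dim (chart_dom I :: (real^'n^'n) set) + ((CARD('n) - card I + 1) choose 2) = (CARD('n) + 1) choose 2"
proof -
  have "sym_supp (- I) \<subseteq> (sym_mats :: (real^'n^'n) set)" by (auto simp: sym_supp_def)
  then have "dim (chart_dom I :: (real^'n^'n) set) + dim (sym_supp (- I) :: (real^'n^'n) set) = (CARD('n) + 1) choose 2"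
    using dim_subspace_orthogonal_to_vectors[OF subspace_sym_supp[of "- I"] subspace_sym_mats]
    by (simp add: chart_dom_def dim_sym_mats)
  moreover have "card (- I) = CARD('n) - card I"
    by (simp add: Compl_eq_Diff_UNIV card_Diff_subset)
  ultimately show ?thesis by (simp add: dim_sym_supp)
qed

lemma cproj_mult_nth: "(cproj I ** A) $ i $ j = (if i \<in> I then A $ i $ j else 0)"
proof -
  have "(cproj I ** A) $ i $ j = (\<Sum>k\<in>UNIV. if k = i then (if i \<in> I then A $ i $ j else 0) else 0)"
    unfolding matrix_matrix_mult_def cproj_def diag_mat_def vec_lambda_beta by (rule sum.cong) auto
  then show ?thesis by simp
qed

text \<open>A matrix A of rank r has r independent rows, indexed by I.  The coefficients that express the
  other rows in terms of these form a matrix H with A = H A.  By symmetry A = H A H^T, and only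
  the entries of A in I \<times> I matter on the right.\<close>

lemma sym_rank_chart:
  fixes A :: "real^'n^'n"
  assumes A: "A \<in> sym_mats"
  obtains I Z where "card I = rank A" "Z \<in> chart_dom I" "A = rank_chart I Z"
proof -
  obtain B where B: "B \<subseteq> range (($) A)" "independent B" "range (($) A) \<subseteq> span B" "card B = dim (range (($) A))"
    using basis_exists[of "range (($) A)"] by blast
  have "rows A = range (($) A)" by (auto simp: rows_def row_def)
  then have cardB: "card B = rank A" using B(4) by (simp add: row_rank_def)
  define k where "k = inv_into UNIV (($) A)"
  have k: "A $ k b = b" if "b \<in> B" for b using that B(1) unfolding k_def by (intro f_inv_into_f) auto
  define I where "I = k ` B"
  have injk: "inj_on k B" by (rule inj_onI) (metis k)
  have cardI: "card I = rank A" unfolding I_def using card_image[OF injk] cardB by simp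
  have "finite B" using B(2) independent_imp_finite by blast
  have "\<exists>c. A $ i = (\<Sum>j\<in>I. c j *\<^sub>R A $ j)" for i
  proof -
    have "A $ i \<in> span B" using B(3) by blast
    then obtain c where "A $ i = (\<Sum>b\<in>B. c b *\<^sub>R b)" using span_finite[OF \<open>finite B\<close>] by auto
    then have "A $ i = (\<Sum>j\<in>I. c (A $ j) *\<^sub>R A $ j)"
      unfolding I_def sum.reindex[OF injk] using k by simp
    then show ?thesis by (rule exI[of _ "\<lambda>j. c (A $ j)"])
  qed
  then obtain h where h: "\<And>i. A $ i = (\<Sum>j\<in>I. h i j *\<^sub>R A $ j)" by metis
  define Z :: "real^'n^'n" where
    "Z = (\<chi> i j. if i \<in> I then (if j \<in> I then A $ i $ j else h j i) else (if j \<in> I then h i j else 0))"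
  have symA: "A $ i $ j = A $ j $ i" for i j using A by (rule sym_matsD)
  have symZ: "Z \<in> sym_mats" using symA by (intro sym_matsI) (auto simp: Z_def)
  have "x \<bullet> Z = 0" if "x \<in> sym_supp (- I)" for x
    using that unfolding inner_vec_def by (auto intro!: sum.neutral simp: sym_supp_def Z_def)
  then have Zdom: "Z \<in> chart_dom I" using symZ by (simp add: chart_dom_def orthogonal_def)
  define H where "H = cproj I + cproj (- I) ** Z ** cproj I"
  have H_nth: "H $ i $ j = (if j \<in> I then (if i \<in> I then (if i = j then 1 else 0) else h i j) else 0)" for i j
    by (simp add: H_def mult_cproj_nth cproj_mult_nth) (simp add: cproj_def diag_mat_def Z_def)
  have HA: "H ** A = A"
  proof -
    have "(H ** A) $ i $ l = A $ i $ l" for i l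
    proof -
      have "(H ** A) $ i $ l = (\<Sum>j\<in>I. H $ i $ j * A $ j $ l)"
        unfolding matrix_matrix_mult_def vec_lambda_beta
        by (rule sum.mono_neutral_right) (auto simp: H_nth)
      also have "\<dots> = A $ i $ l"
      proof (cases "i \<in> I")
        case True
        then have "(\<Sum>j\<in>I. H $ i $ j * A $ j $ l) = (\<Sum>j\<in>I. if j = i then A $ i $ l else 0)"
          by (intro sum.cong) (auto simp: H_nth)
        then show ?thesis using True by simp
      next
        case False
        then have "(\<Sum>j\<in>I. H $ i $ j * A $ j $ l) = (\<Sum>j\<in>I. h i j *\<^sub>R A $ j) $ l"
          by (simp add: H_nth sum_component)
        then show ?thesis using h[of i] by simp
      qed
      finally show ?thesis .
    qed
    then show ?thesis by (simp add: vec_eq_iff)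
  qed
  have HP: "H ** cproj I = H" by (simp add: vec_eq_iff mult_cproj_nth H_nth)
  have "A = transpose (H ** A)" using A by (simp add: HA sym_mats_def)
  then have AH: "A = A ** transpose H" using A by (simp add: matrix_transpose_mul sym_mats_def)
  have "cproj I ** Z ** cproj I = cproj I ** A ** cproj I"
    by (simp add: vec_eq_iff mult_cproj_nth cproj_mult_nth Z_def)
  then have "rank_chart I Z = (H ** cproj I) ** A ** (cproj I ** transpose H)"
    by (simp add: rank_chart_def H_def[symmetric] matrix_mul_assoc)
  also have "cproj I ** transpose H = transpose H"
    using arg_cong[OF HP, of transpose] by (simp add: matrix_transpose_mul)
  also have "(H ** cproj I) ** A ** transpose H = A" unfolding HP HA using AH by simp
  finally have "A = rank_chart I Z" by (rule sym)
  then show ?thesis by (rule that[OF cardI Zdom])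
qed

lemma negligible_image_low_dim:
  fixes f :: "'a::euclidean_space \<Rightarrow> real^'m"
  assumes f: "f differentiable_on UNIV" and D: "subspace D" "dim D < CARD('m)"
  shows "negligible (f ` D)"
proof -
  have "dim D \<le> dim (UNIV :: (real^'m) set)" using D(2) by simp
  then obtain V :: "(real^'m) set" where V: "subspace V" "dim V = dim D"
    by (rule choose_subspace_of_subspace) (rule that)
  obtain h where "linear h \<and> h ` V = D \<and> inj_on h V"
    using subspace_isomorphism[OF V(1) D(1) V(2)] by (elim exE)
  then have h: "linear h" "h ` V = D" by auto
  have negV: "negligible V" using V(2) D(2) by (intro negligible_lowdim) simp
  have "(\<lambda>x. f (h x)) differentiable_on V"
    by (rule differentiable_on_compose[OF linear_imp_differentiable_on[OF h(1)] differentiable_on_subset[OF f]]) simp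
  then have "negligible ((\<lambda>x. f (h x)) ` V)"
    by (rule negligible_differentiable_image_negligible[OF order_refl negV])
  then show ?thesis using h(2) by (simp add: image_image[symmetric])
qed

text \<open>The matrices of rank r are covered by finitely many polynomial images of a space of dimension
  less than dim L, so their projection to L is negligible.\<close>

lemma not_full_dimensional:
  fixes v :: "(real^'n^'n)^'m"
  assumes inj: "inj (comb v)"
    and r: "(CARD('n) + 1) choose 2 < CARD('m) + ((CARD('n) - r + 1) choose 2)"
  shows "\<not> full_dimensional_in (range (comb v)) (orth_proj (range (comb v)) ` {A \<in> sym_mats. rank A = r})"
proof
  let ?L = "range (comb v)"
  assume "full_dimensional_in ?L (orth_proj ?L ` {A \<in> sym_mats. rank A = r})"
  then obtain U where U: "open U" "?L \<inter> U \<noteq> {}" "?L \<inter> U \<subseteq> orth_proj ?L ` {A \<in> sym_mats. rank A = r}"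
    unfolding full_dimensional_in_iff by blast
  obtain g where g: "linear g" "range g \<subseteq> ?L" "\<And>y. coords v (g y) = y"
    "\<And>Z. Z \<in> ?L \<Longrightarrow> g (coords v Z) = Z"
    by (rule coords_inverse[OF inj]) (rule that)
  have "open (g -` U)"
    by (intro open_vimage U) (auto intro: linear_continuous_on linear_linear[THEN iffD2] g)
  moreover have "g -` U \<noteq> {}" using U(2) g(4) by blast
  moreover have "negligible (g -` U)"
  proof -
    let ?C = "\<lambda>I. (\<lambda>Z. coords v (rank_chart I Z)) ` chart_dom I"
    have "negligible (?C I)" if "I \<in> {I. card I = r}" for I
    proof (rule negligible_image_low_dim)
      have "polynomial_function (\<lambda>Z. coords v (rank_chart I Z))"
        unfolding rank_chart_def
        by (intro polynomial_function_bounded_linear_compose[OF linear_coords] pf_intros)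
      then show "(\<lambda>Z. coords v (rank_chart I Z)) differentiable_on UNIV"
        by (rule differentiable_on_polynomial_function)
      show "subspace (chart_dom I)"
        using subspace_sym_mats by (auto simp: chart_dom_def subspace_def orthogonal_def inner_add_right)
      show "dim (chart_dom I) < CARD('m)" using dim_chart_dom[of I] r that by simp
    qed
    then have "negligible (\<Union> (?C ` {I. card I = r}))" by (intro negligible_Union) auto
    moreover have "g -` U \<subseteq> \<Union> (?C ` {I. card I = r})"
    proof
      fix y assume "y \<in> g -` U"
      then have "g y \<in> ?L \<inter> U" using g(2) by auto
      then obtain A where A: "A \<in> sym_mats" "rank A = r" "g y = orth_proj ?L A" using U(3) by blast
      then have "y = coords v A" using g(3)[of y] coords_orth_proj[of v A] by simp
      moreover obtain I Z where "card I = rank A" "Z \<in> chart_dom I" "A = rank_chart I Z"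
        by (rule sym_rank_chart[OF A(1)])
      ultimately show "y \<in> \<Union> (?C ` {I. card I = r})" using A(2) by blast
    qed
    ultimately show ?thesis by (rule negligible_subset)
  qed
  ultimately show False using open_not_negligible by blast
qed

section \<open>Polynomial conditions on a basis and the Grassmannian\<close>

definition lin_tuple :: "real^'m^'m \<Rightarrow> (real^'n^'n)^'m \<Rightarrow> (real^'n^'n)^'m" where
  "lin_tuple T u = (\<chi> a. comb u (T $ a))"

lemma comb_lin_tuple: "comb (lin_tuple T u) c = comb u (transpose T *v c)"
proof -
  have "comb (lin_tuple T u) c = (\<Sum>a\<in>UNIV. \<Sum>b\<in>UNIV. (c $ a * T $ a $ b) *\<^sub>R u $ b)"
    by (simp add: comb_def lin_tuple_def scaleR_sum_right)
  also have "\<dots> = (\<Sum>b\<in>UNIV. \<Sum>a\<in>UNIV. (c $ a * T $ a $ b) *\<^sub>R u $ b)" by (rule sum.swap)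
  also have "\<dots> = comb u (transpose T *v c)"
    by (simp add: comb_def matrix_vector_mult_def transpose_def scaleR_sum_left[symmetric] mult.commute
        del: transpose_matrix_vector)
  finally show ?thesis .
qed

lemma lin_tuple_invertible:
  assumes "det T \<noteq> 0"
  shows "range (comb (lin_tuple T u)) = range (comb u)" "inj (comb (lin_tuple T u)) \<longleftrightarrow> inj (comb u)"
proof -
  have bij: "inj ((*v) (transpose T))" "surj ((*v) (transpose T))"
    using invertible_matrix_vector_bij[of "transpose T"] assms by (simp_all add: invertible_det_nz)
  have eq: "comb (lin_tuple T u) = comb u \<circ> (*v) (transpose T)"
    by (simp add: fun_eq_iff comb_lin_tuple del: transpose_matrix_vector)
  show "range (comb (lin_tuple T u)) = range (comb u)"
    unfolding eq image_comp[symmetric] bij(2) ..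
  show "inj (comb (lin_tuple T u)) \<longleftrightarrow> inj (comb u)"
  proof
    assume *: "inj (comb (lin_tuple T u))"
    show "inj (comb u)"
      using inj_on_imageI[of "comb u" "(*v) (transpose T)" UNIV] * unfolding eq bij(2) .
  next
    assume "inj (comb u)"
    then show "inj (comb (lin_tuple T u))" unfolding eq using bij(1) by (rule inj_compose)
  qed
qed

lemma linear_lin_tuple: "linear (lin_tuple T)"
  by (auto intro!: linearI simp: lin_tuple_def comb_def vec_eq_iff scaleR_add_right sum.distrib
      scaleR_sum_right mult.commute)

lemma scale_lin_tuple: "t *\<^sub>R lin_tuple T u = lin_tuple (t *\<^sub>R T) u"
  by (simp add: lin_tuple_def comb_def vec_eq_iff scaleR_sum_right)

text \<open>The coordinates obtained from the tuple of positions f by replacing one position at a time.\<close>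

definition pl_tuple :: "('m \<Rightarrow> 'n \<times> 'n) \<Rightarrow> real^('m \<Rightarrow> 'n \<times> 'n) \<Rightarrow> (real^'n^'n)^'m" where
  "pl_tuple f x = (\<chi> a. \<chi> i j. x $ (f(a := (i, j))))"

lemma linear_pl_tuple: "linear (pl_tuple f)"
  by (auto intro!: linearI simp: pl_tuple_def vec_eq_iff)

text \<open>By Cramer's rule, where the coordinate at f does not vanish these matrices form a basis of the
  same subspace.\<close>

lemma basis_from_pl_tuple:
  fixes v :: "'m::finite \<Rightarrow> real^'n^'n"
  assumes f: "pluecker v $ f \<noteq> 0"
  obtains T where "det T \<noteq> 0" "(\<chi> a. v a) = lin_tuple T (pl_tuple f (pluecker v))"
proof -
  define M :: "real^'m^'m" where "M = (\<chi> a b. v a $ fst (f b) $ snd (f b))"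
  have M: "det M \<noteq> 0" using f by (simp add: pluecker_def M_def)
  let ?u = "pl_tuple f (pluecker v)"
  have u: "?u $ a $ i $ j = det (\<chi> a' b. if b = a then (\<chi> a'. v a' $ i $ j) $ a' else M $ a' $ b)" for a i j
    by (simp add: pl_tuple_def pluecker_def) (rule arg_cong[of _ _ det], auto simp: vec_eq_iff M_def)
  have "v a' $ i $ j = lin_tuple ((1 / det M) *\<^sub>R M) ?u $ a' $ i $ j" for a' i j
  proof -
    have "M *v (\<chi> a. ?u $ a $ i $ j / det M) = (\<chi> a'. v a' $ i $ j)"
      unfolding cramer[OF M] u by (simp add: vec_eq_iff)
    then have "(\<Sum>a\<in>UNIV. M $ a' $ a * (?u $ a $ i $ j / det M)) = v a' $ i $ j"
      by (simp add: matrix_vector_mult_def vec_eq_iff)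
    then show ?thesis
      by (simp add: lin_tuple_def comb_def sum_component mult.commute)
  qed
  then have "(\<chi> a. v a) = lin_tuple ((1 / det M) *\<^sub>R M) ?u" by (simp add: vec_eq_iff)
  moreover have "det ((1 / det M) *\<^sub>R M) \<noteq> 0" using M by (simp add: det_scaleR)
  ultimately show ?thesis using that by blast
qed

text \<open>The columns of the matrix of entries of the basis span the coordinate space, because a vector
  orthogonal to all of them is a linear relation.  So m of the columns are independent.\<close>

lemma pluecker_nonzero:
  fixes w :: "(real^'n^'n)^'m"
  assumes inj: "inj (comb w)"
  obtains f where "pluecker (\<lambda>a. w $ a) $ f \<noteq> 0"
proof -
  define col :: "'n \<times> 'n \<Rightarrow> real^'m" where "col = (\<lambda>p. \<chi> a. w $ a $ fst p $ snd p)"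
  have spanC: "span (range col) = UNIV"
  proof (rule ccontr)
    assume "span (range col) \<noteq> UNIV"
    then obtain c where c: "c \<noteq> 0" "\<And>y. y \<in> span (range col) \<Longrightarrow> c \<bullet> y = 0"
      by (rule orthogonal_in_larger_subspace[OF subspace_span subspace_UNIV subset_UNIV]) (rule that)
    have "comb w c $ i $ j = 0" for i j
    proof -
      have "c \<bullet> col (i, j) = 0" by (intro c(2) span_base rangeI)
      then show ?thesis by (simp add: comb_def col_def inner_vec_def sum_component)
    qed
    then have "comb w c = 0" by (simp add: vec_eq_iff)
    then show False using inj linear_injective_0[OF linear_comb, of w] c(1) by blast
  qed
  obtain B where B: "B \<subseteq> range col" "independent B" "range col \<subseteq> span B" "card B = dim (range col)"
    using basis_exists[of "range col"] by blast
  have "dim (range col) = CARD('m)" using spanC dim_span[of "range col"] by simp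
  then obtain g where g: "bij_betw g (UNIV :: 'm set) B"
    using finite_same_card_bij[of "UNIV :: 'm set" B] B independent_imp_finite[of B] by auto
  have "\<exists>p. g b = col p" for b using B(1) bij_betwE[OF g] by blast
  then obtain f where f: "\<And>b. g b = col (f b)" by metis
  define M :: "real^'m^'m" where "M = (\<chi> a b. w $ a $ fst (f b) $ snd (f b))"
  have "x = 0" if x: "M *v x = 0" for x
  proof -
    have injg: "inj g" and rg: "range g = B" using g by (auto simp: bij_betw_def)
    have Mx: "M *v x = (\<Sum>b\<in>UNIV. x $ b *\<^sub>R g b)"
      by (simp add: vec_eq_iff matrix_vector_mult_def M_def f col_def sum_component mult.commute)
    have "(\<Sum>y\<in>range g. x $ (inv g y) *\<^sub>R y) = 0"
      using x injg unfolding Mx by (simp add: sum.reindex)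
    then have "x $ (inv g (g b)) = 0" for b
      using independentD[OF B(2) _ subset_refl, of "\<lambda>y. x $ (inv g y)" "g b"] rg independent_imp_finite[OF B(2)]
      by auto
    then show ?thesis using injg by (simp add: vec_eq_iff)
  qed
  then have "invertible M" using matrix_left_invertible_ker[of M] invertible_left_inverse by blast
  then show ?thesis using that[of f] by (simp add: pluecker_def M_def invertible_det_nz)
qed

lemma is_basis_of_comb:
  fixes w :: "(real^'n^'n)^'m"
  assumes inj: "inj (comb w)"
  shows "is_basis_of (\<lambda>a. w $ a) (range (comb w))"
proof -
  have "inj (\<lambda>a. w $ a)"
  proof (rule injI)
    fix a b assume "w $ a = w $ b"
    then have "comb w (axis a 1) = comb w (axis b 1)" by (simp add: comb_axis)
    then have "axis a (1::real) = axis b 1" using inj by (rule injD[rotated])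
    then show "a = b" by (simp add: axis_eq_axis)
  qed
  moreover have span: "span (range (\<lambda>a. w $ a)) = range (comb w)"
  proof
    have "w $ a \<in> range (comb w)" for a using rangeI[of "comb w" "axis a 1"] by (simp only: comb_axis)
    then have sub: "range (\<lambda>a. w $ a) \<subseteq> range (comb w)" by blast
    show "span (range (\<lambda>a. w $ a)) \<subseteq> range (comb w)"
      by (rule span_minimal[OF sub subspace_range_comb])
    have "comb w c \<in> span (range (\<lambda>a. w $ a))" for c
      unfolding comb_def by (intro span_sum span_scale span_base) simp
    then show "range (comb w) \<subseteq> span (range (\<lambda>a. w $ a))" by blast
  qed
  moreover have "independent (range (\<lambda>a. w $ a))"
  proof (rule card_le_dim_spanning[of _ "range (comb w)"])
    show "range (\<lambda>a. w $ a) \<subseteq> range (comb w)"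
      using span_superset[of "range (\<lambda>a. w $ a)"] unfolding span .
    show "range (comb w) \<subseteq> span (range (\<lambda>a. w $ a))" by (simp only: span order_refl)
    show "card (range (\<lambda>a. w $ a)) \<le> dim (range (comb w))"
      using dim_range_comb[OF inj] card_image_le[of UNIV "\<lambda>a. w $ a"] by simp
  qed simp
  ultimately show ?thesis by (simp add: is_basis_of_def)
qed

text \<open>The bases that are recovered from the Pluecker coordinates, and all their linear recombinations,
  depend linearly on the coordinates.  Inserting them into the homogeneous components of Q gives
  equations for an exceptional set, outside of which some recombination is a basis where Q does not
  vanish.  The recombinations are needed because Q need not be invariant under a change of basis.\<close>

lemma generic_basis:
  fixes Q :: "(real^'n^'n)^'m \<Rightarrow> real" and w :: "(real^'n^'n)^'m"
  assumes Q: "real_polynomial_function Q" and w: "\<And>a. w $ a \<in> sym_mats" "inj (comb w)" "Q w \<noteq> 0"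
  obtains E :: "(real^'n^'n) set set" where "zariski_closed_grassmannian TYPE('m) E"
    "E \<subset> grassmannian CARD('m)"
    "\<forall>L \<in> grassmannian CARD('m) - E.
       \<exists>v :: (real^'n^'n)^'m. (\<forall>a. v $ a \<in> sym_mats) \<and> inj (comb v) \<and> range (comb v) = L \<and> Q v \<noteq> 0"
proof -
  obtain D h where h: "\<And>i. i \<le> D \<Longrightarrow> real_polynomial_function (h i)"
      "\<And>i c x. i \<le> D \<Longrightarrow> h i (c *\<^sub>R x) = c ^ i * h i x"
    and Qh: "\<And>x t. Q (t *\<^sub>R x) = (\<Sum>i\<le>D. h i x * t ^ i)"
    by (rule real_polynomial_function_homogeneous_components[OF Q]) (rule that; assumption)
  define p where "p = (\<lambda>f T i x. x $ f * h i (lin_tuple T (pl_tuple f x)))"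
  define P where "P = {p f T i | f T i. i \<le> D \<and> det T \<noteq> 0}"
  define E where "E = {L \<in> grassmannian CARD('m).
    \<forall>v :: 'm \<Rightarrow> real^'n^'n. is_basis_of v L \<longrightarrow> (\<forall>p\<in>P. p (pluecker v) = 0)}"
  have lin: "linear (\<lambda>x. lin_tuple T (pl_tuple f x))" for T and f :: "'m \<Rightarrow> 'n \<times> 'n"
    using linear_compose[OF linear_pl_tuple linear_lin_tuple] by (simp add: o_def)
  have "homogeneous_polynomial (p f T i)" if "i \<le> D" for f T i
    unfolding homogeneous_polynomial_def
  proof (intro conjI exI allI)
    show "real_polynomial_function (p f T i)"
      unfolding p_def
      by (intro real_polynomial_function.intros(4) rpf_vec_nth polynomial_function_id
          rpf_compose[OF h(1)[OF that]] polynomial_function_bounded_linear_compose[OF lin])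
    show "p f T i (c *\<^sub>R x) = c ^ (Suc i) * p f T i x" for c x
      by (simp add: p_def linear_scale[OF lin] h(2)[OF that])
  qed
  then have closed: "zariski_closed_grassmannian TYPE('m) E"
    unfolding zariski_closed_grassmannian_def E_def by (intro exI[of _ P]) (auto simp: P_def)
  have "range (comb w) \<in> grassmannian CARD('m) - E"
  proof -
    have "range (comb w) \<in> grassmannian CARD('m)"
      using subspace_range_comb comb_in_sym[OF w(1)] dim_range_comb[OF w(2)] by (auto simp: grassmannian_def)
    moreover have "\<exists>p\<in>P. p (pluecker (\<lambda>a. w $ a)) \<noteq> 0"
    proof -
      obtain f where f: "pluecker (\<lambda>a. w $ a) $ f \<noteq> 0" by (rule pluecker_nonzero[OF w(2)])
      obtain T where T: "det T \<noteq> 0" "(\<chi> a. w $ a) = lin_tuple T (pl_tuple f (pluecker (\<lambda>a. w $ a)))"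
        by (rule basis_from_pl_tuple[OF f])
      have "(\<Sum>i\<le>D. h i w) \<noteq> 0" using w(3) Qh[of 1 w] by simp
      then obtain i where i: "i \<le> D" "h i w \<noteq> 0" by (metis atMost_iff sum.neutral)
      have "p f T i (pluecker (\<lambda>a. w $ a)) \<noteq> 0"
        using f i(2) T(2) by (simp add: p_def)
      moreover have "p f T i \<in> P" using i(1) T(1) by (auto simp: P_def)
      ultimately show ?thesis by blast
    qed
    ultimately show ?thesis using is_basis_of_comb[OF w(2)] by (auto simp: E_def)
  qed
  then have psub: "E \<subset> grassmannian CARD('m)" by (auto simp: E_def)
  have gen: "\<exists>v :: (real^'n^'n)^'m. (\<forall>a. v $ a \<in> sym_mats) \<and> inj (comb v) \<and> range (comb v) = L \<and> Q v \<noteq> 0"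
    if L: "L \<in> grassmannian CARD('m) - E" for L
  proof -
    obtain v :: "'m \<Rightarrow> real^'n^'n" and f T i where v: "is_basis_of v L"
      and i: "i \<le> D" and T: "det T \<noteq> 0" and p: "p f T i (pluecker v) \<noteq> 0"
      using L by (auto simp: E_def P_def)
    let ?u = "pl_tuple f (pluecker v)"
    have f: "pluecker v $ f \<noteq> 0" using p by (auto simp: p_def)
    obtain T' where T': "det T' \<noteq> 0" "(\<chi> a. v a) = lin_tuple T' ?u" by (rule basis_from_pl_tuple[OF f])
    have "range (comb (\<chi> a. v a)) = L" "inj (comb (\<chi> a. v a))"
      using v comb_of_basis[of v L] by (auto simp: is_basis_of_def)
    then have u: "range (comb ?u) = L" "inj (comb ?u)"
      unfolding T'(2) using lin_tuple_invertible[OF T'(1), of ?u] by simp_all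
    define y where "y = lin_tuple T ?u"
    have "h i y \<noteq> 0" using p by (auto simp: p_def y_def)
    then have "finite {t. (\<Sum>i\<le>D. h i y * t ^ i) = 0}"
      using polyfun_finite_roots[of "\<lambda>i. h i y" D] i by blast
    then have "finite (insert 0 {t. (\<Sum>i\<le>D. h i y * t ^ i) = 0})" by simp
    then obtain t :: real where "t \<notin> insert 0 {t. (\<Sum>i\<le>D. h i y * t ^ i) = 0}"
      using ex_new_if_finite[OF infinite_UNIV_char_0] by blast
    then have t: "t \<noteq> 0" "Q (t *\<^sub>R y) \<noteq> 0" by (auto simp: Qh)
    have ty: "t *\<^sub>R y = lin_tuple (t *\<^sub>R T) ?u" by (simp add: y_def scale_lin_tuple)
    have tT: "det (t *\<^sub>R T) \<noteq> 0" using t(1) T by (simp add: det_scaleR)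
    have ran: "range (comb (t *\<^sub>R y)) = L" and inj: "inj (comb (t *\<^sub>R y))"
      unfolding ty using lin_tuple_invertible[OF tT, of ?u] u by simp_all
    have "(t *\<^sub>R y) $ a \<in> L" for a
      using rangeI[of "comb (t *\<^sub>R y)" "axis a 1"] unfolding comb_axis ran .
    then have "\<forall>a. (t *\<^sub>R y) $ a \<in> sym_mats" using L by (auto simp: grassmannian_def)
    then show ?thesis using ran inj t(2) by blast
  qed
  show ?thesis by (rule that[OF closed psub ballI]) (rule gen)
qed

section \<open>The two thresholds\<close>

lemma choose_two_mono: "a \<le> b \<Longrightarrow> a choose 2 \<le> b choose 2"
  by (simp add: choose_two div_le_mono mult_le_mono)

text \<open>The Gram determinant of the matrices v a S; it does not vanish iff no nontrivial combination X
  of the v a satisfies X S = 0.\<close>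

definition gram_det :: "(real^'n^'n)^'m \<Rightarrow> real^'n^'n \<Rightarrow> real" where
  "gram_det v S = det (\<chi> a b. (v $ a ** S) \<bullet> (v $ b ** S))"

lemma gram_det_nonzero_iff: "gram_det v S \<noteq> 0 \<longleftrightarrow> (\<forall>c. comb v c ** S = 0 \<longrightarrow> c = 0)"
proof -
  let ?M = "\<chi> a b. (v $ a ** S) \<bullet> (v $ b ** S)"
  have comb: "comb v c ** S = (\<Sum>b\<in>UNIV. c $ b *\<^sub>R (v $ b ** S))" for c
    unfolding comb_def
    by (simp add: linear_sum[OF linear_matrix_mult_right] linear_scale[OF linear_matrix_mult_right])
  have Mc: "(?M *v c) $ a = (v $ a ** S) \<bullet> (comb v c ** S)" for c a
    by (simp add: comb matrix_vector_mult_def inner_sum_right mult.commute)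
  have "?M *v c = 0 \<longleftrightarrow> comb v c ** S = 0" for c
  proof
    assume "?M *v c = 0"
    then have "(v $ a ** S) \<bullet> (comb v c ** S) = 0" for a unfolding Mc[symmetric] by simp
    then have "(comb v c ** S) \<bullet> (comb v c ** S) = 0"
      by (subst (1) comb) (simp add: inner_sum_left)
    then show "comb v c ** S = 0" by simp
  qed (simp add: vec_eq_iff[of "?M *v c"] Mc)
  then show ?thesis
    unfolding gram_det_def invertible_det_nz[symmetric] invertible_left_inverse matrix_left_invertible_ker
    by simp
qed

lemma rpf_gram_det:
  fixes v :: "'a::euclidean_space \<Rightarrow> (real^'n^'n)^'m"
  assumes "polynomial_function v" "polynomial_function S"
  shows "real_polynomial_function (\<lambda>\<theta>. gram_det (v \<theta>) (S \<theta>))"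
proof -
  have "real_polynomial_function (\<lambda>\<theta>. A \<theta> \<bullet> B \<theta>)"
    if "polynomial_function A" "polynomial_function B" for A B :: "'a \<Rightarrow> real^'n^'n"
    unfolding inner_vec_def inner_real_def
    by (intro real_polynomial_function_sum real_polynomial_function.intros(4) rpf_mat_nth that) auto
  note inner = this
  show ?thesis
    unfolding gram_det_def
    by (intro rpf_det polynomial_function_vec_lambda rpf_imp_pf inner polynomial_function_matrix_mult
        polynomial_function_vecD assms)
qed

lemma cproj_psd: "cproj I \<in> psd_mats"
proof -
  have "0 \<le> x \<bullet> (cproj I *v x)" for x
    by (auto simp: inner_vec_def cproj_mult_vec intro!: sum_nonneg)
  then show ?thesis by (simp add: psd_mats_def)
qed

text \<open>The orthogonal complement in the symmetric matrices of those supported on J has dimension at least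
  m.  The symmetric matrices annihilated by the projection are the ones supported on J, so any
  m-dimensional subspace of the complement is an example.\<close>

lemma gram_det_nonzero_example:
  fixes J :: "'n::finite set"
  assumes "CARD('m::finite) + ((card J + 1) choose 2) \<le> (CARD('n) + 1) choose 2"
  obtains w :: "(real^'n^'n)^'m" where "\<And>a. w $ a \<in> sym_mats" "gram_det w (cproj (- J)) \<noteq> 0"
proof -
  define W where "W = {Y :: real^'n^'n. Y \<in> sym_mats \<and> (\<forall>x \<in> sym_supp J. orthogonal x Y)}"
  have W: "subspace W"
    using subspace_sym_mats by (auto simp: W_def subspace_def orthogonal_def inner_add_right)
  have "sym_supp J \<subseteq> (sym_mats :: (real^'n^'n) set)" by (auto simp: sym_supp_def)
  then have "dim W + ((card J + 1) choose 2) = (CARD('n) + 1) choose 2"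
    using dim_subspace_orthogonal_to_vectors[OF subspace_sym_supp[of J] subspace_sym_mats]
    by (simp add: W_def dim_sym_mats dim_sym_supp)
  then have "CARD('m) \<le> dim W" using assms by simp
  then obtain L where L: "subspace L" "L \<subseteq> span W" "dim L = CARD('m)"
    by (rule choose_subspace_of_subspace) (rule that)
  have "span W = W" using W by (simp only: span_eq_iff)
  with L(2) have LW: "L \<subseteq> W" by (simp only:)
  obtain w :: "(real^'n^'n)^'m" where w: "range (comb w) = L" "inj (comb w)"
    by (rule subspace_has_comb[OF L(1,3)])
  have in_W: "comb w c \<in> W" for c using LW w(1) by blast
  have "w $ a \<in> sym_mats" for a using in_W[of "axis a 1"] by (simp add: comb_axis W_def)
  moreover have "c = 0" if "comb w c ** cproj (- J) = 0" for c
  proof -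
    have "comb w c \<in> sym_supp J" using that in_W[of c] by (simp add: sym_supp_iff W_def)
    then have "comb w c \<bullet> comb w c = 0" using in_W[of c] by (auto simp: W_def orthogonal_def)
    then have "comb w c = 0" by simp
    then show ?thesis using w(2) linear_injective_0[OF linear_comb, of w] by blast
  qed
  ultimately show ?thesis using that gram_det_nonzero_iff by blast
qed

lemma gram_det_nonzero_imp_inj: "gram_det v S \<noteq> 0 \<Longrightarrow> inj (comb v)"
  using gram_det_nonzero_iff[of v S] linear_injective_0[OF linear_comb, of v] by auto

lemma pd_face_psd:
  fixes G :: "real^'n^'n"
  assumes G: "invertible G" and X: "X \<in> kernel_mats G J" and pos: "transpose G ** X ** G + cproj (- J) \<in> posdefs"
    and J: "J \<noteq> {}"
  shows "X \<in> psd_mats" "X \<noteq> 0"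
proof -
  let ?A = "transpose G ** X ** G"
  have "?A \<in> psd_mats"
  proof (rule psd_if_nonneg_on_support[OF kernel_mats_congruence[OF X]])
    fix u :: "real^'n" assume u: "cproj (- J) *v u = 0"
    have "0 \<le> u \<bullet> ((?A + cproj (- J)) *v u)"
      using pos by (cases "u = 0") (auto simp: posdefs_def intro: less_imp_le)
    then show "0 \<le> u \<bullet> (?A *v u)" by (simp only: matrix_vector_mult_add_rdistrib u add_0_right)
  qed
  then show "X \<in> psd_mats" by (rule psd_mats_congruence_cancel[OF G])
  obtain j where j: "j \<in> J" using J by blast
  show "X \<noteq> 0"
  proof
    assume "X = 0"
    then have "cproj (- J) \<in> posdefs" using pos by simp
    moreover have "axis j (1::real) \<noteq> 0" by (simp add: axis_eq_0_iff)
    ultimately have "0 < axis j 1 \<bullet> (cproj (- J) *v axis j 1)" unfolding posdefs_def by blast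
    then show False using j by (simp add: inner_axis' cproj_mult_vec)
  qed
qed

text \<open>Every positive semidefinite S of rank r is G P G^T for a coordinate projection P that can be fixed
  in advance; let it project onto r coordinates outside J.  A polynomial that is nonzero at some such S
  is nonzero for some G in the open set of the face.  There X S = 0 for the matrix X of the face.\<close>

lemma generic_MLE_fails:
  fixes L :: "(real^'n^'n) set" and J :: "'n set"
  assumes L: "subspace L" and face: "pd_face L J" and r: "card J + r \<le> CARD('n)"
    and U: "zariski_open_in {S \<in> psd_mats. rank S = r} U" "U \<noteq> {}"
  obtains S where "S \<in> U" "\<not> MLE_exists L S"
proof -
  obtain P where P: "\<forall>p\<in>P. real_polynomial_function p"
    "U = {S \<in> {S \<in> psd_mats. rank S = r}. \<exists>p\<in>P. p S \<noteq> 0}"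
    using U(1) unfolding zariski_open_in_def by blast
  obtain S1 p where S1: "S1 \<in> psd_mats" "rank S1 = r" and p: "p \<in> P" "p S1 \<noteq> 0" using U(2) P(2) by auto
  have "card J \<le> CARD('n) - r" "CARD('n) - r \<le> card (UNIV :: 'n set)" using r by simp_all
  then obtain K where K: "J \<subseteq> K" "card K = CARD('n) - r"
    using exists_subset_between[of J "CARD('n) - r" UNIV] by auto
  have cardK: "card (- K) = r"
    using K(2) r by (simp add: Compl_eq_Diff_UNIV card_Diff_subset)
  have "card (- K) = rank S1" using cardK S1(2) by simp
  then obtain G1 :: "real^'n^'n" where G1: "invertible G1" "S1 = G1 ** cproj (- K) ** transpose G1"
    by (rule psd_congruent_cproj[OF S1(1)])
  obtain V where V: "open V" "V \<noteq> {}" and J: "J \<noteq> {}"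
    and V_face: "\<And>G. G \<in> V \<Longrightarrow> invertible G \<and> (\<exists>X \<in> L \<inter> kernel_mats G J. transpose G ** X ** G + cproj (- J) \<in> posdefs)"
    using face unfolding pd_face_def by blast
  have rpf: "real_polynomial_function (\<lambda>G. p (G ** cproj (- K) ** transpose G))"
    by (rule rpf_compose[OF P(1)[rule_format, OF p(1)]]) (intro pf_intros)
  have "p (G1 ** cproj (- K) ** transpose G1) \<noteq> 0" using p(2) G1(2) by simp
  then obtain G where G: "G \<in> V" "p (G ** cproj (- K) ** transpose G) \<noteq> 0"
    by (rule real_polynomial_function_nonzero_in_open[OF rpf _ V])
  obtain X where X: "X \<in> L" "X \<in> kernel_mats G J" "transpose G ** X ** G + cproj (- J) \<in> posdefs"
    and inv: "invertible G" using V_face[OF G(1)] by blast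
  define S where "S = G ** cproj (- K) ** transpose G"
  have "S \<in> psd_mats" using psd_mats_congruence[OF cproj_psd, of "transpose G" "- K"] by (simp add: S_def)
  moreover have "rank S = r" using inv cardK by (simp add: S_def rank_congruence rank_cproj)
  ultimately have "S \<in> U" using P(2) p(1) G(2) by (auto simp: S_def)
  moreover have "X ** S = 0"
  proof -
    have "cproj (- K) = cproj (- J) ** cproj (- K)"
      using K(1) unfolding cproj_mult_cproj by (intro arg_cong[of _ _ cproj]) auto
    then have "X ** S = X ** G ** (cproj (- J) ** cproj (- K)) ** transpose G"
      by (simp add: S_def matrix_mul_assoc)
    also have "\<dots> = (X ** G ** cproj (- J)) ** cproj (- K) ** transpose G" by (simp only: matrix_mul_assoc)
    finally show ?thesis using X(2) by (simp add: kernel_mats_def)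
  qed
  then have "\<not> MLE_exists L S"
    by (intro not_MLE_exists[OF L X(1)] pd_face_psd[OF inv X(2,3) J])
  ultimately show ?thesis using that by blast
qed

lemma pd_face_sym_mats: "pd_face (sym_mats :: (real^'n^'n) set) {i}"
proof -
  have "\<exists>X \<in> sym_mats \<inter> kernel_mats G {i}. transpose G ** X ** G + cproj (- {i}) \<in> posdefs"
    if G: "invertible G" for G :: "real^'n^'n"
  proof -
    obtain H :: "real^'n^'n" where H: "G ** H = mat 1" "H ** G = mat 1" using G invertible_def by blast
    have tH: "transpose G ** transpose H = mat 1" using H(2) by (metis matrix_transpose_mul transpose_mat)
    define X where "X = transpose H ** cproj {i} ** H"
    have XG: "X ** G = transpose H ** cproj {i}" using H(2) by (simp add: X_def matrix_mul_assoc[symmetric])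
    have "X ** G ** cproj (- {i}) = transpose H ** (cproj {i} ** cproj (- {i}))"
      by (simp add: XG matrix_mul_assoc)
    then have "X ** G ** cproj (- {i}) = 0" by (simp add: cproj_mult_cproj)
    moreover have "X \<in> sym_mats" unfolding X_def by (rule sym_mats_congruence(1)) simp
    moreover have "transpose G ** X ** G = cproj {i}"
    proof -
      have "transpose G ** X ** G = (transpose G ** transpose H) ** cproj {i}"
        by (simp only: matrix_mul_assoc[symmetric] XG)
      then show ?thesis by (simp add: tH)
    qed
    ultimately show ?thesis by (intro bexI[of _ X]) (simp_all add: kernel_mats_def mat_1_posdefs)
  qed
  then show ?thesis by (intro pd_face_if_all) simp_all
qed

text \<open>A positive definite face with the fewest indices admits no step to a smaller one.\<close>

lemma small_pd_face:
  fixes L :: "(real^'n^'n) set"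
  assumes pd: "L \<inter> pd_mats \<noteq> {}"
    and step: "\<And>J. large J \<Longrightarrow> pd_face L J \<Longrightarrow> \<exists>J'. card J' < card J \<and> pd_face L J'"
  obtains J where "pd_face L J" "\<not> large J"
proof -
  obtain J where J: "pd_face L J" and min: "\<And>J'. pd_face L J' \<Longrightarrow> card J \<le> card J'"
    using ex_has_least_nat[of "pd_face L" UNIV card] pd_face_UNIV[OF pd] by blast
  have "\<not> large J" using step[of J] J min by (meson not_le)
  then show ?thesis using that J by blast
qed

text \<open>The polynomial Q on bases collects the condition for existence of the estimate at a fixed S of rank
  \<rho> and, for each set J that is too large for a face of minimal size, the regularity condition that
  makes a step to a smaller face possible.\<close>

theorem corollary4p6:
  assumes "CARD('m::finite) \<le> (CARD('n::finite) + 1) choose 2"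
  shows "\<exists>E :: (real^'n^'n) set set.
           zariski_closed_grassmannian TYPE('m) E \<and> E \<subset> grassmannian CARD('m) \<and>
           (\<forall>L \<in> grassmannian CARD('m) - E. L \<inter> pd_mats \<noteq> {} \<longrightarrow> MLT L = GCR L)"
proof -
  let ?N = "(CARD('n) + 1) choose 2"
  define fits where "fits = (\<lambda>r. CARD('m) + ((CARD('n) - r + 1) choose 2) \<le> ?N)"
  define \<rho> where "\<rho> = (LEAST r. fits r)"
  have fits_n: "fits CARD('n)" using assms by (simp add: fits_def binomial_eq_0)
  have fits: "fits \<rho>" unfolding \<rho>_def using fits_n by (rule LeastI)
  have \<rho>_le: "\<rho> \<le> CARD('n)" unfolding \<rho>_def using fits_n by (rule Least_le)
  have not_fits: "\<not> fits r" if "r < \<rho>" for r using that unfolding \<rho>_def by (rule not_less_Least)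
  obtain J0 :: "'n set" where J0: "card J0 = CARD('n) - \<rho>"
    using obtain_subset_with_card_n[of "CARD('n) - \<rho>" "UNIV :: 'n set"] by auto
  have card_J0': "card (- J0) = \<rho>" using J0 \<rho>_le by (simp add: Compl_eq_Diff_UNIV card_Diff_subset)
  let ?P = "cproj (- J0) :: real^'n^'n"
  obtain w0 :: "(real^'n^'n)^'m" where w0: "\<And>a. w0 $ a \<in> sym_mats" "gram_det w0 ?P \<noteq> 0"
    by (rule gram_det_nonzero_example[of J0, where 'm='m]) (use fits J0 in \<open>auto simp: fits_def\<close>)
  define large :: "'n set \<Rightarrow> bool" where
    "large = (\<lambda>J. CARD('m) < ?N \<and> ?N < CARD('m) + (card J choose 2))"
  have "\<exists>q :: (real^'n^'n)^'m \<Rightarrow> real. real_polynomial_function q \<and>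
      (\<exists>w. (\<forall>a. w $ a \<in> sym_mats) \<and> q w \<noteq> 0) \<and>
      (\<forall>v. (\<forall>a. v $ a \<in> sym_mats) \<longrightarrow> inj (comb v) \<longrightarrow> q v \<noteq> 0 \<longrightarrow> pd_face (range (comb v)) J \<longrightarrow>
         (\<exists>J'. card J' < card J \<and> pd_face (range (comb v)) J'))" if "large J" for J
    using that unfolding large_def by (intro generic_pd_face_smaller) auto
  then obtain q :: "'n set \<Rightarrow> (real^'n^'n)^'m \<Rightarrow> real" where
    q: "\<And>J. large J \<Longrightarrow> real_polynomial_function (q J)"
      "\<And>J. large J \<Longrightarrow> \<exists>w. (\<forall>a. w $ a \<in> sym_mats) \<and> q J w \<noteq> 0"
      "\<And>J v. large J \<Longrightarrow> \<forall>a. v $ a \<in> sym_mats \<Longrightarrow> inj (comb v) \<Longrightarrow> q J v \<noteq> 0 \<Longrightarrow>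
         pd_face (range (comb v)) J \<Longrightarrow> \<exists>J'. card J' < card J \<and> pd_face (range (comb v)) J'"
    by metis
  \<comment> \<open>Composition with the symmetrization turns a product of polynomials that are nonzero at symmetric
    tuples into one nonzero polynomial on all tuples.\<close>
  define sy :: "(real^'n^'n)^'m \<Rightarrow> (real^'n^'n)^'m" where
    "sy = (\<lambda>v. \<chi> a. (1/2) *\<^sub>R (v $ a + transpose (v $ a)))"
  have sy_sym: "sy v $ a \<in> sym_mats" for v a
    by (rule sym_matsI) (simp add: sy_def transpose_def)
  have sy_id: "sy v = v" if "\<forall>a. v $ a \<in> sym_mats" for v
  proof -
    have "v $ a + transpose (v $ a) = 2 *\<^sub>R v $ a" for a
      using that by (simp add: sym_mats_def scaleR_2)
    then show ?thesis by (simp add: sy_def vec_eq_iff)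
  qed
  have pf_sy: "polynomial_function sy" unfolding sy_def by (intro pf_intros real_polynomial_function.intros(2))
  define p where "p = (\<lambda>k v. case k of None \<Rightarrow> gram_det (sy v) ?P | Some J \<Rightarrow> q J (sy v))"
  let ?K = "insert None (Some ` {J. large J})"
  have fin: "finite ?K" by simp
  have rpf_p: "real_polynomial_function (p k)" if "k \<in> ?K" for k
  proof (cases k)
    case None
    then show ?thesis
      using rpf_gram_det[OF pf_sy polynomial_function_const[of ?P]] by (simp add: p_def)
  next
    case (Some J)
    then show ?thesis using rpf_compose[OF q(1) pf_sy, of J] that by (auto simp: p_def)
  qed
  have nz_p: "\<exists>x. p k x \<noteq> 0" if k: "k \<in> ?K" for k
  proof (cases k)
    case None
    then show ?thesis using w0 sy_id[of w0] by (intro exI[of _ w0]) (simp add: p_def)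
  next
    case (Some J)
    then obtain w where "\<forall>a. w $ a \<in> sym_mats" "q J w \<noteq> 0" using q(2)[of J] k by auto
    then show ?thesis using sy_id[of w] Some by (intro exI[of _ w]) (simp add: p_def)
  qed
  obtain x where x: "\<And>k. k \<in> ?K \<Longrightarrow> p k x \<noteq> 0"
    by (rule real_polynomial_function_prod_nonzero[of ?K p, OF fin rpf_p nz_p], assumption, assumption)
      (rule that)
  define w where "w = sy x"
  have gram_w: "gram_det w ?P \<noteq> 0" using x[of None] by (simp add: p_def w_def)
  have q_w: "q J w \<noteq> 0" if "large J" for J using x[of "Some J"] that by (simp add: p_def w_def)
  define Q where "Q = (\<lambda>v. gram_det v ?P * (\<Prod>J\<in>{J. large J}. q J v))"
  have Q_nonzero: "Q v \<noteq> 0 \<longleftrightarrow> gram_det v ?P \<noteq> 0 \<and> (\<forall>J. large J \<longrightarrow> q J v \<noteq> 0)" for v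
    by (auto simp: Q_def)
  have rpf_Q: "real_polynomial_function Q"
    unfolding Q_def
    by (intro real_polynomial_function.intros(4) real_polynomial_function_prod rpf_gram_det
        polynomial_function_id polynomial_function_const) (auto intro: q(1))
  have w_sym: "w $ a \<in> sym_mats" for a by (simp add: w_def sy_sym)
  have "Q w \<noteq> 0" using gram_w q_w Q_nonzero by simp
  then obtain E :: "(real^'n^'n) set set" where E: "zariski_closed_grassmannian TYPE('m) E"
    "E \<subset> grassmannian CARD('m)"
    "\<forall>L \<in> grassmannian CARD('m) - E.
       \<exists>v :: (real^'n^'n)^'m. (\<forall>a. v $ a \<in> sym_mats) \<and> inj (comb v) \<and> range (comb v) = L \<and> Q v \<noteq> 0"
    by (rule generic_basis[OF rpf_Q w_sym gram_det_nonzero_imp_inj[OF gram_w]])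
  have "MLT L = GCR L" if L: "L \<in> grassmannian CARD('m) - E" and pd: "L \<inter> pd_mats \<noteq> {}" for L
  proof -
    obtain v :: "(real^'n^'n)^'m" where v: "\<forall>a. v $ a \<in> sym_mats" "inj (comb v)" "range (comb v) = L" "Q v \<noteq> 0"
      using E(3) L by blast
    have subL: "subspace L" "dim L = CARD('m)" "L \<subseteq> sym_mats" using L by (auto simp: grassmannian_def)
    have gram: "gram_det v ?P \<noteq> 0" and qv: "\<And>J. large J \<Longrightarrow> q J v \<noteq> 0" using v(4) Q_nonzero by auto
    have "GCR L = \<rho>"
      unfolding GCR_def
    proof (rule Least_equality)
      show "full_dimensional_in L (orth_proj L ` {A \<in> sym_mats. rank A = \<rho>})"
        using full_dimensional_if_no_kernel[of v "- J0"] v gram gram_det_nonzero_iff[of v ?P] card_J0' by simp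
    next
      fix r assume "full_dimensional_in L (orth_proj L ` {A \<in> sym_mats. rank A = r})"
      then have "\<not> ?N < CARD('m) + ((CARD('n) - r + 1) choose 2)"
        using not_full_dimensional[OF v(2), of r] unfolding v(3) by blast
      then have "fits r" by (simp only: fits_def not_less)
      then show "\<rho> \<le> r" unfolding \<rho>_def by (rule Least_le)
    qed
    moreover have "MLT L = \<rho>"
      unfolding MLT_def
    proof (rule Least_equality)
      define U where "U = {S \<in> {S \<in> psd_mats. rank S = \<rho>}. \<exists>p \<in> {gram_det v}. p S \<noteq> 0}"
      have "real_polynomial_function (gram_det v)"
        using rpf_gram_det[OF polynomial_function_const[of v] polynomial_function_id] by simp
      then have "zariski_open_in {S \<in> psd_mats. rank S = \<rho>} U"
        unfolding zariski_open_in_def U_def by (intro exI[of _ "{gram_det v}"]) simp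
      moreover have "?P \<in> U" using gram card_J0' by (simp add: U_def cproj_psd rank_cproj)
      then have "U \<noteq> {}" by blast
      moreover have "MLE_exists L S" if S: "S \<in> U" for S
      proof (rule MLE_exists_if_no_kernel[OF subL(1) pd])
        show "S \<in> psd_mats" using S by (simp add: U_def)
        fix X assume X: "X \<in> L" "X ** S = 0"
        then obtain c where c: "X = comb v c" using v(3) by blast
        then have "c = 0" using X(2) S gram_det_nonzero_iff[of v S] by (simp add: U_def)
        then show "X = 0" by (simp add: c linear_0[OF linear_comb])
      qed
      ultimately show "\<exists>U. zariski_open_in {S \<in> psd_mats. rank S = \<rho>} U \<and> U \<noteq> {} \<and> (\<forall>S\<in>U. MLE_exists L S)"
        by blast
    next
      fix r
      assume "\<exists>U. zariski_open_in {S \<in> psd_mats. rank S = r} U \<and> U \<noteq> {} \<and> (\<forall>S\<in>U. MLE_exists L S)"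
      then obtain U where U: "zariski_open_in {S \<in> psd_mats. rank S = r} U" "U \<noteq> {}" "\<forall>S\<in>U. MLE_exists L S"
        by blast
      show "\<rho> \<le> r"
      proof (rule ccontr)
        assume "\<not> \<rho> \<le> r"
        then have r: "r < \<rho>" by simp
        then have nf: "?N < CARD('m) + ((CARD('n) - r + 1) choose 2)"
          using not_fits[OF r] by (simp add: fits_def)
        have r_n: "r < CARD('n)" using r \<rho>_le by simp
        obtain J where J: "pd_face L J" "card J + r \<le> CARD('n)"
        proof (cases "CARD('m) < ?N")
          case True
          obtain J where J: "pd_face L J" "\<not> large J"
          proof (rule small_pd_face[OF pd])
            fix J assume "large J" "pd_face L J"
            then show "\<exists>J'. card J' < card J \<and> pd_face L J'"
              using q(3)[OF _ v(1,2) qv] v(3) by simp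
          qed
          have "card J + r \<le> CARD('n)"
          proof (rule ccontr)
            assume "\<not> card J + r \<le> CARD('n)"
            then have "CARD('n) - r + 1 \<le> card J" using r_n by arith
            then have "(CARD('n) - r + 1) choose 2 \<le> card J choose 2" by (rule choose_two_mono)
            then show False using nf J(2) True by (simp add: large_def)
          qed
          then show ?thesis using that J(1) by blast
        next
          case False
          then have "L = sym_mats"
            using subspace_dim_equal[OF subL(1) subspace_sym_mats subL(3)] subL(2) by (simp add: dim_sym_mats)
          then have "pd_face L {i}" for i using pd_face_sym_mats by simp
          moreover have "card {i} + r \<le> CARD('n)" for i :: 'n using r_n by simp
          ultimately show ?thesis using that by blast
        qed
        obtain S where "S \<in> U" "\<not> MLE_exists L S"
          by (rule generic_MLE_fails[OF subL(1) J U(1,2)])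
        then show False using U(3) by blast
      qed
    qed
    ultimately show ?thesis by simp
  qed
  then show ?thesis using E(1,2) by blast
qed

end
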